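(* Let $k\ge 2$ be a fixed integer. For each $\alpha>0$ there is a constant $c_k=c_k(\alpha)$ such that the following hold as $n\to\infty$. (a) If $H$ is a $k$-uniform hypergraph on the vertex set $[kn]$ with $\delta_{k-1}(H)\ge\alpha n$, and $R$ is a random hypergraph with distribution $\mathbb{H}_k(kn,c_k n)$, then $H\cup R$ a.a.s. has a perfect matching. (b) If $H$ is a $k$-uniform hypergraph on the vertex set $[(k-1)n]$ with $\delta_{k-1}(H)\ge\alpha n$, and $R$ is a random hypergraph with distribution $\mathbb{H}_k((k-1)n,c_k n)$, then $H\cup R$ a.a.s. has a loose Hamilton cycle.
   Context: $[N]=\{1,\dots,N\}$. $\mathbb{H}_k(N,m)$ denotes the uniform distribution on $k$-uniform hypergraphs with vertex set $[N]$ and exactly $m$ edges. The degree of a set of vertices in a hypergraph is the number of edges containing that set; the minimum $(k-1)$-degree $\delta_{k-1}(H)$ is the minimum degree among all sets of $k-1$ vertices. $H\cup R$ is the hypergraph on the same vertex set whose edge set is the union of the edge sets. A perfect matching is a set of pairwise disjoint edges covering all vertices. A $k$-uniform loose cycle is a $k$-uniform hypergraph with a cyclic ordering of its vertices such that every edge consists of $k$ consecutive vertices and every pair of consecutive edges intersects in exactly one vertex; a loose Hamilton cycle of a hypergraph is a loose cycle, contained in it as a subhypergraph, that uses all of its vertices. (On $(k-1)n$ vertices such a cycle has $n$ edges $\{v_{(k-1)i},v_{(k-1)i+1},\dots,v_{(k-1)(i+1)}\}$, $0\le i<n$, for some ordering $v_0,\dots,v_{(k-1)n-1}$ of the vertices,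 with subscripts modulo $(k-1)n$.) A.a.s. (asymptotically almost surely) means with probability $1-o(1)$ as $n\to\infty$, for any sequence of hypergraphs $H=H_n$ satisfying the hypotheses, with $k$ and $\alpha$ fixed. Large quantities such as $c_k n$ are implicitly rounded to integers. *)

theory Defs
  imports "HOL-Probability.Probability"
begin

(* A hypergraph on an explicitly given vertex set V is represented by its set of edges, so the
   union of two hypergraphs on the same vertex set is the union of the edge sets. *)

definition uniform_hypergraph :: "nat \<Rightarrow> 'a set \<Rightarrow> 'a set set \<Rightarrow> bool" where
  "uniform_hypergraph k V E \<longleftrightarrow> (\<forall>e\<in>E. e \<subseteq> V \<and> card e = k)"

definition degree :: "'a set set \<Rightarrow> 'a set \<Rightarrow> nat" where
  "degree E S = card {e \<in> E. S \<subseteq> e}"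

(* Meaningful for finite V with j \<le> card V; otherwise this is a Min over an empty or an infinite
   family of sets. *)
definition min_degree :: "nat \<Rightarrow> 'a set \<Rightarrow> 'a set set \<Rightarrow> nat" where
  "min_degree j V E = Min (degree E ` {S. S \<subseteq> V \<and> card S = j})"

(* A probability distribution with the intended meaning when m \<le> (N choose k), as shown by
   set_pmf_random_hypergraph below; the value of pmf_of_set on the empty set is unspecified. *)
definition random_hypergraph :: "nat \<Rightarrow> nat \<Rightarrow> nat \<Rightarrow> nat set set pmf" where
  "random_hypergraph k N m = pmf_of_set {R. uniform_hypergraph k {1..N} R \<and> card R = m}"

definition perfect_matching :: "'a set \<Rightarrow> 'a set set \<Rightarrow> bool" where
  "perfect_matching V M \<longleftrightarrow> disjoint M \<and> \<Union>M = V"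

definition has_perfect_matching :: "'a set \<Rightarrow> 'a set set \<Rightarrow> bool" where
  "has_perfect_matching V E \<longleftrightarrow> (\<exists>M\<subseteq>E. perfect_matching V M)"

(* The i-th edge of the loose cycle with l edges along the cyclic ordering
   v 0, ..., v ((k - 1) * l - 1): the k consecutive vertices starting at position (k - 1) * i. *)
definition loose_edge :: "nat \<Rightarrow> nat \<Rightarrow> (nat \<Rightarrow> 'a) \<Rightarrow> nat \<Rightarrow> 'a set" where
  "loose_edge k l v i = (\<lambda>j. v (((k - 1) * i + j) mod ((k - 1) * l))) ` {..<k}"

(* For k \<ge> 2 and l \<ge> 3 the uniformity and the intersection condition follow from the form of the
   edges; they exclude the degenerate cases l = 1 and l = 2. *)
definition loose_cycle :: "nat \<Rightarrow> 'a set \<Rightarrow> 'a set set \<Rightarrow> bool" where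
  "loose_cycle k V C \<longleftrightarrow> uniform_hypergraph k V C \<and>
     (\<exists>l v. l > 0 \<and> bij_betw v {..<(k - 1) * l} V \<and> C = loose_edge k l v ` {..<l} \<and>
       (\<forall>i<l. card (loose_edge k l v i \<inter> loose_edge k l v (Suc i mod l)) = 1))"

definition has_loose_Hamilton_cycle :: "nat \<Rightarrow> 'a set \<Rightarrow> 'a set set \<Rightarrow> bool" where
  "has_loose_Hamilton_cycle k V E \<longleftrightarrow> (\<exists>C\<subseteq>E. loose_cycle k V C)"

lemma uniform_hypergraph_iff_subset:
  "uniform_hypergraph k V E \<longleftrightarrow> E \<subseteq> {e. e \<subseteq> V \<and> card e = k}"
  by (auto simp: uniform_hypergraph_def)

lemma finite_uniform_hypergraphs:
  fixes N :: nat
  shows "finite {R. uniform_hypergraph k {1..N} R \<and> card R = m}"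
  by (rule finite_subset[of _ "Pow (Pow {1..N})"]) (auto simp: uniform_hypergraph_def)

lemma card_uniform_hypergraphs:
  "card {R. uniform_hypergraph k {1..N} R \<and> card R = m} = (N choose k) choose m"
proof -
  have "finite {e. e \<subseteq> {1..N} \<and> card e = k}"
    by (rule finite_subset[of _ "Pow {1..N}"]) auto
  then show ?thesis
    unfolding uniform_hypergraph_iff_subset by (simp add: n_subsets)
qed

lemma set_pmf_random_hypergraph:
  assumes "m \<le> (N choose k)"
  shows "set_pmf (random_hypergraph k N m) = {R. uniform_hypergraph k {1..N} R \<and> card R = m}"
proof -
  have "{R. uniform_hypergraph k {1..N} R \<and> card R = m} \<noteq> {}"
    using card_uniform_hypergraphs[of k N m] assms
    by (metis card.empty zero_less_binomial less_irrefl)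
  then show ?thesis
    unfolding random_hypergraph_def using finite_uniform_hypergraphs by (rule set_pmf_of_set)
qed

end

theory Submission
  imports Defs "HOL-Real_Asymp.Real_Asymp"
begin

text \<open>
  No step of the argument exposes the random edges one after the other. All that is used of \<open>R\<close> is
  that it meets every member of a collection of at most \<open>exp (C n)\<close> families of \<open>k\<close>-sets, each of
  positive density \<open>q\<close>; a union bound gives this for \<open>c > C / q\<close>. The families are the transversals of
  \<open>k\<close> disjoint sets of linear size, and, for a small set \<open>W\<close> and a set \<open>Y\<close> of vertices, the \<open>k\<close>-sets avoiding
  \<open>W\<close> into which a positive proportion of the vertices \<open>v \<in> Y\<close> can be swapped, i.e. which have a
  vertex \<open>b\<close> whose replacement by \<open>v\<close> gives an edge of \<open>H\<close>. Both are indexed by tuples of subsets of the vertex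
  set, hence exponential in number.

  Perfect matchings: \<open>R\<close> contains a small matching (the reserve) such that all but few vertices can be
  swapped into linearly many of its edges. The exceptional vertices are covered by edges of \<open>H\<close>, and a maximal
  extension by edges of \<open>R\<close> leaves few vertices. Any \<open>k\<close> of these are swapped into \<open>k\<close>
  reserve edges in such a way that the \<open>k\<close> released vertices form an edge of \<open>R\<close>.

  Loose Hamilton cycles: fix a set of joints that meets all neighbourhoods in \<open>H\<close> of \<open>(k - 1)\<close>-sets, put
  the joints in a cyclic order that contains the reserve edges, and call a pair of neighbouring joints bad
  if no edge has been placed there. A bad pair \<open>{u, w}\<close> is removed by a 3-opt move: two edges of
  \<open>H\<close> lead from \<open>u\<close> and \<open>w\<close> to joints \<open>x\<close> and \<open>y\<close> of linear choice, and the
  corresponding neighbours \<open>p\<close> and \<open>q\<close> are connected by an edge of \<open>R\<close>, whose interior comes from unplaced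
  vertices while there are many of them, and from swaps with the reserve afterwards. The interiors of the
  two broken edges become unplaced. So that enough unplaced vertices are left until the last bad pair
  is gone, two gadgets are kept open; closing a gadget places its \<open>k\<close> vertices by swaps alone.
\<close>

section \<open>Random hypergraphs hit dense families\<close>

text \<open>Linear codegree lets an edge be completed in its last vertex, but it gives no edge
  inside the few vertices that remain at the end. Swapping trades a fixed leftover vertex for one
  that may be chosen from a linear set, and \<open>k\<close> disjoint linear sets always have a
  transversal in \<open>R\<close>.

  The gadgets answer a counting problem. A 3-opt move needs \<open>3 * (k - 2)\<close> interior
  vertices before the broken edges return any, whereas in a cycle with all vertices counted a single
  bad pair leaves only \<open>k - 2\<close> of them. The three edges of a gadget have
  \<open>3 * k - 4\<close> vertices other than \<open>u\<close> and \<open>w\<close>, that is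
  \<open>k\<close> more than \<open>K\<close> and \<open>K'\<close> together. Two open gadgets thus
  leave \<open>2 * k\<close> vertices, which covers the missing \<open>2 * (k - 2)\<close> for every
  \<open>k\<close>.\<close>

definition ksets :: "nat \<Rightarrow> 'a set \<Rightarrow> 'a set set" where
  "ksets k V = {e. e \<subseteq> V \<and> card e = k}"

lemma finite_ksets: "finite V \<Longrightarrow> finite (ksets k V)"
  by (rule finite_subset[of _ "Pow V"]) (auto simp: ksets_def)

lemma card_ksets: "finite V \<Longrightarrow> card (ksets k V) = card V choose k"
  by (simp add: ksets_def n_subsets)

text \<open>The quotient of the two binomials is a product of \<open>m\<close> factors
  \<open>(T - g - i) / (T - i)\<close>, each at most \<open>(T - g) / T\<close>; the induction peels
  off the first one.\<close>

lemma choose_diff_le: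
  assumes "g \<le> T"
  shows "real ((T - g) choose m) \<le> (1 - real g / real T) ^ m * real (T choose m)"
  using assms
proof (induction m arbitrary: T)
  case 0
  then show ?case by simp
next
  case (Suc m)
  show ?case
  proof (cases "T = g")
    case True
    then show ?thesis by simp
  next
    case False
    then have T: "T \<ge> Suc 0" "g \<le> T - 1" using Suc.prems by auto
    have T0: "real T > 0" using T by simp
    have mono: "(1 - real g / real (T - 1)) \<le> 1 - real g / real T"
    proof (cases "T = 1")
      case True
      then show ?thesis using T by simp
    next
      case False
      then have "real (T - 1) > 0" using T by simp
      then show ?thesis using T by (simp add: frac_le)
    qed
    have nn: "0 \<le> 1 - real g / real (T - 1)"
    proof (cases "T = 1")
      case True
      then show ?thesis using T by simp
    next
      case False
      then show ?thesis using T by (simp add: divide_le_eq_1)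
    qed
    have e1: "real (Suc m) * real (T - g choose Suc m) = real (T - g) * real (T - g - 1 choose m)"
      using times_binomial_minus1_eq[of "Suc m" "T - g"]
      by (metis Suc_eq_plus1 add_diff_cancel_right' of_nat_mult zero_less_Suc)
    have e2: "real (Suc m) * real (T choose Suc m) = real T * real (T - 1 choose m)"
      using times_binomial_minus1_eq[of "Suc m" "T"]
      by (metis Suc_eq_plus1 add_diff_cancel_right' of_nat_mult zero_less_Suc)
    have ih: "real (T - g - 1 choose m) \<le> (1 - real g / real (T - 1)) ^ m * real (T - 1 choose m)"
      using Suc.IH[OF T(2)] by (simp add: diff_commute)
    have "real (Suc m) * real (T - g choose Suc m)
        \<le> real (T - g) * ((1 - real g / real T) ^ m * real (T - 1 choose m))"
      unfolding e1
      by (intro mult_left_mono order_trans[OF ih] mult_right_mono power_mono mono nn) auto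
    also have "\<dots> = (1 - real g / real T) ^ Suc m * (real T * real (T - 1 choose m))"
      using T0 Suc.prems by (simp add: of_nat_diff field_simps)
    also have "\<dots> = real (Suc m) * ((1 - real g / real T) ^ Suc m * real (T choose Suc m))"
      by (simp only: e2[symmetric] mult.left_commute)
    finally show ?thesis
      by (rule mult_left_le_imp_le) simp
  qed
qed

lemma prob_hits_all:
  assumes m: "m \<le> N choose k" and fin: "finite \<C>" and p: "p \<le> 1"
    and dense: "\<And>G. G \<in> \<C> \<Longrightarrow> G \<subseteq> ksets k {1..N} \<and> p * real (N choose k) \<le> real (card G)"
  shows "measure_pmf.prob (random_hypergraph k N m) {R. \<forall>G\<in>\<C>. R \<inter> G \<noteq> {}}
    \<ge> 1 - real (card \<C>) * (1 - p) ^ m"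
proof -
  let ?K = "ksets k {1..N}" and ?T = "N choose k"
  let ?S = "{R. uniform_hypergraph k {1..N} R \<and> card R = m}"
  let ?P = "measure_pmf.prob (random_hypergraph k N m)"
  have K: "finite ?K" "card ?K = ?T" by (simp_all add: finite_ksets card_ksets)
  have S: "?S = {R. R \<subseteq> ?K \<and> card R = m}"
    by (simp add: uniform_hypergraph_iff_subset ksets_def)
  have cS: "card ?S = ?T choose m" unfolding S using K by (simp add: n_subsets)
  have fS: "finite ?S" by (rule finite_uniform_hypergraphs)
  have neS: "?S \<noteq> {}" using cS m by (metis card.empty zero_less_binomial less_irrefl)
  have miss: "?P {R. R \<inter> G = {}} \<le> (1 - p) ^ m" if G: "G \<in> \<C>" for G
  proof (cases "?T = 0")
    case True
    then have "m = 0" using m by (metis le_zero_eq)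
    then show ?thesis by simp
  next
    case False
    have GK: "G \<subseteq> ?K" using dense[OF G] by auto
    then have gT: "card G \<le> ?T" using K card_mono by metis
    have "?S \<inter> {R. R \<inter> G = {}} = {R. R \<subseteq> ?K - G \<and> card R = m}" unfolding S by auto
    then have "card (?S \<inter> {R. R \<inter> G = {}}) = (?T - card G) choose m"
      using K GK finite_subset[OF GK] by (simp add: n_subsets card_Diff_subset)
    then have "?P {R. R \<inter> G = {}} = real ((?T - card G) choose m) / real (?T choose m)"
      unfolding random_hypergraph_def measure_pmf_of_set[OF neS fS] cS by (simp only:)
    also have "\<dots> \<le> (1 - real (card G) / real ?T) ^ m"
      using choose_diff_le[OF gT, of m] m by (simp add: divide_le_eq)
    also have "\<dots> \<le> (1 - p) ^ m"
      using dense[OF G] False gT by (intro power_mono) (auto simp: field_simps)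
    finally show ?thesis .
  qed
  have "{R. \<forall>G\<in>\<C>. R \<inter> G \<noteq> {}} = UNIV - (\<Union>G\<in>\<C>. {R. R \<inter> G = {}})" by auto
  moreover have "?P (UNIV - (\<Union>G\<in>\<C>. {R. R \<inter> G = {}})) = 1 - ?P (\<Union>G\<in>\<C>. {R. R \<inter> G = {}})"
    using measure_pmf.prob_compl[of "\<Union>G\<in>\<C>. {R. R \<inter> G = {}}" "random_hypergraph k N m"]
    by (simp only: space_measure_pmf sets_measure_pmf UNIV_I)
  moreover have "?P (\<Union>G\<in>\<C>. {R. R \<inter> G = {}}) \<le> (\<Sum>G\<in>\<C>. ?P {R. R \<inter> G = {}})"
    by (rule measure_pmf.finite_measure_subadditive_finite) (auto simp: fin)
  moreover have "\<dots> \<le> (\<Sum>G\<in>\<C>. (1 - p) ^ m)" by (rule sum_mono) (rule miss)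
  ultimately show ?thesis by simp
qed

text \<open>\<open>Nx xs\<close> is the set of entries allowed after \<open>xs\<close>. It depends
  on the whole prefix because the last entry of a swap sequence has to be a neighbour of earlier
  ones, which a product of fixed sets cannot express.\<close>

fun branches :: "('a list \<Rightarrow> 'a set) \<Rightarrow> nat \<Rightarrow> 'a list set" where
  "branches Nx 0 = {[]}"
| "branches Nx (Suc j) = (\<Union>xs\<in>branches Nx j. (\<lambda>x. xs @ [x]) ` Nx xs)"

lemma length_branches: "xs \<in> branches Nx j \<Longrightarrow> length xs = j"
  by (induction j arbitrary: xs) auto

lemma branches_nth:
  "xs \<in> branches Nx j \<Longrightarrow> i < j \<Longrightarrow> take i xs \<in> branches Nx i \<and> xs ! i \<in> Nx (take i xs)"
proof (induction j arbitrary: xs)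
  case (Suc j)
  then obtain ys x where xs: "xs = ys @ [x]" "ys \<in> branches Nx j" "x \<in> Nx ys" by auto
  have l: "length ys = j" using xs(2) by (rule length_branches)
  show ?case
  proof (cases "i = j")
    case True
    then show ?thesis using xs l by (simp add: nth_append)
  next
    case False
    then show ?thesis using Suc.IH[OF xs(2)] Suc.prems xs l by (simp add: nth_append)
  qed
qed simp

lemma distinct_branches:
  assumes "\<And>ys. Nx ys \<inter> set ys = {}" "xs \<in> branches Nx j"
  shows "distinct xs"
  using assms(2) by (induction j arbitrary: xs) (use assms(1) in fastforce)+

lemma card_branches:
  assumes "\<And>j xs. j < k \<Longrightarrow> xs \<in> branches Nx j \<Longrightarrow> finite (Nx xs) \<and> r \<le> real (card (Nx xs))"
    and "0 \<le> r"
  shows "finite (branches Nx k) \<and> r ^ k \<le> real (card (branches Nx k))"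
  using assms(1)
proof (induction k)
  case (Suc k)
  have ih: "finite (branches Nx k)" "r ^ k \<le> real (card (branches Nx k))"
    using Suc.IH Suc.prems by (metis less_SucI)+
  have N: "finite (Nx xs)" "r \<le> real (card (Nx xs))" if "xs \<in> branches Nx k" for xs
    using Suc.prems[OF lessI that] by auto
  have "card (branches Nx (Suc k)) = (\<Sum>xs\<in>branches Nx k. card ((\<lambda>x. xs @ [x]) ` Nx xs))"
    using ih N by (simp, intro card_UN_disjoint) auto
  also have "\<dots> = (\<Sum>xs\<in>branches Nx k. card (Nx xs))"
    by (intro sum.cong card_image) (auto simp: inj_on_def)
  finally have "real (card (branches Nx (Suc k))) = (\<Sum>xs\<in>branches Nx k. real (card (Nx xs)))"
    by simp
  also have "\<dots> \<ge> (\<Sum>xs\<in>branches Nx k. r)" by (intro sum_mono N)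
  also have "(\<Sum>xs\<in>branches Nx k. r) \<ge> r ^ Suc k"
    using mult_right_mono[OF ih(2) assms(2)] by (simp add: mult.commute)
  finally show ?case using ih N by auto
qed simp

text \<open>A set in \<open>G\<close> comes from at most \<open>k!\<close> of the at least
  \<open>r ^ k\<close> sequences. This factor is recovered from
  \<open>(N choose k) * k! \<le> N ^ k\<close> with \<open>N = card V\<close>, which leaves the
  clean density \<open>(r / N) ^ k\<close>.\<close>

lemma card_family_branches:
  fixes Nx :: "'a list \<Rightarrow> 'a set"
  assumes N: "\<And>j xs. j < k \<Longrightarrow> xs \<in> branches Nx j \<Longrightarrow> finite (Nx xs) \<and> r \<le> real (card (Nx xs))"
    and r: "0 \<le> r" and V: "finite V" "V \<noteq> {}" and G: "G \<subseteq> ksets k V"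
    and sub: "\<And>xs. xs \<in> branches Nx k \<Longrightarrow> distinct xs \<and> set xs \<in> G"
  shows "(r / real (card V)) ^ k * real (card V choose k) \<le> real (card G)"
proof -
  have B: "r ^ k \<le> real (card (branches Nx k))" using card_branches[of k Nx r] N r by blast
  have fG: "finite G" using finite_subset[OF G finite_ksets[OF V(1)]] .
  have "branches Nx k \<subseteq> (\<Union>e\<in>G. permutations_of_set e)"
    using sub by (auto simp: permutations_of_set_def)
  then have "card (branches Nx k) \<le> card (\<Union>e\<in>G. permutations_of_set e)"
    by (intro card_mono finite_UN_I fG) auto
  also have "\<dots> \<le> (\<Sum>e\<in>G. card (permutations_of_set e))" by (rule card_UN_le[OF fG])
  also have "\<dots> = (\<Sum>e\<in>G. fact k)"
    using G V(1) by (intro sum.cong refl, subst card_permutations_of_set)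
      (auto simp: ksets_def dest: finite_subset)
  finally have 1: "card (branches Nx k) \<le> card G * fact k" by simp
  have 2: "r ^ k \<le> real (card G) * fact k"
    using B of_nat_mono[OF 1, where 'a = real] by simp
  have 3: "real (card V choose k) * fact k \<le> real (card V) ^ k"
    using of_nat_mono[OF binomial_fact_pow[of "card V" k], where 'a = real] by simp
  have V0: "real (card V) > 0" using V by (simp add: card_gt_0_iff)
  have "(r / real (card V)) ^ k * real (card V choose k) * fact k
      \<le> (r / real (card V)) ^ k * real (card V) ^ k"
    using 3 r by (simp add: mult.assoc mult_left_mono)
  also have "\<dots> = r ^ k" using V0 by (simp add: power_divide)
  also have "\<dots> \<le> real (card G) * fact k" by (rule 2)
  finally show ?thesis by simp
qed

section \<open>Reserves\<close>

lemma card_Union_uniform: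
  assumes "\<And>f. f \<in> M \<Longrightarrow> card f = k" "card M \<le> s"
  shows "card (\<Union>M) \<le> k * s"
proof -
  have "card (\<Union>M) \<le> (\<Sum>f\<in>M. card f)" using card_Union_le_sum_card by blast
  also have "\<dots> = k * card M" using assms(1) by simp
  finally show ?thesis using assms(2) by (meson le_trans mult_le_mono2)
qed

text \<open>The greedy choice of \<open>M\<close> is controlled by the potential
  \<open>\<Sum>i. min g (number of edges of M in F i)\<close>: as long as more than \<open>b\<close> indices are short of \<open>g\<close>
  edges, one more edge raises it by at least \<open>\<rho> b\<close>.\<close>

lemma reserve_matching:
  fixes F :: "'i \<Rightarrow> 'a set set" and V :: "'a set"
  assumes V: "finite V" and R: "\<And>f. f \<in> R \<Longrightarrow> f \<subseteq> V \<and> card f = k" and k: "k > 0"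
    and Idx: "finite Idx"
    and hit: "\<And>W Y. W \<subseteq> V \<Longrightarrow> card W \<le> w \<Longrightarrow> Y \<subseteq> Idx \<Longrightarrow> Y \<noteq> {} \<Longrightarrow>
        \<exists>f\<in>R. f \<inter> W = {} \<and> \<rho> * real (card Y) \<le> real (card {i\<in>Y. f \<in> F i})"
    and pos: "\<rho> > 0" "b > 0" and s: "real g * real (card Idx) < \<rho> * b * real s" "k * s \<le> w"
  shows "\<exists>M\<subseteq>R. disjoint M \<and> finite M \<and> card M \<le> s \<and>
    real (card {i\<in>Idx. card {f\<in>M. f \<in> F i} < g}) \<le> b"
proof (rule ccontr)
  assume neg: "\<not> ?thesis"
  have "\<exists>M\<subseteq>R. disjoint M \<and> finite M \<and> card M = j \<and>
      \<rho> * b * real j \<le> real (\<Sum>i\<in>Idx. min g (card {f\<in>M. f \<in> F i}))" if "j \<le> s" for j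
    using that
  proof (induction j)
    case 0
    show ?case by (rule exI[of _ "{}"]) (simp add: sum_nonneg)
  next
    case (Suc j)
    then obtain M where M: "M \<subseteq> R" "disjoint M" "finite M" "card M = j"
      and big: "\<rho> * b * real j \<le> real (\<Sum>i\<in>Idx. min g (card {f\<in>M. f \<in> F i}))" by auto
    define Y where "Y = {i\<in>Idx. card {f\<in>M. f \<in> F i} < g}"
    have bY: "b < real (card Y)"
      using neg M Suc.prems unfolding Y_def by (meson Suc_leD leI)
    then have "Y \<noteq> {}" using pos by auto
    have "card (\<Union>M) \<le> k * s"
      using M R Suc.prems by (intro card_Union_uniform) auto
    then have "card (\<Union>M) \<le> w" using s(2) by linarith
    then obtain f where f: "f \<in> R" "f \<inter> \<Union>M = {}"
      and fY: "\<rho> * real (card Y) \<le> real (card {i\<in>Y. f \<in> F i})"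
      using hit[of "\<Union>M" Y] \<open>Y \<noteq> {}\<close> M R unfolding Y_def by blast
    have fM: "f \<notin> M"
    proof
      assume "f \<in> M"
      then have "f = {}" using f by blast
      then show False using R[OF f(1)] k by simp
    qed
    let ?c = "\<lambda>i. card {e\<in>M. e \<in> F i}" and ?c' = "\<lambda>i. card {e\<in>insert f M. e \<in> F i}"
    have c': "?c' i = ?c i + (if f \<in> F i then 1 else 0)" for i
    proof -
      have "{e\<in>insert f M. e \<in> F i} = (if f \<in> F i then insert f {e\<in>M. e \<in> F i} else {e\<in>M. e \<in> F i})"
        by auto
      then show ?thesis using fM M(3) by simp
    qed
    have "(\<Sum>i\<in>Idx. min g (?c i)) + card {i\<in>Y. f \<in> F i}
        = (\<Sum>i\<in>Idx. min g (?c i) + (if i \<in> Y \<and> f \<in> F i then 1 else 0))"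
    proof -
      have "{i\<in>Y. f \<in> F i} = {i\<in>Idx. i \<in> Y \<and> f \<in> F i}" by (auto simp: Y_def)
      then have "card {i\<in>Y. f \<in> F i} = (\<Sum>i\<in>Idx. if i \<in> Y \<and> f \<in> F i then 1 else 0)"
        using Idx by (simp add: sum.If_cases Int_def)
      then show ?thesis by (simp add: sum.distrib)
    qed
    also have "\<dots> \<le> (\<Sum>i\<in>Idx. min g (?c' i))"
      by (rule sum_mono, subst c') (auto simp: Y_def)
    finally have "real (\<Sum>i\<in>Idx. min g (?c i)) + real (card {i\<in>Y. f \<in> F i})
      \<le> real (\<Sum>i\<in>Idx. min g (?c' i))" by linarith
    moreover have "\<rho> * b \<le> \<rho> * real (card Y)" using bY pos by simp
    ultimately have "\<rho> * b * real (Suc j) \<le> real (\<Sum>i\<in>Idx. min g (?c' i))"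
      using big fY by (simp add: algebra_simps)
    moreover have "disjoint (insert f M)"
      using M(2) f(2) by (auto simp: disjoint_def pairwise_def disjnt_def)
    ultimately show ?case
      using M f fM by (intro exI[of _ "insert f M"]) auto
  qed
  then obtain M where "\<rho> * b * real s \<le> real (\<Sum>i\<in>Idx. min g (card {f\<in>M. f \<in> F i}))" by blast
  also have "\<dots> \<le> real (\<Sum>i\<in>Idx. g)" by (intro of_nat_mono sum_mono) auto
  also have "\<dots> = real g * real (card Idx)" by simp
  finally show False using s(1) by linarith
qed

text \<open>The quantifier over all \<open>A\<close> matters: the property is later applied to sets
  of vertices that a reserve, itself a subset of \<open>R\<close>, is able to release.\<close>

definition has_transversals :: "nat \<Rightarrow> real \<Rightarrow> 'a set \<Rightarrow> 'a set set \<Rightarrow> bool" where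
  "has_transversals k r V R \<longleftrightarrow> (\<forall>A. disjoint_family_on A {..<k} \<longrightarrow>
     (\<forall>j<k. A j \<subseteq> V \<and> r \<le> real (card (A j))) \<longrightarrow>
     (\<exists>a. (\<forall>j<k. a j \<in> A j) \<and> a ` {..<k} \<in> R))"

lemma transversals_dense:
  fixes A :: "nat \<Rightarrow> 'a set"
  assumes V: "finite V" "V \<noteq> {}" and r: "0 \<le> r" and A: "disjoint_family_on A {..<k}"
    "\<And>j. j < k \<Longrightarrow> A j \<subseteq> V \<and> r \<le> real (card (A j))"
  defines "G \<equiv> {a ` {..<k} | a. \<forall>j<k. a j \<in> A j}"
  shows "G \<subseteq> ksets k V" and "(r / real (card V)) ^ k * real (card V choose k) \<le> real (card G)"
proof -
  show G: "G \<subseteq> ksets k V"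
  proof
    fix e assume "e \<in> G"
    then obtain a where a: "e = a ` {..<k}" "\<forall>j<k. a j \<in> A j" unfolding G_def by auto
    have "inj_on a {..<k}"
      using a(2) A(1) by (auto simp: inj_on_def disjoint_family_on_def) (metis IntI empty_iff lessThan_iff)
    then show "e \<in> ksets k V" using a A(2) by (auto simp: ksets_def card_image)
  qed
  define Nx where "Nx = (\<lambda>xs :: 'a list. A (length xs))"
  show "(r / real (card V)) ^ k * real (card V choose k) \<le> real (card G)"
  proof (rule card_family_branches[OF _ r V G])
    fix j xs assume "j < k" "xs \<in> branches Nx j"
    then show "finite (Nx xs) \<and> r \<le> real (card (Nx xs))"
      using A(2)[of j] V length_branches[of xs Nx j] by (auto simp: Nx_def intro: finite_subset)
  next
    fix xs assume xs: "xs \<in> branches Nx k"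
    then have l: "length xs = k" by (rule length_branches)
    have n: "xs ! i \<in> A i" if "i < k" for i
      using branches_nth[OF xs that] l that by (simp add: Nx_def)
    have "distinct xs"
      unfolding distinct_conv_nth
      using n A(1) l by (auto simp: disjoint_family_on_def) (metis IntI empty_iff lessThan_iff)
    moreover have "set xs = (!) xs ` {..<k}" using l by (auto simp: set_conv_nth)
    ultimately show "distinct xs \<and> set xs \<in> G" using n unfolding G_def by auto
  qed
qed

text \<open>\<open>W\<close> stands for the vertices already in use and \<open>Y\<close> for the
  indices still short of edges. Uniformity in both allows an adaptive greedy choice, in which each
  new edge serves a fixed proportion of the current \<open>Y\<close>.\<close>

definition spreads :: "real \<Rightarrow> nat \<Rightarrow> 'a set \<Rightarrow> 'i set \<Rightarrow> ('i \<Rightarrow> 'a set set) \<Rightarrow> 'a set set \<Rightarrow> bool" where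
  "spreads \<rho> w V Idx F R \<longleftrightarrow> (\<forall>W Y. W \<subseteq> V \<longrightarrow> card W \<le> w \<longrightarrow> Y \<subseteq> Idx \<longrightarrow> Y \<noteq> {} \<longrightarrow>
     (\<exists>f\<in>R. f \<inter> W = {} \<and> \<rho> * real (card Y) \<le> real (card {i\<in>Y. f \<in> F i})))"

text \<open>Double counting of pairs \<open>(i, f)\<close> with \<open>f\<close> in
  \<open>F i\<close> and disjoint from \<open>W\<close>. A fraction \<open>p\<close> of all pairs is
  present; the \<open>k\<close>-sets serving less than \<open>p / 2\<close> of \<open>Y\<close>
  account for at most half of these, and every other \<open>k\<close>-set for at most
  \<open>card Y\<close> pairs.\<close>

lemma spread_family_dense:
  fixes F :: "'i \<Rightarrow> 'a set set"
  assumes V: "finite V" and Y: "finite Y" "Y \<noteq> {}" and p: "0 \<le> p"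
    and F: "\<And>i. i \<in> Y \<Longrightarrow> F i \<subseteq> ksets k V"
    and dens: "\<And>i. i \<in> Y \<Longrightarrow> p * real (card V choose k) \<le> real (card {f\<in>F i. f \<inter> W = {}})"
  shows "p / 2 * real (card V choose k)
    \<le> real (card {f\<in>ksets k V. f \<inter> W = {} \<and> p / 2 * real (card Y) \<le> real (card {i\<in>Y. f \<in> F i})})"
    (is "_ \<le> real (card ?G)")
proof -
  let ?K = "ksets k V"
  have K: "finite ?K" "card ?K = card V choose k" using V by (simp_all add: finite_ksets card_ksets)
  have y: "real (card Y) > 0" using Y by (simp add: card_gt_0_iff)
  have "p * real (card V choose k) * real (card Y) = (\<Sum>i\<in>Y. p * real (card V choose k))" by simp
  also have "\<dots> \<le> (\<Sum>i\<in>Y. real (card {f\<in>F i. f \<inter> W = {}}))" by (rule sum_mono) (rule dens)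
  also have "\<dots> = (\<Sum>i\<in>Y. \<Sum>f\<in>?K. if f \<in> F i \<and> f \<inter> W = {} then 1 else 0)"
  proof (rule sum.cong[OF refl])
    fix i assume "i \<in> Y"
    then have "{f\<in>F i. f \<inter> W = {}} = {f\<in>?K. f \<in> F i \<and> f \<inter> W = {}}" using F by auto
    then show "real (card {f\<in>F i. f \<inter> W = {}}) = (\<Sum>f\<in>?K. if f \<in> F i \<and> f \<inter> W = {} then 1 else 0)"
      using K by (simp add: sum.If_cases Int_def)
  qed
  also have "\<dots> = (\<Sum>f\<in>?K. \<Sum>i\<in>Y. if f \<in> F i \<and> f \<inter> W = {} then 1 else 0)" by (rule sum.swap)
  also have "\<dots> \<le> (\<Sum>f\<in>?K. (if f \<in> ?G then real (card Y) else 0) + p / 2 * real (card Y))"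
  proof (rule sum_mono)
    fix f assume f: "f \<in> ?K"
    have e: "(\<Sum>i\<in>Y. if f \<in> F i \<and> f \<inter> W = {} then 1 else 0)
        = (if f \<inter> W = {} then real (card {i\<in>Y. f \<in> F i}) else 0)"
      using Y by (simp add: sum.If_cases Int_def)
    have "real (card {i\<in>Y. f \<in> F i}) \<le> real (card Y)" using Y by (intro of_nat_mono card_mono) auto
    moreover have "0 \<le> p / 2 * real (card Y)" using p by simp
    ultimately show "(\<Sum>i\<in>Y. if f \<in> F i \<and> f \<inter> W = {} then 1 else 0)
        \<le> (if f \<in> ?G then real (card Y) else 0) + p / 2 * real (card Y)"
      unfolding e using f by auto
  qed
  also have "\<dots> = real (card ?G) * real (card Y) + real (card V choose k) * (p / 2 * real (card Y))"
    using K by (simp add: sum.distrib sum.If_cases Int_def)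
  finally have "p / 2 * real (card V choose k) * real (card Y) \<le> real (card ?G) * real (card Y)"
    by (simp add: algebra_simps)
  then show ?thesis using y by simp
qed

text \<open>A spread family is determined by a pair \<open>(W, Y)\<close>, a transversal family by a
  \<open>k\<close>-tuple of subsets of \<open>V\<close>; the two summands of the bound count
  these.\<close>

lemma hitting_collection:
  fixes F :: "'i \<Rightarrow> 'a set set"
  assumes V: "finite V" "V \<noteq> {}" and Idx: "finite Idx" and r: "0 \<le> r" and p: "0 \<le> p"
    and F: "\<And>i. i \<in> Idx \<Longrightarrow> F i \<subseteq> ksets k V"
    and dens: "\<And>i W. i \<in> Idx \<Longrightarrow> W \<subseteq> V \<Longrightarrow> card W \<le> w \<Longrightarrow>
       p * real (card V choose k) \<le> real (card {f\<in>F i. f \<inter> W = {}})"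
  shows "\<exists>\<C>. finite \<C> \<and> card \<C> \<le> 2 ^ (card V + card Idx) + 2 ^ (card V * k) \<and>
     (\<forall>G\<in>\<C>. G \<subseteq> ksets k V \<and>
        min (p / 2) ((r / real (card V)) ^ k) * real (card V choose k) \<le> real (card G)) \<and>
     (\<forall>R. (\<forall>G\<in>\<C>. R \<inter> G \<noteq> {}) \<longrightarrow> has_transversals k r V R \<and> spreads (p / 2) w V Idx F R)"
proof -
  let ?q = "min (p / 2) ((r / real (card V)) ^ k)" and ?T = "real (card V choose k)"
  define Gs where "Gs = (\<lambda>(W, Y). {f\<in>ksets k V. f \<inter> W = {} \<and> p / 2 * real (card Y) \<le> real (card {i\<in>Y. f \<in> F i})})"
  define Gt where "Gt = (\<lambda>A. {a ` {..<k} | a. \<forall>j<k. a j \<in> (A :: nat \<Rightarrow> 'a set) j})"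
  define P1 where "P1 = {(W, Y). W \<subseteq> V \<and> card W \<le> w \<and> Y \<subseteq> Idx \<and> Y \<noteq> {}}"
  define P2 where "P2 = {A \<in> {..<k} \<rightarrow>\<^sub>E Pow V. disjoint_family_on A {..<k} \<and> (\<forall>j<k. r \<le> real (card (A j)))}"
  have s1: "P1 \<subseteq> Pow V \<times> Pow Idx" and s2: "P2 \<subseteq> {..<k} \<rightarrow>\<^sub>E Pow V" by (auto simp: P1_def P2_def)
  have f1: "finite (Pow V \<times> Pow Idx)" and f2: "finite ({..<k} \<rightarrow>\<^sub>E Pow V)"
    using V Idx by (auto intro: finite_PiE)
  have fin: "finite P1" "finite P2" using finite_subset[OF s1 f1] finite_subset[OF s2 f2] by auto
  have "card P1 \<le> 2 ^ (card V + card Idx)"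
    using card_mono[OF f1 s1] V Idx by (simp add: card_cartesian_product card_Pow power_add)
  moreover have "card P2 \<le> 2 ^ (card V * k)"
    using card_mono[OF f2 s2] V by (simp add: card_PiE card_Pow power_mult)
  ultimately have "card (Gs ` P1 \<union> Gt ` P2) \<le> 2 ^ (card V + card Idx) + 2 ^ (card V * k)"
    using card_Un_le[of "Gs ` P1" "Gt ` P2"] card_image_le[OF fin(1), of Gs] card_image_le[OF fin(2), of Gt]
    by linarith
  moreover have "G \<subseteq> ksets k V \<and> ?q * ?T \<le> real (card G)" if "G \<in> Gs ` P1 \<union> Gt ` P2" for G
  proof -
    have "G \<subseteq> ksets k V \<and> (p / 2 * ?T \<le> real (card G) \<or> (r / real (card V)) ^ k * ?T \<le> real (card G))"
      using that
    proof
      assume "G \<in> Gs ` P1"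
      then obtain W Y where WY: "(W, Y) \<in> P1" and G: "G = Gs (W, Y)" by auto
      have Y: "finite Y" "Y \<noteq> {}" "Y \<subseteq> Idx" using WY Idx by (auto simp: P1_def intro: finite_subset)
      have "p / 2 * ?T \<le> real (card G)"
        unfolding G Gs_def prod.case
        by (rule spread_family_dense[OF V(1) Y(1,2) p]) (use WY Y(3) F dens in \<open>auto simp: P1_def\<close>)
      then show ?thesis unfolding G Gs_def by auto
    next
      assume "G \<in> Gt ` P2"
      then obtain A where A: "A \<in> P2" and G: "G = Gt A" by auto
      have "disjoint_family_on A {..<k}" "\<And>j. j < k \<Longrightarrow> A j \<subseteq> V \<and> r \<le> real (card (A j))"
        using A by (auto simp: P2_def PiE_def Pi_def)
      from transversals_dense[OF V r this] show ?thesis unfolding G Gt_def by blast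
    qed
    moreover have "?q * ?T \<le> p / 2 * ?T" "?q * ?T \<le> (r / real (card V)) ^ k * ?T"
      by (intro mult_right_mono; simp)+
    ultimately show ?thesis by linarith
  qed
  moreover have "has_transversals k r V R \<and> spreads (p / 2) w V Idx F R"
    if hit: "\<forall>G\<in>Gs ` P1 \<union> Gt ` P2. R \<inter> G \<noteq> {}" for R
  proof
    show "has_transversals k r V R"
      unfolding has_transversals_def
    proof (intro allI impI)
      fix A assume A: "disjoint_family_on A {..<k}" "\<forall>j<k. A j \<subseteq> V \<and> r \<le> real (card (A j))"
      \<comment> \<open>Only extensional functions are in \<open>P2\<close>, which keeps it finite;
        values of \<open>A\<close> outside \<open>{..<k}\<close> are irrelevant for
        transversals.\<close>
      define A' where "A' = restrict A {..<k}"
      have "A' \<in> P2" using A by (auto simp: P2_def A'_def disjoint_family_on_def)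
      then have "R \<inter> Gt A' \<noteq> {}" using hit by auto
      then show "\<exists>a. (\<forall>j<k. a j \<in> A j) \<and> a ` {..<k} \<in> R" by (auto simp: Gt_def A'_def)
    qed
    show "spreads (p / 2) w V Idx F R"
      unfolding spreads_def
    proof (intro allI impI)
      fix W Y assume "W \<subseteq> V" "card W \<le> w" "Y \<subseteq> Idx" "Y \<noteq> {}"
      then have "(W, Y) \<in> P1" by (simp add: P1_def)
      then have "R \<inter> Gs (W, Y) \<noteq> {}" using hit by blast
      then show "\<exists>f\<in>R. f \<inter> W = {} \<and> p / 2 * real (card Y) \<le> real (card {i\<in>Y. f \<in> F i})"
        by (auto simp: Gs_def)
    qed
  qed
  ultimately show ?thesis using fin by (intro exI[of _ "Gs ` P1 \<union> Gt ` P2"]) blast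
qed

text \<open>Greedy: the sets chosen earlier occupy at most \<open>(t - 1) * m\<close> elements, so
  \<open>m\<close> are left in the next \<open>G j\<close>. It makes the candidates for different
  positions disjoint, as \<open>has_transversals\<close> demands.\<close>

lemma disjoint_choice:
  assumes "finite J" "card J \<le> t" "\<And>j. j \<in> J \<Longrightarrow> finite (G j) \<and> t * m \<le> card (G j)"
  shows "\<exists>D. (\<forall>j\<in>J. D j \<subseteq> G j \<and> card (D j) = m) \<and> disjoint_family_on D J"
  using assms
proof (induction J rule: finite_induct)
  case (insert j J)
  then obtain D where D: "\<forall>i\<in>J. D i \<subseteq> G i \<and> card (D i) = m" "disjoint_family_on D J" by auto
  let ?U = "\<Union>i\<in>J. D i"
  have "card ?U \<le> (\<Sum>i\<in>J. card (D i))" by (rule card_UN_le[OF insert.hyps(1)])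
  also have "\<dots> = card J * m" using D by simp
  finally have U: "card ?U \<le> card J * m" .
  have fU: "finite ?U"
  proof (rule finite_UN_I[OF insert.hyps(1)])
    fix i assume "i \<in> J"
    then show "finite (D i)" using D(1) insert.prems(2)[of i] by (meson finite_subset insertCI)
  qed
  have "Suc (card J) * m \<le> t * m" using insert.prems(1) insert.hyps by (intro mult_right_mono) auto
  then have "m + card ?U \<le> card (G j)" using U insert.prems(2)[of j] by simp
  moreover have "card (G j) - card ?U \<le> card (G j - ?U)" by (rule diff_card_le_card_Diff[OF fU])
  ultimately have "m \<le> card (G j - ?U)" by linarith
  then obtain E where E: "E \<subseteq> G j - (\<Union>i\<in>J. D i)" "card E = m"
    by (meson obtain_subset_with_card_n)
  have "disjoint_family_on (D(j := E)) (insert j J)"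
    using D(2) E insert.hyps(2) by (auto simp: disjoint_family_on_def)
  moreover have "\<forall>i\<in>insert j J. (D(j := E)) i \<subseteq> G i \<and> card ((D(j := E)) i) = m"
    using D(1) E insert.hyps(2) by auto
  ultimately show ?case by (intro exI[of _ "D(j := E)"] conjI)
qed (auto simp: disjoint_family_on_def)

section \<open>Swap families\<close>

definition nbs :: "'a set set \<Rightarrow> 'a set \<Rightarrow> 'a set \<Rightarrow> 'a set" where
  "nbs H V S = {x \<in> V - S. insert x S \<in> H}"

text \<open>The head of \<open>xs\<close> is the vertex that \<open>v\<close> releases when it takes its place in the edge; \<open>D j\<close>
  prescribes where the \<open>j\<close>-th entry lies.\<close>

definition swap_family :: "nat \<Rightarrow> 'a set set \<Rightarrow> (nat \<Rightarrow> 'a set) \<Rightarrow> 'a \<Rightarrow> 'a set set" where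
  "swap_family k H D v = {set xs | xs. length xs = k \<and> distinct xs \<and> v \<notin> set xs \<and>
     (\<forall>j<k. xs ! j \<in> D j) \<and> insert v (set (tl xs)) \<in> H}"

lemma swap_family_ksets:
  assumes "\<And>j. j < k \<Longrightarrow> D j \<subseteq> V"
  shows "swap_family k H D v \<subseteq> ksets k V"
proof
  fix f assume "f \<in> swap_family k H D v"
  then obtain xs where xs: "f = set xs" "length xs = k" "distinct xs" "\<forall>j<k. xs ! j \<in> D j"
    unfolding swap_family_def by blast
  have "x \<in> V" if x: "x \<in> set xs" for x
  proof -
    obtain i where i: "i < length xs" "x = xs ! i" using x by (metis in_set_conv_nth)
    then show ?thesis using xs(2,4) assms[of i] by auto
  qed
  then show "f \<in> ksets k V" using xs distinct_card[OF xs(3)] by (auto simp: ksets_def)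
qed

text \<open>The entries are chosen in order and only the last one is constrained by
  \<open>H\<close>: at that point \<open>v\<close> and the entries after the head form a
  \<open>(k - 1)\<close>-set. The slack \<open>k + 1\<close> pays for excluding \<open>v\<close> and
  the earlier entries. The second conclusion serves to cover \<open>v\<close> by an edge of
  \<open>H\<close>, namely \<open>insert v (set (tl xs))\<close>, whose other vertices avoid
  \<open>W\<close>.\<close>

lemma swap_family_dense:
  fixes V :: "'a set"
  assumes V: "finite V" and k: "k \<ge> 2" and D: "\<And>j. j < k \<Longrightarrow> D j \<subseteq> V" and v: "v \<in> V" and r: "0 \<le> r"
    and big: "\<And>j. j < k - 1 \<Longrightarrow> r + real k + 1 \<le> real (card (D j - W))"
    and codeg: "\<And>S. S \<subseteq> V \<Longrightarrow> card S = k - 1 \<Longrightarrow> r + real k + 1 \<le> real (card (D (k - 1) \<inter> nbs H V S - W))"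
  shows "(r / real (card V)) ^ k * real (card V choose k)
      \<le> real (card {f \<in> swap_family k H D v. f \<inter> W = {}})"
    and "0 < r \<Longrightarrow> \<exists>xs. length xs = k \<and> distinct xs \<and> v \<notin> set xs \<and>
     (\<forall>j<k. xs ! j \<in> D j) \<and> insert v (set (tl xs)) \<in> H \<and> set xs \<inter> W = {}"
proof -
  define Nx where "Nx = (\<lambda>ys. (if length ys = k - 1 then D (k - 1) \<inter> nbs H V (insert v (set (tl ys)))
    else D (length ys)) - W - insert v (set ys))"
  have dj: "Nx ys \<inter> set ys = {}" for ys by (auto simp: Nx_def)
  have NxD: "Nx ys \<subseteq> D (length ys) - W - {v}" for ys by (auto simp: Nx_def)
  have nth: "xs ! i \<in> D i" "xs ! i \<notin> W" "xs ! i \<noteq> v"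
    if "xs \<in> branches Nx j" "i < j" for xs i j
  proof -
    have "xs ! i \<in> Nx (take i xs)" using branches_nth[OF that] by blast
    moreover have "length (take i xs) = i" using length_branches[OF that(1)] that(2) by simp
    ultimately have "xs ! i \<in> D i - W - {v}" using NxD[of "take i xs"] by (metis subsetD)
    then show "xs ! i \<in> D i" "xs ! i \<notin> W" "xs ! i \<noteq> v" by blast+
  qed
  have subV: "set xs \<subseteq> V" if "xs \<in> branches Nx j" "j \<le> k" for xs j
  proof
    fix x assume "x \<in> set xs"
    then obtain i where i: "i < length xs" "x = xs ! i" by (metis in_set_conv_nth)
    then have "i < j" using length_branches[OF that(1)] by simp
    then show "x \<in> V" using nth(1)[OF that(1)] D[of i] that(2) i by auto
  qed
  have vn: "v \<notin> set xs" if "xs \<in> branches Nx j" for xs j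
  proof
    assume "v \<in> set xs"
    then obtain i where i: "i < length xs" "v = xs ! i" by (metis in_set_conv_nth)
    then show False using nth(3)[OF that, of i] length_branches[OF that] by simp
  qed
  have Wn: "set xs \<inter> W = {}" if xsb: "xs \<in> branches Nx j" for xs j
  proof -
    have "x \<notin> W" if x: "x \<in> set xs" for x
    proof -
      obtain i where i: "i < length xs" "x = xs ! i" using x unfolding in_set_conv_nth by blast
      have "i < j" using i(1) length_branches[OF xsb] by simp
      then show ?thesis unfolding i(2) by (rule nth(2)[OF xsb])
    qed
    then show ?thesis by blast
  qed
  have br: "finite (Nx xs) \<and> r \<le> real (card (Nx xs))" if j: "j < k" "xs \<in> branches Nx j" for j xs
  proof -
    define B where "B = (if length xs = k - 1 then D (k - 1) \<inter> nbs H V (insert v (set (tl xs)))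
      else D (length xs)) - W"
    have l: "length xs = j" using length_branches[OF j(2)] .
    have B: "r + real k + 1 \<le> real (card B)" "B \<subseteq> V"
    proof -
      show "B \<subseteq> V" using D[of "length xs"] j l D[of "k - 1"] unfolding B_def by (auto split: if_splits)
      show "r + real k + 1 \<le> real (card B)"
      proof (cases "j = k - 1")
        case True
        have d: "distinct xs" using distinct_branches[OF dj j(2)] .
        have "card (insert v (set (tl xs))) = k - 1"
          using vn[OF j(2)] d l True k by (cases xs) (auto simp: distinct_card)
        moreover have "insert v (set (tl xs)) \<subseteq> V"
          using subV[OF j(2)] j v by (cases xs) auto
        ultimately show ?thesis using codeg l True by (simp add: B_def)
      next
        case False
        then show ?thesis using big[of j] j l by (simp add: B_def)
      qed
    qed
    have "card (insert v (set xs)) \<le> k + 1"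
      using card_length[of xs] l j card_insert_le_m1[of "k+1" "set xs" v] by simp
    then have "card B - (k + 1) \<le> card (B - insert v (set xs))"
      using diff_card_le_card_Diff[of "insert v (set xs)" B] by simp
    moreover have "Nx xs = B - insert v (set xs)" by (auto simp: Nx_def B_def)
    moreover have "finite B" using B V finite_subset by blast
    ultimately show ?thesis using B(1) by simp
  qed
  have full: "length xs = k \<and> distinct xs \<and> v \<notin> set xs \<and>
     (\<forall>j<k. xs ! j \<in> D j) \<and> insert v (set (tl xs)) \<in> H \<and> set xs \<inter> W = {}"
    if xs: "xs \<in> branches Nx k" for xs
  proof -
    have l: "length xs = k" using length_branches[OF xs] .
    let ?ys = "take (k - 1) xs"
    have last: "xs ! (k - 1) \<in> Nx ?ys" using branches_nth[OF xs, of "k - 1"] k by simp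
    have "xs = ?ys @ [xs ! (k - 1)]"
      using l k by (metis One_nat_def Suc_diff_Suc diff_zero lessI less_le_trans pos2 take_Suc_conv_app_nth take_all_iff order_refl)
    then have "tl xs = tl ?ys @ [xs ! (k - 1)]"
      using l k by (metis One_nat_def Suc_1 diff_is_0_eq length_0_conv length_take list.size(3) min.absorb2 not_less_eq_eq diff_le_self le_refl tl_append2)
    then have "insert v (set (tl xs)) = insert (xs ! (k - 1)) (insert v (set (tl ?ys)))" by auto
    also have "\<dots> \<in> H" using last l by (auto simp: Nx_def nbs_def)
    finally show ?thesis
      using l distinct_branches[OF dj xs] vn[OF xs] nth(1)[OF xs] Wn[OF xs] by simp
  qed
  have G: "{f \<in> swap_family k H D v. f \<inter> W = {}} \<subseteq> ksets k V"
    using swap_family_ksets[of k D V H v] D by auto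
  show "(r / real (card V)) ^ k * real (card V choose k)
      \<le> real (card {f \<in> swap_family k H D v. f \<inter> W = {}})"
    by (rule card_family_branches[OF br r V _ G]) (use v full in \<open>auto simp: swap_family_def\<close>)
  assume "0 < r"
  then have "0 < r ^ k" by simp
  also have "\<dots> \<le> real (card (branches Nx k))" using card_branches[of k Nx r] br r by blast
  finally have "branches Nx k \<noteq> {}" by auto
  then show "\<exists>xs. length xs = k \<and> distinct xs \<and> v \<notin> set xs \<and>
     (\<forall>j<k. xs ! j \<in> D j) \<and> insert v (set (tl xs)) \<in> H \<and> set xs \<inter> W = {}" using full by blast
qed

lemma swap_familyE:
  assumes "f \<in> swap_family k H D v" "k > 0"
  obtains b where "b \<in> f" "b \<in> D 0" "insert v (f - {b}) \<in> H"
proof -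
  from assms obtain xs where xs: "f = set xs" "length xs = k" "distinct xs" "\<forall>j<k. xs ! j \<in> D j"
    "insert v (set (tl xs)) \<in> H" by (auto simp: swap_family_def)
  then obtain b ys where "xs = b # ys" using assms(2) by (cases xs) auto
  then show ?thesis using that[of b] xs assms(2) by fastforce
qed

text \<open>Greedy. At most \<open>card Y\<close> edges are ever chosen, so obstacles of size up to
  \<open>w + k * card Y\<close> suffice in \<open>ex\<close>. One edge may cover several vertices of
  \<open>Y\<close>.\<close>

lemma cover_matching:
  fixes Y :: "'a set"
  assumes "finite Y" and Q: "\<And>e. e \<in> Q \<Longrightarrow> card e = k"
    and ex: "\<And>y W. y \<in> Y \<Longrightarrow> y \<notin> W \<Longrightarrow> finite W \<Longrightarrow> card W \<le> w + k * card Y \<Longrightarrow> W \<subseteq> W0 \<union> \<Union>Q \<Longrightarrow>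
       \<exists>e\<in>Q. y \<in> e \<and> e \<inter> W = {}"
    and W0: "finite W0" "card W0 \<le> w" "Y \<inter> W0 = {}"  and k: "k > 0"
  shows "\<exists>M\<subseteq>Q. disjoint M \<and> finite M \<and> card M \<le> card Y \<and> Y \<subseteq> \<Union>M \<and> \<Union>M \<inter> W0 = {}"
  using assms(1) ex W0(3)
proof (induction Y rule: finite_induct)
  case empty
  then show ?case by (intro exI[of _ "{}"]) auto
next
  case (insert y Y)
  have "\<exists>M\<subseteq>Q. disjoint M \<and> finite M \<and> card M \<le> card Y \<and> Y \<subseteq> \<Union>M \<and> \<Union>M \<inter> W0 = {}"
  proof (rule insert.IH)
    fix z W assume "z \<in> Y" "z \<notin> W" "finite W" "card W \<le> w + k * card Y" "W \<subseteq> W0 \<union> \<Union>Q"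
    then show "\<exists>e\<in>Q. z \<in> e \<and> e \<inter> W = {}"
      using insert.prems(1)[of z W] insert.hyps by simp
  qed (use insert.prems in auto)
  then obtain M where M: "M \<subseteq> Q" "disjoint M" "finite M" "card M \<le> card Y" "Y \<subseteq> \<Union>M" "\<Union>M \<inter> W0 = {}"
    by auto
  show ?case
  proof (cases "y \<in> \<Union>M")
    case True
    then show ?thesis using M insert.hyps by (intro exI[of _ M]) auto
  next
    case False
    have fe: "finite e" if "e \<in> M" for e using that M(1) Q k by (metis card.infinite less_irrefl subsetD)
    have "card (\<Union>M) \<le> k * card Y" using M Q by (intro card_Union_uniform) auto
    then have "card (W0 \<union> \<Union>M) \<le> w + k * card Y"
      using card_Un_le[of W0 "\<Union>M"] W0 by linarith
    then obtain e where e: "e \<in> Q" "y \<in> e" "e \<inter> (W0 \<union> \<Union>M) = {}"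
      using insert.prems(1)[of y "W0 \<union> \<Union>M"] insert.prems(2) insert.hyps M False W0(1) fe by auto
    have "disjoint (insert e M)"
      using M(2) e(3) by (auto simp: disjoint_def pairwise_def disjnt_def)
    moreover have "card (insert e M) \<le> card (insert y Y)"
      using M insert.hyps by (simp add: card_insert_if)
    ultimately show ?thesis
      using M e by (intro exI[of _ "insert e M"]) auto
  qed
qed

lemma has_transversals_mono:
  "has_transversals k r V R \<Longrightarrow> R \<subseteq> E \<Longrightarrow> r \<le> r' \<Longrightarrow> has_transversals k r' V E"
  unfolding has_transversals_def by (meson order_trans subsetD)

lemma has_transversalsD:
  assumes "has_transversals k r V R" "disjoint_family_on A {..<k}"
    "\<And>j. j < k \<Longrightarrow> A j \<subseteq> V" "\<And>j. j < k \<Longrightarrow> r \<le> real (card (A j))"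
  obtains a where "\<And>j. j < k \<Longrightarrow> a j \<in> A j" "a ` {..<k} \<in> R"
  using assms unfolding has_transversals_def by metis

lemma transversal_inside:
  assumes "has_transversals k r V R" "finite L" "L \<subseteq> V" "r \<le> real m" "k * m \<le> card L"
  obtains e where "e \<in> R" "e \<subseteq> L"
proof -
  obtain D where D: "\<forall>j\<in>{..<k}. D j \<subseteq> L \<and> card (D j) = m" "disjoint_family_on D {..<k}"
    using disjoint_choice[of "{..<k}" k "\<lambda>_. L" m] assms by auto
  obtain a where a: "\<And>j. j < k \<Longrightarrow> a j \<in> D j" "a ` {..<k} \<in> R"
    by (rule has_transversalsD[OF assms(1) D(2)]) (use D assms in auto)
  show thesis by (rule that[OF a(2)]) (use a(1) D in auto)
qed

section \<open>Perfect matchings\<close>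

lemma absorb_leftover:
  fixes V :: "'a set"
  assumes k: "k \<ge> 1" and V: "finite V" "k dvd card V" and E: "E \<subseteq> ksets k V"
    and tr: "has_transversals k r V E" and r: "r \<le> real m"
    and Mr: "finite Mr"
    and res: "\<And>v. v \<in> T \<Longrightarrow> g \<le> card {f\<in>Mr. f \<in> F v}"
    and swap: "\<And>v f. f \<in> F v \<Longrightarrow> \<exists>b\<in>f. insert v (f - {b}) \<in> E"
    and s: "k * m + s \<le> g"
    and M: "M \<subseteq> E" "disjoint M" "Mu \<subseteq> M" "Mu \<subseteq> Mr"
      "card (Mr - Mu) + card (V - \<Union>M) \<le> s" "V - \<Union>M \<subseteq> T"
  shows "has_perfect_matching V E"
  using M
proof (induction "card (V - \<Union>M)" arbitrary: M Mu rule: less_induct)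
  case less
  note M = less.prems
  have MK: "M \<subseteq> ksets k V" using M(1) E by (rule order_trans)
  have Vs: "e \<subseteq> V" "card e = k" if "e \<in> M" for e
    using subsetD[OF MK that] unfolding ksets_def by simp_all
  have UM: "\<Union>M \<subseteq> V" using Vs(1) by blast
  show ?case
  proof (cases "V - \<Union>M = {}")
    case True
    then have "perfect_matching V M" using M UM by (auto simp: perfect_matching_def)
    then show ?thesis using M by (auto simp: has_perfect_matching_def)
  next
    case False
    have "card (\<Union>M) = (\<Sum>e\<in>M. card e)"
      using M(2) V(1) by (intro card_Union_disjoint) (auto dest: Vs(1) finite_subset)
    also have "\<dots> = k * card M" using Vs by simp
    \<comment> \<open>Divisibility guarantees that a nonempty leftover contains a full batch of
      \<open>k\<close> vertices, so the process cannot get stuck with fewer.\<close>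
    finally have "k dvd card (V - \<Union>M)"
      using V UM by (simp add: card_Diff_subset finite_subset)
    then have "k \<le> card (V - \<Union>M)" using False V by (intro dvd_imp_le) (auto simp: card_gt_0_iff)
    then obtain L where L: "L \<subseteq> V - \<Union>M" "card L = k" by (meson obtain_subset_with_card_n)
    have fL: "finite L" using L V finite_subset by blast
    then obtain v where v: "bij_betw v {..<k} L" using L(2) ex_bij_betw_nat_finite[of L] by (auto simp: atLeast0LessThan)
    have vL: "v j \<in> V - \<Union>M" if "j < k" for j using v L that by (auto simp: bij_betw_def)
    have G: "finite {f\<in>Mu. f \<in> F (v j)} \<and> k * m \<le> card {f\<in>Mu. f \<in> F (v j)}" if "j \<in> {..<k}" for j
    proof -
      have "{f\<in>Mr. f \<in> F (v j)} \<subseteq> {f\<in>Mu. f \<in> F (v j)} \<union> (Mr - Mu)" by auto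
      then have "card {f\<in>Mr. f \<in> F (v j)} \<le> card ({f\<in>Mu. f \<in> F (v j)} \<union> (Mr - Mu))"
        using Mr M(4) by (intro card_mono) (auto intro: finite_subset)
      also have "\<dots> \<le> card {f\<in>Mu. f \<in> F (v j)} + card (Mr - Mu)" by (rule card_Un_le)
      finally have "g \<le> card {f\<in>Mu. f \<in> F (v j)} + card (Mr - Mu)"
        using res[of "v j"] vL[of j] M(6) that by fastforce
      then show ?thesis using s M(5) Mr M(4) finite_subset by fastforce
    qed
    obtain D where D: "\<forall>j\<in>{..<k}. D j \<subseteq> {f\<in>Mu. f \<in> F (v j)} \<and> card (D j) = m"
      "disjoint_family_on D {..<k}"
      using disjoint_choice[of "{..<k}" k "\<lambda>j. {f\<in>Mu. f \<in> F (v j)}" m] G by auto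
    have "\<exists>b. b \<in> f \<and> insert (v j) (f - {b}) \<in> E" if "j < k" "f \<in> D j" for j f
      using swap[of f "v j"] D that by auto
    then obtain b where b: "\<And>j f. j < k \<Longrightarrow> f \<in> D j \<Longrightarrow> b j f \<in> f \<and> insert (v j) (f - {b j f}) \<in> E"
      by metis
    have DM: "D j \<subseteq> M" if "j < k" for j using D M(3) that by auto
    have Mdis: "e = e'" if "e \<in> M" "e' \<in> M" "x \<in> e" "x \<in> e'" for e e' x
      using M(2) that by (auto simp: disjoint_def pairwise_def disjnt_def)
    \<comment> \<open>The vertices that \<open>v j\<close> can release. Distinct reserve edges are
      disjoint and so are the sets \<open>D j\<close>; hence the sets \<open>A j\<close> are
      disjoint and have \<open>m\<close> elements each.\<close>
    define A where "A j = b j ` D j" for j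
    have "disjoint_family_on A {..<k}"
      unfolding disjoint_family_on_def
    proof (intro ballI impI)
      fix i j assume ij: "i \<in> {..<k}" "j \<in> {..<k}" "i \<noteq> j"
      then have "D i \<inter> D j = {}" using D(2) by (auto simp: disjoint_family_on_def)
      then show "A i \<inter> A j = {}" using ij b DM Mdis unfolding A_def by (auto; metis IntI empty_iff subsetD)
    qed
    moreover have "A j \<subseteq> V \<and> r \<le> real (card (A j))" if "j < k" for j
    proof -
      have "inj_on (b j) (D j)" using b[OF that] DM[OF that] Mdis by (auto simp: inj_on_def) (metis subsetD)+
      then have "card (A j) = m" using D that by (simp add: A_def card_image)
      moreover have "A j \<subseteq> V" using b[OF that] DM[OF that] Vs by (auto simp: A_def)
      ultimately show ?thesis using r by simp
    qed
    ultimately obtain a where a: "\<And>j. j < k \<Longrightarrow> a j \<in> A j" "a ` {..<k} \<in> E"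
      using has_transversalsD[OF tr] by metis
    then have "\<exists>f. f \<in> D j \<and> a j = b j f" if "j < k" for j using that by (auto simp: A_def)
    then obtain f where f: "\<And>j. j < k \<Longrightarrow> f j \<in> D j \<and> a j = b j (f j)" by metis
    have fMj: "f j \<in> M" "f j \<in> Mu" "a j \<in> f j" "insert (v j) (f j - {a j}) \<in> E" if "j < k" for j
      using f[OF that] b[OF that] DM[OF that] D that by auto
    have fne: "f i \<noteq> f j" if "i < k" "j < k" "i \<noteq> j" for i j
      using f D(2) that by (auto simp: disjoint_family_on_def) (metis IntI empty_iff lessThan_iff)
    have vin: "v i \<noteq> v j" if "i < k" "j < k" "i \<noteq> j" for i j
      using v that by (auto simp: bij_betw_def inj_on_def)
    define h where "h j = insert (v j) (f j - {a j})" for j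
    let ?e = "a ` {..<k}"
    \<comment> \<open>The edges \<open>f j\<close> are replaced by their swapped versions
      \<open>h j\<close>, and the released vertices \<open>a j\<close> form the additional edge
      \<open>?e\<close>.\<close>
    define M' where "M' = (M - f ` {..<k}) \<union> h ` {..<k} \<union> {?e}"
    have aM: "a j \<in> \<Union>M" if "j < k" for j using fMj that by auto
    have aeq: "i = j" if "a i \<in> f j" "i < k" "j < k" for i j
      using that Mdis[OF fMj(1) fMj(1), of i j "a i"] fMj(3)[of i] fne by blast
    have vM: "v j \<notin> e" if "j < k" "e \<in> M" for j e using vL that by auto
    have d1: "e \<inter> h j = {}" if "e \<in> M - f ` {..<k}" "j < k" for e j
    proof -
      have "e \<inter> f j = {}" using that fMj(1)[of j] Mdis[of e "f j"] by (metis Diff_iff disjoint_iff image_eqI lessThan_iff)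
      then show ?thesis using vM[OF that(2)] that by (auto simp: h_def)
    qed
    have d2: "e \<inter> ?e = {}" if "e \<in> M - f ` {..<k}" for e
      using that fMj Mdis by (auto; metis image_eqI lessThan_iff)
    have d3: "h i \<inter> h j = {}" if "i < k" "j < k" "i \<noteq> j" for i j
    proof -
      have "f i \<inter> f j = {}" using that fMj(1) Mdis fne by (metis disjoint_iff)
      then show ?thesis using vM[OF that(1) fMj(1)[OF that(2)]] vM[OF that(2) fMj(1)[OF that(1)]] vin[OF that]
        by (auto simp: h_def)
    qed
    have d4: "h j \<inter> ?e = {}" if "j < k" for j
    proof -
      have "x \<notin> ?e" if "x \<in> h j" for x
      proof
        assume "x \<in> ?e"
        then obtain i where i: "i < k" "x = a i" by auto
        show False
        proof (cases "x = v j")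
          case True
          then show False using vM[OF \<open>j < k\<close> fMj(1)[OF i(1)]] fMj(3)[OF i(1)] i by auto
        next
          case False
          then have "x \<in> f j" "x \<noteq> a j" using that by (auto simp: h_def)
          then show False using aeq[of i j] i \<open>j < k\<close> by auto
        qed
      qed
      then show ?thesis by auto
    qed
    have "disjoint M'"
    proof (rule disjointI)
      fix p q assume pq: "p \<in> M'" "q \<in> M'" "p \<noteq> q"
      have M'E: "p \<in> M - f ` {..<k} \<or> (\<exists>i<k. p = h i) \<or> p = ?e" if "p \<in> M'" for p
        using that by (auto simp: M'_def)
      have mm: "p \<inter> q = {}" if "p \<in> M" "q \<in> M" using that pq(3) Mdis by blast
      show "p \<inter> q = {}"
        using M'E[OF pq(1)] M'E[OF pq(2)] pq(3) d1 d2 d3 d4 mm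
        by (elim disjE exE conjE) (simp_all add: Int_commute, metis+)
    qed
    moreover have "M' \<subseteq> E" using M(1) a(2) fMj(4) by (auto simp: M'_def h_def)
    moreover have "\<Union>M' = \<Union>M \<union> L"
    proof
      show "\<Union>M' \<subseteq> \<Union>M \<union> L" using fMj v aM by (auto simp: M'_def h_def bij_betw_def)
      have "x \<in> \<Union>M'" if "x \<in> e" "e \<in> M" for x e
      proof (cases "e \<in> f ` {..<k}")
        case False
        then show ?thesis using that by (auto simp: M'_def)
      next
        case True
        then obtain j where "j < k" "e = f j" by auto
        then show ?thesis using that by (cases "x = a j") (auto simp: M'_def h_def)
      qed
      moreover have "x \<in> \<Union>M'" if "x \<in> L" for x
        using that v by (auto simp: M'_def h_def bij_betw_def)
      ultimately show "\<Union>M \<union> L \<subseteq> \<Union>M'" by auto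
    qed
    ultimately have M': "disjoint M'" "M' \<subseteq> E" "V - \<Union>M' = (V - \<Union>M) - L" by auto
    have cL: "card (V - \<Union>M) = card (V - \<Union>M') + k"
      using M'(3) L fL card_Diff_subset[OF fL L(1)] card_mono[OF _ L(1)] V by simp
    define Mu' where "Mu' = Mu - f ` {..<k}"
    have "Mr - Mu' \<subseteq> (Mr - Mu) \<union> f ` {..<k}" by (auto simp: Mu'_def)
    then have "card (Mr - Mu') \<le> card ((Mr - Mu) \<union> f ` {..<k})" using Mr by (intro card_mono) auto
    also have "\<dots> \<le> card (Mr - Mu) + k"
      using card_Un_le[of "Mr - Mu" "f ` {..<k}"] card_image_le[of "{..<k}" f] by simp
    finally have "card (Mr - Mu') + card (V - \<Union>M') \<le> s" using M(5) cL by linarith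
    moreover have "Mu' \<subseteq> M'" "Mu' \<subseteq> Mr" using M(3,4) by (auto simp: Mu'_def M'_def)
    moreover have "card (V - \<Union>M') < card (V - \<Union>M)" using cL k by simp
    moreover have "V - \<Union>M' \<subseteq> T" using M(6) M'(3) by auto
    ultimately show ?thesis using less.hyps[of M' Mu'] M'(1,2) by blast
  qed
qed

text \<open>The reserve occupies at most \<open>k * s\<close> vertices and the edges covering
  exceptional vertices at most \<open>k * b\<close> more, hence the bound on \<open>w\<close>. In
  \<open>2 * k * m\<close>, one half pays for the reserve edges consumed by at most
  \<open>k * m\<close> leftover vertices, the other half provides the \<open>k\<close> disjoint sets
  of \<open>m\<close> candidates in each round.\<close>

lemma perfect_matching_of_hits:
  fixes V :: "'a set"
  assumes k: "k \<ge> 2" and V: "finite V" "k dvd card V" and H: "H \<subseteq> ksets k V" and R: "R \<subseteq> ksets k V"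
    and codeg: "\<And>S W. S \<subseteq> V \<Longrightarrow> card S = k - 1 \<Longrightarrow> finite W \<Longrightarrow> card W \<le> w \<Longrightarrow> real k + 2 \<le> real (card (nbs H V S - W))"
    and big: "real k + 2 + real w \<le> real (card V)"
    and tr: "has_transversals k (real m) V R"
    and sp: "spreads \<rho> w V V (swap_family k H (\<lambda>_. V)) R"
    and pos: "\<rho> > 0" "b > 0" and g: "2 * k * m \<le> g"
    and s: "real g * real (card V) < \<rho> * real b * real s" "k * s + k * b \<le> w"
  shows "has_perfect_matching V (H \<union> R)"
proof -
  have Rf: "f \<subseteq> V \<and> card f = k" if "f \<in> R" for f using that R by (auto simp: ksets_def)
  obtain M0 where M0: "M0 \<subseteq> R" "disjoint M0" "finite M0" "card M0 \<le> s"
    "real (card {i\<in>V. card {f\<in>M0. f \<in> swap_family k H (\<lambda>_. V) i} < g}) \<le> real b"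
    using reserve_matching[of V R k V w \<rho> "swap_family k H (\<lambda>_. V)" "real b" g s] sp V(1) Rf k pos s
    unfolding spreads_def by force
  define Y where "Y = {i\<in>V. card {f\<in>M0. f \<in> swap_family k H (\<lambda>_. V) i} < g}"
  have cM0: "card (\<Union>M0) \<le> k * s"
    using M0 Rf by (intro card_Union_uniform) auto
  have UM0: "\<Union>M0 \<subseteq> V" using M0 Rf by blast
  \<comment> \<open>Exceptional vertices inside the reserve are already covered; only the remaining
    ones need an edge of \<open>H\<close>.\<close>
  have "\<exists>M\<subseteq>H. disjoint M \<and> finite M \<and> card M \<le> card (Y - \<Union>M0) \<and> Y - \<Union>M0 \<subseteq> \<Union>M \<and> \<Union>M \<inter> \<Union>M0 = {}"
  proof (rule cover_matching[where w = "k * s" and k = k])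
    show "finite (Y - \<Union>M0)" using V by (simp add: Y_def)
    show "finite (\<Union>M0)" using UM0 V finite_subset by blast
    show "card (\<Union>M0) \<le> k * s" by (rule cM0)
    show "card e = k" if "e \<in> H" for e using that H by (auto simp: ksets_def)
    fix y W assume y: "y \<in> Y - \<Union>M0" "y \<notin> W" and W: "finite W" "card W \<le> k * s + k * card (Y - \<Union>M0)"
      "W \<subseteq> \<Union>M0 \<union> \<Union>H"
    have "card (Y - \<Union>M0) \<le> card Y" using V by (intro card_mono) (auto simp: Y_def)
    also have "\<dots> \<le> b" using M0(5) by (simp add: Y_def)
    finally have "k * card (Y - \<Union>M0) \<le> k * b" by simp
    then have cW: "card W \<le> w" using W(2) s(2) by linarith
    have yV: "y \<in> V" using y by (simp add: Y_def)
    have VW: "1 + real k + 1 \<le> real (card (V - W))"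
      using diff_card_le_card_Diff[OF W(1), of V] cW big by linarith
    have nV: "V \<inter> nbs H V S - W = nbs H V S - W" for S by (auto simp: nbs_def)
    have "\<exists>xs. length xs = k \<and> distinct xs \<and> y \<notin> set xs \<and> (\<forall>j<k. xs ! j \<in> V) \<and>
        insert y (set (tl xs)) \<in> H \<and> set xs \<inter> W = {}"
    proof (rule swap_family_dense(2)[OF V(1) k _ yV])
      fix S assume "S \<subseteq> V" "card S = k - 1"
      then have "real k + 2 \<le> real (card (nbs H V S - W))" by (rule codeg[OF _ _ W(1) cW])
      then show "1 + real k + 1 \<le> real (card (V \<inter> nbs H V S - W))" unfolding nV by linarith
    qed (use VW in \<open>simp_all add: algebra_simps\<close>)
    then obtain xs where xs: "length xs = k" "y \<notin> set xs" "insert y (set (tl xs)) \<in> H" "set xs \<inter> W = {}"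
      by blast
    have "set (tl xs) \<subseteq> set xs" by (cases xs) auto
    then show "\<exists>e\<in>H. y \<in> e \<and> e \<inter> W = {}" using xs y by (intro bexI[of _ "insert y (set (tl xs))"]) auto
  qed (use k in auto)
  then obtain MY where MY: "MY \<subseteq> H" "disjoint MY" "Y - \<Union>M0 \<subseteq> \<Union>MY" "\<Union>MY \<inter> \<Union>M0 = {}" by auto
  let ?E = "H \<union> R"
  have E: "?E \<subseteq> ksets k V" using H R by auto
  define MS where "MS = {M. M \<subseteq> ?E \<and> disjoint M \<and> M0 \<union> MY \<subseteq> M}"
  have fE: "finite ?E" using E finite_ksets[OF V(1)] finite_subset by blast
  have "disjoint (M0 \<union> MY)"
    using M0(2) MY(2,4) by (intro disjoint_union) auto
  then have "M0 \<union> MY \<in> MS" using M0(1) MY(1) by (auto simp: MS_def)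
  moreover have "\<forall>M. M \<in> MS \<longrightarrow> card M < Suc (card ?E)"
    using fE by (simp add: MS_def card_mono less_Suc_eq_le)
  ultimately have "\<exists>M. M \<in> MS \<and> (\<forall>M'. M' \<in> MS \<longrightarrow> card M' \<le> card M)"
    by (rule ex_has_greatest_nat)
  then obtain M where M: "M \<in> MS" and max: "\<And>M'. M' \<in> MS \<Longrightarrow> card M' \<le> card M" by blast
  have noR: "\<not> e \<subseteq> V - \<Union>M" if e: "e \<in> R" for e
  proof
    assume sub: "e \<subseteq> V - \<Union>M"
    have "e \<noteq> {}" using Rf[OF e] k by auto
    then have "e \<notin> M" using sub by auto
    moreover have "insert e M \<in> MS"
      using M e sub unfolding MS_def by (auto simp: disjoint_def pairwise_def disjnt_def) 
    then have "card (insert e M) \<le> card M" by (rule max)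
    moreover have "finite M" using M fE by (auto simp: MS_def intro: finite_subset)
    ultimately show False by simp
  qed
  have L: "card (V - \<Union>M) \<le> k * m"
  proof (rule ccontr)
    assume "\<not> ?thesis"
    then obtain e where "e \<in> R" "e \<subseteq> V - \<Union>M"
      using transversal_inside[OF tr, of "V - \<Union>M" m] V by auto
    then show False using noR by blast
  qed
  have "Y \<subseteq> \<Union>M"
  proof
    fix y assume "y \<in> Y"
    then have "y \<in> \<Union>M0 \<union> \<Union>MY" using MY(3) by blast
    moreover have "M0 \<union> MY \<subseteq> M" using M by (simp add: MS_def)
    ultimately show "y \<in> \<Union>M" by blast
  qed
  then have YM: "V - \<Union>M \<subseteq> V - Y" by blast
  show ?thesis
  proof (rule absorb_leftover[where T = "V - Y" and Mr = M0 and M = M and Mu = M0 and s = "k * m" and g = g and m = m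
        and r = "real m" and F = "swap_family k H (\<lambda>_. V)" and k = k])
    show "has_transversals k (real m) V ?E" using has_transversals_mono[OF tr, of ?E "real m"] by simp
    show "g \<le> card {f\<in>M0. f \<in> swap_family k H (\<lambda>_. V) v}" if "v \<in> V - Y" for v
      using that by (auto simp: Y_def)
    show "\<exists>b\<in>f. insert v (f - {b}) \<in> ?E" if "f \<in> swap_family k H (\<lambda>_. V) v" for v f
      using swap_familyE[OF that] k by (metis Un_iff less_le_trans pos2)
  qed (use k V E M0 g M L YM in \<open>simp_all add: MS_def\<close>)
qed

section \<open>Cyclic orderings\<close>

fun pedges :: "'a list \<Rightarrow> 'a set set" where
  "pedges [] = {}"
| "pedges [x] = {}"
| "pedges (x # y # zs) = insert {x, y} (pedges (y # zs))"

text \<open>Pairs are unordered, so a cyclic ordering of two elements has a single pair, coming from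
  both directions; this is why counting pairs requires at least three elements.\<close>

definition cedges :: "'a list \<Rightarrow> 'a set set" where
  "cedges c = insert {last c, hd c} (pedges c)"

lemma pedges_append:
  "xs \<noteq> [] \<Longrightarrow> ys \<noteq> [] \<Longrightarrow> pedges (xs @ ys) = insert {last xs, hd ys} (pedges xs \<union> pedges ys)"
proof (induction xs rule: pedges.induct)
  case (2 x)
  then show ?case by (cases ys) auto
qed auto

lemma pedges_rev: "pedges (rev xs) = pedges xs"
proof (induction xs rule: pedges.induct)
  case (3 x y zs)
  have "pedges (rev (x # y # zs)) = pedges (rev (y # zs) @ [x])" by simp
  also have "\<dots> = insert {last (rev (y # zs)), hd [x]} (pedges (rev (y # zs)) \<union> pedges [x])"
    by (rule pedges_append) auto
  also have "\<dots> = pedges (x # y # zs)" using 3 by (simp add: insert_commute)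
  finally show ?case .
qed auto

lemma cedges_rotate: "xs \<noteq> [] \<Longrightarrow> ys \<noteq> [] \<Longrightarrow> cedges (xs @ ys) = cedges (ys @ xs)"
  by (auto simp: cedges_def pedges_append)

lemma cedges_rev: "c \<noteq> [] \<Longrightarrow> cedges (rev c) = cedges c"
  by (simp add: cedges_def pedges_rev last_rev hd_rev insert_commute)

lemma pedges_subset: "e \<in> pedges c \<Longrightarrow> e \<subseteq> set c"
  by (induction c rule: pedges.induct) auto

lemma cedges_subset: "c \<noteq> [] \<Longrightarrow> e \<in> cedges c \<Longrightarrow> e \<subseteq> set c"
  using pedges_subset[of e c] by (auto simp: cedges_def)

lemma finite_cedges: "finite (cedges c)"
proof -
  have "finite (pedges c)" by (induction c rule: pedges.induct) auto
  then show ?thesis by (simp add: cedges_def)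
qed

lemma pedges_nth: "pedges c = (\<lambda>i. {c ! i, c ! Suc i}) ` {i. Suc i < length c}"
proof (induction c rule: pedges.induct)
  case (3 x y zs)
  have "{i. Suc i < length (x # y # zs)} = insert 0 (Suc ` {i. Suc i < length (y # zs)})"
    by (auto simp: image_iff) (metis Suc_less_eq not0_implies_Suc)
  then show ?case using 3 by (simp add: image_image)
qed auto

lemma cedges_nth:
  assumes "c \<noteq> []"
  shows "cedges c = (\<lambda>i. {c ! i, c ! (Suc i mod length c)}) ` {..<length c}"
proof -
  let ?l = "length c"
  have l: "?l > 0" using assms by simp
  have e: "{..<?l} = insert (?l - 1) {i. Suc i < ?l}" using l by auto
  have "(\<lambda>i. {c ! i, c ! (Suc i mod ?l)}) ` {i. Suc i < ?l} = pedges c"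
    unfolding pedges_nth by (intro image_cong) auto
  moreover have "{c ! (?l - 1), c ! (Suc (?l - 1) mod ?l)} = {last c, hd c}"
    using assms l by (simp add: last_conv_nth hd_conv_nth)
  ultimately show ?thesis unfolding e cedges_def by simp
qed

lemma cyclic_pair_inj:
  assumes "distinct c" "3 \<le> length c"
  shows "inj_on (\<lambda>i. {c ! i, c ! (Suc i mod length c)}) {..<length c}"
proof (rule inj_onI)
  let ?l = "length c"
  fix i j assume ij: "i \<in> {..<?l}" "j \<in> {..<?l}"
    and e: "{c ! i, c ! (Suc i mod ?l)} = {c ! j, c ! (Suc j mod ?l)}"
  have "Suc i mod ?l < ?l" "Suc j mod ?l < ?l"
    using assms(2) by (intro mod_less_divisor; linarith)+
  then have "i = j \<or> (i = Suc j mod ?l \<and> Suc i mod ?l = j)"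
    using e ij assms(1) by (auto simp: doubleton_eq_iff nth_eq_iff_index_eq)
  then show "i = j"
    using ij assms(2) by (auto simp: mod_Suc split: if_splits)
qed

lemma card_cedges: "distinct c \<Longrightarrow> 3 \<le> length c \<Longrightarrow> card (cedges c) = length c"
  using card_image[OF cyclic_pair_inj[of c]] cedges_nth[of c] by fastforce

lemma cedges_doubleton:
  assumes "distinct c" "2 \<le> length c" "e \<in> cedges c"
  obtains u w where "e = {u, w}" "u \<noteq> w" "u \<in> set c" "w \<in> set c"
proof -
  have "c \<noteq> []" using assms by auto
  then obtain i where i: "i < length c" "e = {c ! i, c ! (Suc i mod length c)}"
    using assms(3) by (auto simp: cedges_nth)
  have "Suc i mod length c < length c" "i \<noteq> Suc i mod length c"
    using i(1) assms(2) by (auto simp: mod_Suc)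
  then show thesis using that[OF i(2)] i(1) assms(1) by (simp add: nth_eq_iff_index_eq)
qed

text \<open>Rotation brings the pair to the closing position and reversal fixes its direction. The
  pair to be removed can therefore always be taken as the one from the last entry to the first, and
  a move only has to cut the list into three segments.\<close>

lemma cedges_normal:
  assumes c: "distinct c" "c \<noteq> []" and e: "{u, w} \<in> cedges c"
  obtains d where "distinct d" "set d = set c" "cedges d = cedges c" "hd d = w" "last d = u" "d \<noteq> []"
proof -
  have "\<exists>d. distinct d \<and> set d = set c \<and> cedges d = cedges c \<and> {u, w} = {last d, hd d} \<and> d \<noteq> []"
  proof (cases "{u, w} = {last c, hd c}")
    case True
    then show ?thesis using c by blast
  next
    case False
    then obtain i where i: "Suc i < length c" "{u, w} = {c ! i, c ! Suc i}"
      using e by (auto simp: cedges_def pedges_nth)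
    let ?A = "take (Suc i) c" and ?B = "drop (Suc i) c"
    have ne: "?A \<noteq> []" "?B \<noteq> []" using i by auto
    have "cedges (?B @ ?A) = cedges c" using cedges_rotate[OF ne] by simp
    moreover have "set (?B @ ?A) = set c" "distinct (?B @ ?A)"
      by (metis append_take_drop_id set_append sup_commute)
        (use c(1) in \<open>metis append_take_drop_id distinct_append inf_commute\<close>)
    moreover have "last (?B @ ?A) = c ! i" "hd (?B @ ?A) = c ! Suc i"
      using i ne by (simp_all add: hd_drop_conv_nth take_Suc_conv_app_nth)
    ultimately show ?thesis using i(2) ne by (intro exI[of _ "?B @ ?A"]) auto
  qed
  then obtain d where d: "distinct d" "set d = set c" "cedges d = cedges c" "{u, w} = {last d, hd d}" "d \<noteq> []"
    by blast
  show thesis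
  proof (cases "w = hd d \<and> u = last d")
    case True
    then show thesis using that[of d] d by simp
  next
    case False
    then have "w = last d" "u = hd d" using d(4) by (auto simp: doubleton_eq_iff)
    then show thesis using that[of "rev d"] d by (simp add: cedges_rev hd_rev last_rev)
  qed
qed

section \<open>Three-opt moves on a cyclic ordering\<close>

lemma cedges_three:
  assumes "A \<noteq> []" "B \<noteq> []" "C \<noteq> []"
  shows "cedges (A @ B @ C) = {{last A, hd B}, {last B, hd C}, {last C, hd A}} \<union> (pedges A \<union> pedges B \<union> pedges C)"
  using assms by (auto simp: cedges_def pedges_append)

lemma ends_notin_pedges:
  assumes "distinct c" "3 \<le> length c"
  shows "{last c, hd c} \<notin> pedges c"
proof
  assume "{last c, hd c} \<in> pedges c"
  then obtain i where i: "Suc i < length c" "{last c, hd c} = {c ! i, c ! Suc i}"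
    by (auto simp: pedges_nth)
  have "last c = c ! (length c - 1)" "hd c = c ! 0" using assms(2) by (cases c; simp add: last_conv_nth hd_conv_nth)+
  moreover have l: "0 < length c" "length c - 1 < length c" using i by linarith+
  moreover have "c ! 0 = c ! i \<longleftrightarrow> i = 0"
    using nth_eq_iff_index_eq[OF assms(1) l(1), of i] i by simp
  ultimately show False using i assms by (auto simp: doubleton_eq_iff nth_eq_iff_index_eq)
qed

text \<open>In a 3-opt move the neighbour \<open>q\<close> that \<open>y\<close> loses is its
  predecessor if \<open>y\<close> does not come after \<open>x\<close>, and its successor otherwise.
  For every pair \<open>(p, q)\<close> of a product set to give a valid move, all pairs
  \<open>(x, y)\<close> must have the same relative order; cutting both index sets at a median of
  one of them achieves this at the cost of a factor 2.\<close>

lemma median_split: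
  fixes A B :: "nat set"
  assumes "finite A" "finite B" "2 * m \<le> card A" "2 * m \<le> card B"
  shows "\<exists>\<mu>. (m \<le> card {i\<in>A. \<mu> \<le> i} \<and> m \<le> card {j\<in>B. j \<le> \<mu>}) \<or>
             (m \<le> card {i\<in>A. i < \<mu>} \<and> m \<le> card {j\<in>B. \<mu> \<le> j})"
proof -
  have "\<exists>\<mu>. card {i\<in>A. i < \<mu>} \<ge> m"
  proof
    show "card {i\<in>A. i < Suc (Max A)} \<ge> m"
    proof -
      have "{i\<in>A. i < Suc (Max A)} = A" using assms(1) by (auto simp: less_Suc_eq_le)
      then show ?thesis using assms(3) by simp
    qed
  qed
  define \<mu> where "\<mu> = (LEAST \<mu>. card {i\<in>A. i < \<mu>} \<ge> m)"
  have 1: "m \<le> card {i\<in>A. i < \<mu>}" using \<open>\<exists>\<mu>. _\<close> unfolding \<mu>_def by (rule LeastI_ex)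
  have 2: "m \<le> card {i\<in>A. \<mu> \<le> i}"
  proof (cases \<mu>)
    case 0
    then show ?thesis using assms(3) by simp
  next
    case (Suc \<nu>)
    then have "card {i\<in>A. i < \<nu>} < m" unfolding \<mu>_def using not_less_Least by (metis lessI not_le)
    moreover have "{i\<in>A. i < \<mu>} \<subseteq> insert \<nu> {i\<in>A. i < \<nu>}" using Suc by auto
    then have "card {i\<in>A. i < \<mu>} \<le> Suc (card {i\<in>A. i < \<nu>})"
      using assms(1) card_mono[of "insert \<nu> {i\<in>A. i < \<nu>}" "{i\<in>A. i < \<mu>}"] by (simp add: card_insert_if)
    ultimately have "card {i\<in>A. i < \<mu>} \<le> m" by simp
    moreover have "A = {i\<in>A. i < \<mu>} \<union> {i\<in>A. \<mu> \<le> i}" by auto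
    then have "card A \<le> card {i\<in>A. i < \<mu>} + card {i\<in>A. \<mu> \<le> i}" by (metis card_Un_le)
    ultimately show ?thesis using assms(3) by simp
  qed
  have "B = {j\<in>B. j \<le> \<mu>} \<union> {j\<in>B. \<mu> \<le> j}" by auto
  then have "card B \<le> card {j\<in>B. j \<le> \<mu>} + card {j\<in>B. \<mu> \<le> j}" by (metis card_Un_le)
  then have "m \<le> card {j\<in>B. j \<le> \<mu>} \<or> m \<le> card {j\<in>B. \<mu> \<le> j}" using assms(4) by linarith
  then show ?thesis using 1 2 by blast
qed

lemma card_index_le:
  assumes "distinct c" "finite S" "inj f"
  shows "card {i. f i < length c \<and> c ! f i \<in> S} \<le> card S"
proof (rule card_inj_on_le[of "\<lambda>i. c ! f i"])
  show "inj_on (\<lambda>i. c ! f i) {i. f i < length c \<and> c ! f i \<in> S}"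
    using assms(1,3) by (auto simp: inj_on_def nth_eq_iff_index_eq)
qed (use assms in auto)

text \<open>A 3-opt move: the pairs \<open>{u, w}\<close>, \<open>{x, p}\<close>, \<open>{y, q}\<close> of neighbours are replaced by \<open>{u, x}\<close>,
  \<open>{w, y}\<close>, \<open>{p, q}\<close>.\<close>

definition reconnects :: "'a list \<Rightarrow> 'a list \<Rightarrow> 'a \<Rightarrow> 'a \<Rightarrow> 'a \<Rightarrow> 'a \<Rightarrow> 'a \<Rightarrow> 'a \<Rightarrow> bool" where
  "reconnects c d u w x y p q \<longleftrightarrow> distinct d \<and> set d = set c \<and>
     {u, x} \<in> cedges d \<and> {w, y} \<in> cedges d \<and> {p, q} \<in> cedges d \<and>
     {u, x} \<noteq> {w, y} \<and> {u, x} \<noteq> {p, q} \<and> {w, y} \<noteq> {p, q} \<and>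
     cedges c \<subseteq> cedges d \<union> {{u, w}, {x, p}, {y, q}} \<and>
     cedges d \<subseteq> (cedges c - {{u, w}}) \<union> {{u, x}, {w, y}, {p, q}}"

lemma reconnectsI:
  assumes "distinct d" "set d = set c" "cedges c = {{u, w}, {x, p}, {y, q}} \<union> P"
    "cedges d = {{u, x}, {w, y}, {p, q}} \<union> P" "{u, w} \<notin> P"
    "{u, x} \<noteq> {w, y}" "{u, x} \<noteq> {p, q}" "{w, y} \<noteq> {p, q}"
  shows "reconnects c d u w x y p q"
proof -
  have "cedges c \<subseteq> cedges d \<union> {{u, w}, {x, p}, {y, q}}"
    unfolding assms(3,4) by (simp add: subset_insertI2)
  moreover have "P \<subseteq> cedges c - {{u, w}}" unfolding assms(3) using assms(5) by blast
  then have "cedges d \<subseteq> (cedges c - {{u, w}}) \<union> {{u, x}, {w, y}, {p, q}}"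
    unfolding assms(4) by (simp add: subset_insertI2)
  ultimately show ?thesis unfolding reconnects_def using assms by simp
qed

text \<open>The order along the list is \<open>w .. q\<close>, \<open>y .. x\<close>,
  \<open>p .. u\<close>, one segment each. The new cycle runs \<open>p .. u\<close>,
  \<open>x .. y\<close>, \<open>w .. q\<close>, and \<open>q\<close> is joined back to
  \<open>p\<close>.\<close>

lemma reconnects_before:
  assumes "distinct (A @ B @ C)" "A \<noteq> []" "B \<noteq> []" "C \<noteq> []"
  shows "reconnects (A @ B @ C) (C @ rev B @ A) (last C) (hd A) (last B) (hd B) (hd C) (last A)"
proof -
  have h: "last C \<in> set C" "hd A \<in> set A" "last B \<in> set B" "hd B \<in> set B" "hd C \<in> set C" "last A \<in> set A"
    using assms by auto
  have dj: "set A \<inter> set B = {}" "set A \<inter> set C = {}" "set B \<inter> set C = {}" using assms(1) by auto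
  have l: "3 \<le> length (A @ B @ C)" using assms by (cases A; cases B; cases C) auto
  have "{last C, hd A} \<notin> pedges (A @ B @ C)" using ends_notin_pedges[OF assms(1) l] assms by simp
  then have nin: "{last C, hd A} \<notin> pedges A \<union> pedges B \<union> pedges C"
    using assms by (simp add: pedges_append)
  have ne: "{last C, last B} \<noteq> {hd A, hd B}" "{last C, last B} \<noteq> {hd C, last A}" "{hd A, hd B} \<noteq> {hd C, last A}"
    using h dj by (auto simp: doubleton_eq_iff)
  have e: "cedges (C @ rev B @ A) = {{last C, last B}, {hd B, hd A}, {last A, hd C}} \<union> (pedges A \<union> pedges B \<union> pedges C)"
    using cedges_three[of C "rev B" A] assms by (simp add: hd_rev last_rev pedges_rev Un_ac)
  have s: "set (C @ rev B @ A) = set (A @ B @ C)" "distinct (C @ rev B @ A)" using assms(1) by auto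
  show ?thesis
  proof (rule reconnectsI[OF s(2,1) _ _ nin])
    show "cedges (A @ B @ C) = {{last C, hd A}, {last B, hd C}, {hd B, last A}} \<union> (pedges A \<union> pedges B \<union> pedges C)"
      unfolding cedges_three[OF assms(2-4)] by (simp add: insert_commute)
    show "cedges (C @ rev B @ A) = {{last C, last B}, {hd A, hd B}, {hd C, last A}} \<union> (pedges A \<union> pedges B \<union> pedges C)"
      unfolding e by (simp add: insert_commute)
  qed (rule ne)+
qed

text \<open>The order along the list is \<open>w .. x\<close>, \<open>p .. y\<close>,
  \<open>q .. u\<close>, one segment each. The new cycle runs \<open>w .. x\<close>,
  \<open>u .. q\<close>, \<open>p .. y\<close>, and \<open>y\<close> is joined back to
  \<open>w\<close>.\<close>

lemma reconnects_after:
  assumes "distinct (A @ B @ C)" "A \<noteq> []" "B \<noteq> []" "C \<noteq> []"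
  shows "reconnects (A @ B @ C) (A @ rev C @ B) (last C) (hd A) (last A) (last B) (hd B) (hd C)"
proof -
  have h: "last C \<in> set C" "hd A \<in> set A" "last B \<in> set B" "hd B \<in> set B" "hd C \<in> set C" "last A \<in> set A"
    using assms by auto
  have dj: "set A \<inter> set B = {}" "set A \<inter> set C = {}" "set B \<inter> set C = {}" using assms(1) by auto
  have l: "3 \<le> length (A @ B @ C)" using assms by (cases A; cases B; cases C) auto
  have "{last C, hd A} \<notin> pedges (A @ B @ C)" using ends_notin_pedges[OF assms(1) l] assms by simp
  then have nin: "{last C, hd A} \<notin> pedges A \<union> pedges B \<union> pedges C"
    using assms by (simp add: pedges_append)
  have ne: "{last C, last A} \<noteq> {hd A, last B}" "{last C, last A} \<noteq> {hd B, hd C}" "{hd A, last B} \<noteq> {hd B, hd C}"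
    using h dj by (auto simp: doubleton_eq_iff)
  have e: "cedges (A @ rev C @ B) = {{last A, last C}, {hd C, hd B}, {last B, hd A}} \<union> (pedges A \<union> pedges B \<union> pedges C)"
    using cedges_three[of A "rev C" B] assms by (simp add: hd_rev last_rev pedges_rev Un_ac)
  have s: "set (A @ rev C @ B) = set (A @ B @ C)" "distinct (A @ rev C @ B)" using assms(1) by auto
  show ?thesis
  proof (rule reconnectsI[OF s(2,1) _ _ nin])
    show "cedges (A @ B @ C) = {{last C, hd A}, {last A, hd B}, {last B, hd C}} \<union> (pedges A \<union> pedges B \<union> pedges C)"
      unfolding cedges_three[OF assms(2-4)] by (simp add: insert_commute)
    show "cedges (A @ rev C @ B) = {{last C, last A}, {hd A, last B}, {hd B, hd C}} \<union> (pedges A \<union> pedges B \<union> pedges C)"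
      unfolding e by (simp add: insert_commute)
  qed (rule ne)+
qed

text \<open>Since \<open>p\<close> and \<open>q\<close> are neighbours of \<open>x\<close> and
  \<open>y\<close>, a linear choice of \<open>x\<close> and \<open>y\<close> becomes a linear choice
  of \<open>p\<close> and \<open>q\<close>, where an edge of \<open>R\<close> is available.
  \<open>Bd\<close> is to contain the vertices of protected pairs: \<open>x\<close> and
  \<open>y\<close> outside \<open>Bd\<close> make the broken pairs and the pairs
  \<open>{u, x}\<close>, \<open>{w, y}\<close> differ from all pairs inside \<open>Bd\<close>, and
  \<open>p \<notin> Bd\<close> does so for \<open>{p, q}\<close>.\<close>

lemma rotation:
  fixes c :: "'a list"
  assumes c: "distinct c" "c \<noteq> []" and e: "{u, w} \<in> cedges c"
    and Sx: "Sx \<subseteq> set c" "u \<notin> Sx" "2 * m + 2 * card Bd \<le> card Sx"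
    and Sy: "Sy \<subseteq> set c" "w \<notin> Sy" "2 * m + 3 * card Bd + 1 \<le> card Sy"
    and Bd: "finite Bd"
  obtains P Q where "P \<subseteq> set c" "Q \<subseteq> set c" "P \<inter> Q = {}" "m \<le> card P" "m \<le> card Q"
    "\<And>p q. p \<in> P \<Longrightarrow> q \<in> Q \<Longrightarrow>
      p \<notin> Bd \<and> (\<exists>x\<in>Sx - Bd. \<exists>y\<in>Sy - Bd. \<exists>d. reconnects c d u w x y p q)"
proof -
  obtain d where d: "distinct d" "set d = set c" "cedges d = cedges c" "hd d = w" "last d = u" "d \<noteq> []"
    using cedges_normal[OF c e] by blast
  let ?l = "length d"
  have d0: "d ! 0 = w" using d by (simp add: hd_conv_nth)
  have dl: "d ! (?l - 1) = u" using d by (simp add: last_conv_nth)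
  have rc: "reconnects c d' u w x y p q" if "reconnects d d' u w x y p q" for d' x y p q
    using that d unfolding reconnects_def by simp
  \<comment> \<open>An entry from \<open>Sx\<close> is lost if it or its successor lies in
    \<open>Bd\<close>; one from \<open>Sy\<close> if it or one of its two neighbours does, or if it
    is in the last position. This explains the multiples 2 and 3 of \<open>card Bd\<close> and the
    extra 1. As \<open>u\<close> is the last and \<open>w\<close> the first entry, elements of
    \<open>Sx\<close> have a successor and elements of \<open>Sy\<close> a predecessor.\<close>
  define Ai where "Ai = {i. d ! i \<in> Sx - Bd \<and> d ! Suc i \<notin> Bd \<and> Suc i < ?l}"
  define Bj where "Bj = {j. 0 < j \<and> d ! j \<in> Sy - Bd \<and> d ! (j - 1) \<notin> Bd \<and> d ! Suc j \<notin> Bd \<and> Suc j < ?l}"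
  have fA: "finite Ai" "finite Bj"
    unfolding Ai_def Bj_def by (auto intro: finite_subset[of _ "{..<?l}"])
  let ?B0 = "{i. i < ?l \<and> d ! i \<in> Bd}" and ?B1 = "{i. Suc i < ?l \<and> d ! Suc i \<in> Bd}"
  have fB: "finite ?B0" "finite ?B1" by (auto intro: finite_subset[of _ "{..<?l}"])
  have B0: "card ?B0 \<le> card Bd" using card_index_le[OF d(1) Bd, of id] by simp
  have B1: "card ?B1 \<le> card Bd" using card_index_le[OF d(1) Bd, of Suc] by simp
  have B2: "card (Suc ` ?B0) \<le> card Bd" using B0 by (simp add: card_image)
  have "2 * m \<le> card Ai"
  proof -
    have "Sx \<subseteq> (!) d ` (Ai \<union> ?B0 \<union> ?B1)"
    proof
      fix x assume x: "x \<in> Sx"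
      then obtain i where i: "i < ?l" "d ! i = x" using Sx d by (metis in_set_conv_nth subsetD)
      have "Suc i < ?l"
      proof (rule ccontr)
        assume "\<not> ?thesis"
        then have "i = ?l - 1" using i by simp
        then show False using dl i x Sx by simp
      qed
      then have "i \<in> Ai \<union> ?B0 \<union> ?B1" using i x by (auto simp: Ai_def)
      then show "x \<in> (!) d ` (Ai \<union> ?B0 \<union> ?B1)" unfolding i(2)[symmetric] by (rule imageI)
    qed
    moreover have "finite (Ai \<union> ?B0 \<union> ?B1)" using fA fB by simp
    ultimately have "card Sx \<le> card (Ai \<union> ?B0 \<union> ?B1)" by (rule surj_card_le[rotated])
    also have "\<dots> \<le> card Ai + card ?B0 + card ?B1" using card_Un_le[of "Ai \<union> ?B0" ?B1] card_Un_le[of Ai ?B0] by linarith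
    finally show ?thesis using B0 B1 Sx(3) by linarith
  qed
  moreover have "2 * m \<le> card Bj"
  proof -
    have "Sy \<subseteq> (!) d ` (Bj \<union> ?B0 \<union> ?B1 \<union> Suc ` ?B0 \<union> {?l - 1})"
    proof
      fix x assume x: "x \<in> Sy"
      then obtain i where i: "i < ?l" "d ! i = x" using Sy d by (metis in_set_conv_nth subsetD)
      have i0: "0 < i" using d0 i x Sy by (metis gr0I)
      have "i \<in> Bj \<union> ?B0 \<union> ?B1 \<union> Suc ` ?B0 \<union> {?l - 1}"
      proof (cases "i = ?l - 1")
        case False
        then have "Suc i < ?l" using i by simp
        moreover have "i \<in> Suc ` ?B0" if "d ! (i - 1) \<in> Bd"
          using that i i0 by (intro image_eqI[of _ _ "i - 1"]) auto
        ultimately show ?thesis using i x i0 by (auto simp: Bj_def)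
      qed simp
      then show "x \<in> (!) d ` (Bj \<union> ?B0 \<union> ?B1 \<union> Suc ` ?B0 \<union> {?l - 1})" unfolding i(2)[symmetric] by (rule imageI)
    qed
    moreover have "finite (Bj \<union> ?B0 \<union> ?B1 \<union> Suc ` ?B0 \<union> {?l - 1})" using fA fB by simp
    ultimately have "card Sy \<le> card (Bj \<union> ?B0 \<union> ?B1 \<union> Suc ` ?B0 \<union> {?l - 1})" by (rule surj_card_le[rotated])
    also have "\<dots> \<le> card Bj + card ?B0 + card ?B1 + card (Suc ` ?B0) + 1"
      using card_Un_le[of "Bj \<union> ?B0 \<union> ?B1 \<union> Suc ` ?B0" "{?l - 1}"] card_Un_le[of "Bj \<union> ?B0 \<union> ?B1" "Suc ` ?B0"]
        card_Un_le[of "Bj \<union> ?B0" ?B1] card_Un_le[of Bj ?B0] by simp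
    finally show ?thesis using B0 B1 B2 Sy(3) by linarith
  qed
  ultimately obtain \<mu> where \<mu>: "(m \<le> card {i\<in>Ai. \<mu> \<le> i} \<and> m \<le> card {j\<in>Bj. j \<le> \<mu>}) \<or>
             (m \<le> card {i\<in>Ai. i < \<mu>} \<and> m \<le> card {j\<in>Bj. \<mu> \<le> j})"
    using median_split[OF fA] by blast
  have neq: "d ! i \<noteq> d ! j" if "i < ?l" "j < ?l" "i \<noteq> j" for i j
    using that d(1) by (simp add: nth_eq_iff_index_eq)
  from \<mu> show thesis
  proof
    assume m: "m \<le> card {i\<in>Ai. \<mu> \<le> i} \<and> m \<le> card {j\<in>Bj. j \<le> \<mu>}"
    let ?P = "(\<lambda>i. d ! Suc i) ` {i\<in>Ai. \<mu> \<le> i}" and ?Q = "(\<lambda>j. d ! (j - 1)) ` {j\<in>Bj. j \<le> \<mu>}"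
    show thesis
    proof (rule that[of ?P ?Q])
      show "?P \<subseteq> set c" "?Q \<subseteq> set c" unfolding d(2)[symmetric] by (auto simp: Ai_def Bj_def)
      show "?P \<inter> ?Q = {}"
      proof -
        have "d ! Suc i \<noteq> d ! (j - 1)" if "i \<in> Ai" "\<mu> \<le> i" "j \<in> Bj" "j \<le> \<mu>" for i j
          using that by (intro neq) (auto simp: Ai_def Bj_def)
        then show ?thesis by blast
      qed
      have "card ?P = card {i\<in>Ai. \<mu> \<le> i}"
        using d(1) by (intro card_image) (auto simp: inj_on_def Ai_def nth_eq_iff_index_eq)
      then show "m \<le> card ?P" using m by simp
      have "card ?Q = card {j\<in>Bj. j \<le> \<mu>}"
        using d(1) by (intro card_image) (auto simp: inj_on_def Bj_def nth_eq_iff_index_eq)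
      then show "m \<le> card ?Q" using m by simp
      fix p q assume "p \<in> ?P" "q \<in> ?Q"
      \<comment> \<open>The case \<open>i = j\<close> is allowed: then \<open>x = y\<close>, and the
        move relocates this single vertex between \<open>u\<close> and \<open>w\<close>.\<close>
      then obtain i j where ij: "i \<in> Ai" "j \<in> Bj" "j \<le> i" "p = d ! Suc i" "q = d ! (j - 1)" by auto
      have ijl: "Suc i < ?l" "0 < j" using ij by (auto simp: Ai_def Bj_def)
      let ?A = "take j d" and ?B = "drop j (take (Suc i) d)" and ?C = "drop (Suc i) d"
      have dec: "d = ?A @ ?B @ ?C"
      proof -
        have "?A @ ?B = take (Suc i) d" using ij(3)
          by (metis append_take_drop_id le_SucI min.absorb1 take_take)
        then show ?thesis by (metis append.assoc append_take_drop_id)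
      qed
      have ne: "?A \<noteq> []" "?B \<noteq> []" "?C \<noteq> []" using ij ijl by auto
      have "reconnects d (?C @ rev ?B @ ?A) (last ?C) (hd ?A) (last ?B) (hd ?B) (hd ?C) (last ?A)"
        using reconnects_before[of ?A ?B ?C] dec d(1) ne by metis
      moreover have "last ?C = u" "hd ?A = w" using d ijl by simp_all
      moreover have "last ?B = d ! i" "hd ?B = d ! j" "hd ?C = p" "last ?A = q"
        using ij ijl ne by (simp_all add: last_conv_nth hd_conv_nth min_def)
      ultimately have "reconnects c (?C @ rev ?B @ ?A) u w (d ! i) (d ! j) p q"
        by (intro rc) (simp only:)
      moreover have "d ! i \<in> Sx - Bd" "d ! j \<in> Sy - Bd" "p \<notin> Bd"
        using ij unfolding Ai_def Bj_def by simp_all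
      ultimately show "p \<notin> Bd \<and> (\<exists>x\<in>Sx - Bd. \<exists>y\<in>Sy - Bd. \<exists>d. reconnects c d u w x y p q)"
        by blast
    qed
  next
    assume m: "m \<le> card {i\<in>Ai. i < \<mu>} \<and> m \<le> card {j\<in>Bj. \<mu> \<le> j}"
    let ?P = "(\<lambda>i. d ! Suc i) ` {i\<in>Ai. i < \<mu>}" and ?Q = "(\<lambda>j. d ! Suc j) ` {j\<in>Bj. \<mu> \<le> j}"
    show thesis
    proof (rule that[of ?P ?Q])
      show "?P \<subseteq> set c" "?Q \<subseteq> set c" unfolding d(2)[symmetric] by (auto simp: Ai_def Bj_def)
      show "?P \<inter> ?Q = {}"
      proof -
        have "d ! Suc i \<noteq> d ! Suc j" if "i \<in> Ai" "i < \<mu>" "j \<in> Bj" "\<mu> \<le> j" for i j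
          using that by (intro neq) (auto simp: Ai_def Bj_def)
        then show ?thesis by blast
      qed
      have "card ?P = card {i\<in>Ai. i < \<mu>}"
        using d(1) by (intro card_image) (auto simp: inj_on_def Ai_def nth_eq_iff_index_eq)
      then show "m \<le> card ?P" using m by simp
      have "card ?Q = card {j\<in>Bj. \<mu> \<le> j}"
        using d(1) by (intro card_image) (auto simp: inj_on_def Bj_def nth_eq_iff_index_eq)
      then show "m \<le> card ?Q" using m by simp
      fix p q assume "p \<in> ?P" "q \<in> ?Q"
      then obtain i j where ij: "i \<in> Ai" "j \<in> Bj" "i < j" "p = d ! Suc i" "q = d ! Suc j" by auto
      have ijl: "Suc j < ?l" "Suc i < ?l" using ij by (auto simp: Ai_def Bj_def)
      let ?A = "take (Suc i) d" and ?B = "drop (Suc i) (take (Suc j) d)" and ?C = "drop (Suc j) d"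
      have dec: "d = ?A @ ?B @ ?C"
      proof -
        have "?A @ ?B = take (Suc j) d" using ij(3)
          by (metis append_take_drop_id Suc_le_mono less_imp_le min.absorb1 take_take)
        then show ?thesis by (metis append.assoc append_take_drop_id)
      qed
      have ne: "?A \<noteq> []" "?B \<noteq> []" "?C \<noteq> []" using ij ijl by auto
      have "reconnects d (?A @ rev ?C @ ?B) (last ?C) (hd ?A) (last ?A) (last ?B) (hd ?B) (hd ?C)"
        using reconnects_after[of ?A ?B ?C] dec d(1) ne by metis
      moreover have "last ?C = u" "hd ?A = w" using d ijl by simp_all
      moreover have "last ?A = d ! i" "last ?B = d ! j" "hd ?B = p" "hd ?C = q"
        using ij ijl ne by (simp_all add: last_conv_nth hd_conv_nth min_def)
      ultimately have "reconnects c (?A @ rev ?C @ ?B) u w (d ! i) (d ! j) p q"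
        by (intro rc) (simp only:)
      moreover have "d ! i \<in> Sx - Bd" "d ! j \<in> Sy - Bd" "p \<notin> Bd"
        using ij unfolding Ai_def Bj_def by simp_all
      ultimately show "p \<notin> Bd \<and> (\<exists>x\<in>Sx - Bd. \<exists>y\<in>Sy - Bd. \<exists>d. reconnects c d u w x y p q)"
        by blast
    qed
  qed
qed

lemma ordering_with_pairs:
  assumes "finite \<P>" "finite X" "disjoint \<P>" "\<And>g. g \<in> \<P> \<Longrightarrow> g \<subseteq> X \<and> card g = 2"
  shows "\<exists>c. distinct c \<and> set c = X \<and> \<P> \<subseteq> pedges c"
  using assms
proof (induction \<P> arbitrary: X rule: finite_induct)
  case empty
  then show ?case using finite_distinct_list[of X] by auto
next
  case (insert g \<P>)
  then obtain a b where ab: "g = {a, b}" "a \<noteq> b" by (metis card_2_iff insertI1)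
  have "h \<subseteq> X - g \<and> card h = 2" if "h \<in> \<P>" for h
    using insert.prems(2) insert.prems(3)[of h] that insert.hyps(2)
    by (auto simp: disjoint_def pairwise_def disjnt_def)
  moreover have "disjoint \<P>" using insert.prems(2) by (auto simp: disjoint_def pairwise_def)
  ultimately obtain c where c: "distinct c" "set c = X - g" "\<P> \<subseteq> pedges c"
    using insert.IH[of "X - g"] insert.prems(1) by auto
  have "pedges c \<subseteq> pedges (a # b # c)" by (cases c) auto
  moreover have "g \<in> pedges (a # b # c)" using ab by simp
  moreover have "set (a # b # c) = X" using c(2) ab insert.prems(3)[of g] by auto
  moreover have "distinct (a # b # c)" using c(1,2) ab by auto
  ultimately show ?case using c(3) by (intro exI[of _ "a # b # c"]) auto
qed

text \<open>The vertex ordering lists each joint \<open>c ! i\<close> followed by the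
  \<open>k - 2\<close> interior vertices of the edge between \<open>c ! i\<close> and the next
  joint. For \<open>k = 2\<close> all interiors are empty and the ordering is \<open>c\<close>
  itself.\<close>

lemma loose_cycle_of_arrangement:
  fixes V :: "'a set"
  assumes k: "k \<ge> 2" and n: "n \<ge> 3" and V: "finite V" "card V = (k - 1) * n"
    and c: "distinct c" "length c = n" "set c \<subseteq> V"
    and I: "\<And>g. g \<in> cedges c \<Longrightarrow> I g \<subseteq> V - set c \<and> card (I g) = k - 2 \<and> g \<union> I g \<in> E"
    and dis: "\<And>g h. g \<in> cedges c \<Longrightarrow> h \<in> cedges c \<Longrightarrow> g \<noteq> h \<Longrightarrow> I g \<inter> I h = {}"
  shows "has_loose_Hamilton_cycle k V E"
proof -
  define ed where "ed i = {c ! i, c ! (Suc i mod n)}" for i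
  have cne: "c \<noteq> []" using n c by auto
  have ced: "cedges c = ed ` {..<n}" using cedges_nth[OF cne] c by (simp add: ed_def)
  have edin: "ed i \<in> cedges c" if "i < n" for i using that ced by auto
  have edinj: "ed i \<noteq> ed j" if "i < n" "j < n" "i \<noteq> j" for i j
    using cyclic_pair_inj[OF c(1)] n c that by (auto simp: inj_on_def ed_def)
  have sl: "Suc i mod n < n" for i using n by simp
  have neq: "c ! i \<noteq> c ! j" if "i < n" "j < n" "i \<noteq> j" for i j
    using that c by (simp add: nth_eq_iff_index_eq)
  have fI: "finite (I (ed i))" if "i < n" for i using I[OF edin[OF that]] V finite_subset by (metis Diff_subset subset_trans)
  have "\<exists>b. bij_betw b {..<k - 2} (I (ed i))" if "i < n" for i
    using ex_bij_betw_nat_finite[OF fI[OF that]] I[OF edin[OF that]] by (simp add: atLeast0LessThan)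
  then obtain b where b: "\<And>i. i < n \<Longrightarrow> bij_betw (b i) {..<k - 2} (I (ed i))" by metis
  \<comment> \<open>Positions divisible by \<open>k - 1\<close> carry joints; the shift by one at
    the other positions makes the enumeration \<open>b i\<close> of an interior start at 0.\<close>
  define v where "v t = (if t mod (k - 1) = 0 then c ! (t div (k - 1)) else b (t div (k - 1)) (t mod (k - 1) - 1))" for t
  have k1: "k - 1 > 0" using k by simp
  have bI: "b i j \<in> I (ed i)" if "i < n" "j < k - 2" for i j using b[OF that(1)] that(2) by (auto simp: bij_betw_def)
  have vinj: "inj_on v {..<(k - 1) * n}"
  proof (rule inj_onI)
    fix s t assume st: "s \<in> {..<(k - 1) * n}" "t \<in> {..<(k - 1) * n}" and e: "v s = v t"
    let ?i = "s div (k - 1)" and ?j = "t div (k - 1)" and ?a = "s mod (k - 1)" and ?b = "t mod (k - 1)"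
    have ij: "?i < n" "?j < n" using st k1 by (simp_all add: less_mult_imp_div_less mult.commute)
    have ab: "?a < k - 1" "?b < k - 1" using k1 by simp_all
    have cI: "c ! i \<noteq> b j a" if "i < n" "j < n" "a < k - 2" for i j a
    proof -
      have "c ! i \<in> set c" using that(1) c(2) by simp
      then show ?thesis using bI[OF that(2,3)] I[OF edin[OF that(2)]] by auto
    qed
    have "?i = ?j \<and> ?a = ?b"
    proof (cases "?a = 0"; cases "?b = 0")
      assume "?a = 0" "?b = 0"
      then show ?thesis using e neq[OF ij] by (auto simp: v_def)
    next
      assume z: "?a = 0" "?b \<noteq> 0"
      then have "?b - 1 < k - 2" using ab by linarith
      then show ?thesis using e z cI[OF ij, of "?b - 1"] by (simp add: v_def)
    next
      assume z: "?a \<noteq> 0" "?b = 0"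
      then have "?a - 1 < k - 2" using ab by linarith
      then show ?thesis using e z cI[OF ij(2,1), of "?a - 1"] by (simp add: v_def)
    next
      assume ab0: "?a \<noteq> 0" "?b \<noteq> 0"
      then have ab2: "?a - 1 < k - 2" "?b - 1 < k - 2" using ab by linarith+
      have e2: "b ?i (?a - 1) = b ?j (?b - 1)" using e ab0 by (simp add: v_def)
      have "?i = ?j"
      proof (rule ccontr)
        assume "?i \<noteq> ?j"
        then have "I (ed ?i) \<inter> I (ed ?j) = {}" by (intro dis edin edinj ij)
        then show False using bI[OF ij(1) ab2(1)] bI[OF ij(2) ab2(2)] e2 by auto
      qed
      moreover then have "?a - 1 = ?b - 1"
        using e2 inj_onD[OF bij_betw_imp_inj_on[OF b[OF ij(1)]], of "?a - 1" "?b - 1"] ab2 by simp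
      ultimately show ?thesis using ab0 by linarith
    qed
    then show "s = t" by (metis mult_div_mod_eq)
  qed
  have vV: "v ` {..<(k - 1) * n} \<subseteq> V"
  proof
    fix x assume "x \<in> v ` {..<(k - 1) * n}"
    then obtain t where t: "t < (k - 1) * n" "x = v t" by auto
    have i: "t div (k - 1) < n" using t k1 by (simp add: less_mult_imp_div_less mult.commute)
    have a: "t mod (k - 1) < k - 1" using k1 by simp
    show "x \<in> V"
    proof (cases "t mod (k - 1) = 0")
      case True
      then show ?thesis using t i c by (auto simp: v_def)
    next
      case False
      then have "t mod (k - 1) - 1 < k - 2" using a by linarith
      then show ?thesis using bI[OF i] I[OF edin[OF i]] t False by (auto simp: v_def)
    qed
  qed
  have vb: "bij_betw v {..<(k - 1) * n} V"
  proof -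
    have "card (v ` {..<(k - 1) * n}) = card V" using vinj V by (simp add: card_image)
    then have "v ` {..<(k - 1) * n} = V" using vV V(1) by (simp add: card_subset_eq)
    then show ?thesis using vinj by (simp add: bij_betw_def)
  qed
  have le: "loose_edge k n v i = ed i \<union> I (ed i)" if i: "i < n" for i
  proof -
    have im: "(k - 1) * i + j < (k - 1) * n" if "j < k - 1" for j
    proof -
      have "(k - 1) * i + j < (k - 1) * Suc i" using that by simp
      also have "\<dots> \<le> (k - 1) * n" using i by (intro mult_le_mono2) simp
      finally show ?thesis .
    qed
    have dm: "((k - 1) * i + j) div (k - 1) = i" "((k - 1) * i + j) mod (k - 1) = j" if "j < k - 1" for j
      using that by simp_all
    have v0: "v (((k - 1) * i + 0) mod ((k - 1) * n)) = c ! i"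
      using im[of 0] dm[of 0] k1 by (simp add: v_def)
    have vj: "v (((k - 1) * i + Suc j) mod ((k - 1) * n)) = b i j" if "j < k - 2" for j
      using im[of "Suc j"] dm[of "Suc j"] that by (simp add: v_def)
    have vk: "v (((k - 1) * i + (k - 1)) mod ((k - 1) * n)) = c ! (Suc i mod n)"
    proof -
      have "(k - 1) * i + (k - 1) = (k - 1) * Suc i" by simp
      then have "((k - 1) * i + (k - 1)) mod ((k - 1) * n) = (k - 1) * (Suc i mod n)"
        by (metis mult_mod_right)
      then show ?thesis using k1 by (simp add: v_def)
    qed
    have kk: "{..<k} = insert 0 (insert (k - 1) (Suc ` {..<k - 2}))"
    proof -
      have "x \<in> insert 0 (insert (k - 1) (Suc ` {..<k - 2}))" if "x < k" for x
        using that by (cases x) (auto simp: image_iff)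
      then show ?thesis using k by auto
    qed
    have "(\<lambda>j. v (((k - 1) * i + j) mod ((k - 1) * n))) ` Suc ` {..<k - 2} = b i ` {..<k - 2}"
      unfolding image_image using vj by (intro image_cong) auto
    then show ?thesis
      unfolding loose_edge_def kk image_insert v0 vk using b[OF i] by (auto simp: bij_betw_def ed_def)
  qed
  have edc: "ed i \<subseteq> set c" if "i < n" for i using that c sl[of i] by (auto simp: ed_def)
  have sn: "Suc i mod n \<noteq> i" if "i < n" for i using that n by (auto simp: mod_Suc)
  have edge: "ed i \<union> I (ed i) \<subseteq> V \<and> card (ed i \<union> I (ed i)) = k" if i: "i < n" for i
  proof -
    have "card (ed i) = 2" using neq[OF i sl sn[OF i, symmetric]] by (simp add: ed_def)
    moreover have "ed i \<inter> I (ed i) = {}" using edc[OF i] I[OF edin[OF i]] by auto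
    moreover have "finite (ed i)" by (simp add: ed_def)
    ultimately have "card (ed i \<union> I (ed i)) = k"
      using fI[OF i] I[OF edin[OF i]] k by (simp add: card_Un_disjoint)
    then show ?thesis using edc[OF i] I[OF edin[OF i]] c by auto
  qed
  have int: "card (loose_edge k n v i \<inter> loose_edge k n v (Suc i mod n)) = 1" if i: "i < n" for i
  proof -
    let ?i' = "Suc i mod n" and ?i'' = "Suc (Suc i mod n) mod n"
    \<comment> \<open>Here \<open>n \<ge> 3\<close> enters: with two edges, consecutive ones would
      share both joints.\<close>
    have ne: "i \<noteq> ?i'" "?i' \<noteq> ?i''" "i \<noteq> ?i''" using i n by (auto simp: mod_Suc)
    have "I (ed i) \<inter> I (ed ?i') = {}" using dis[OF edin[OF i] edin[OF sl] edinj[OF i sl ne(1)]] .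
    then have "(ed i \<union> I (ed i)) \<inter> (ed ?i' \<union> I (ed ?i')) = ed i \<inter> ed ?i'"
      using I[OF edin[OF i]] I[OF edin[OF sl[of i]]] edc[OF i] edc[OF sl[of i]] by auto
    also have "\<dots> = {c ! ?i'}"
      using neq[OF i sl ne(3)] neq[OF sl sl ne(2)] neq[OF i sl ne(1)] by (auto simp: ed_def)
    finally show ?thesis using le[OF i] le[OF sl[of i]] by simp
  qed
  let ?C = "loose_edge k n v ` {..<n}"
  have "loose_cycle k V ?C"
    unfolding loose_cycle_def uniform_hypergraph_def
    using le edge int vb n by (auto intro!: exI[of _ n] exI[of _ v])
  moreover have "?C \<subseteq> E" using le I edin by auto
  ultimately show ?thesis by (auto simp: has_loose_Hamilton_cycle_def)
qed

section \<open>Arrangements\<close>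

text \<open>A partially built loose cycle: \<open>c\<close> is the cyclic ordering of the joints (the vertices shared by
  consecutive edges), \<open>Gd\<close> the set of those pairs of neighbouring joints that have been completed to an
  edge of \<open>E\<close>, and \<open>I g\<close> the \<open>k - 2\<close> interior vertices of the edge at the pair \<open>g\<close>. Since \<open>I\<close> is
  indexed by unordered pairs, it is not affected by reversing segments of \<open>c\<close>.\<close>

definition arr :: "nat \<Rightarrow> 'a set \<Rightarrow> 'a set set \<Rightarrow> 'a list \<Rightarrow> 'a set set \<Rightarrow> ('a set \<Rightarrow> 'a set) \<Rightarrow> bool" where
  "arr k V E c Gd I \<longleftrightarrow> distinct c \<and> c \<noteq> [] \<and> set c \<subseteq> V \<and> Gd \<subseteq> cedges c \<and>
     (\<forall>g\<in>Gd. I g \<subseteq> V - set c \<and> card (I g) = k - 2 \<and> g \<union> I g \<in> E) \<and>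
     (\<forall>g\<in>Gd. \<forall>h\<in>Gd. g \<noteq> h \<longrightarrow> I g \<inter> I h = {})"

definition pool :: "'a set \<Rightarrow> 'a list \<Rightarrow> 'a set set \<Rightarrow> ('a set \<Rightarrow> 'a set) \<Rightarrow> 'a set" where
  "pool V c Gd I = V - set c - \<Union>(I ` Gd)"

lemma arrD:
  assumes "arr k V E c Gd I"
  shows "distinct c" "c \<noteq> []" "set c \<subseteq> V" "Gd \<subseteq> cedges c"
    "g \<in> Gd \<Longrightarrow> I g \<subseteq> V - set c" "g \<in> Gd \<Longrightarrow> card (I g) = k - 2" "g \<in> Gd \<Longrightarrow> g \<union> I g \<in> E"
    "g \<in> Gd \<Longrightarrow> h \<in> Gd \<Longrightarrow> g \<noteq> h \<Longrightarrow> I g \<inter> I h = {}"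
  using assms by (simp_all add: arr_def)

lemma card_pool:
  assumes a: "arr k V E c Gd I" and V: "finite V"
  shows "card (pool V c Gd I) + length c + (k - 2) * card Gd = card V"
proof -
  have fG: "finite Gd" using arrD(4)[OF a] finite_cedges finite_subset by metis
  have fI: "finite (I g)" if "g \<in> Gd" for g
    using arrD(5)[OF a that] V by (meson finite_Diff finite_subset)
  have "card (\<Union>(I ` Gd)) = (\<Sum>g\<in>Gd. card (I g))"
    by (rule card_UN_disjoint[OF fG]) (use fI arrD(8)[OF a] in auto)
  also have "\<dots> = (k - 2) * card Gd" using arrD(6)[OF a] by simp
  finally have cI: "card (\<Union>(I ` Gd)) = (k - 2) * card Gd" .
  have sub: "\<Union>(I ` Gd) \<subseteq> V - set c" using arrD(5)[OF a] by blast
  have "card (pool V c Gd I) + card (\<Union>(I ` Gd)) = card (V - set c)"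
    unfolding pool_def using sub V card_Diff_subset[of "\<Union>(I ` Gd)" "V - set c"]
      card_mono[OF _ sub] finite_subset[OF sub] by simp
  moreover have "card (V - set c) + length c = card V"
    using arrD(1,3)[OF a] V by (simp add: card_Diff_subset distinct_card card_mono finite_subset flip: distinct_card)
  ultimately show ?thesis using cI by simp
qed

lemma arr_swap:
  assumes a: "arr k V E c Gd I" and V: "finite V" and g: "g \<in> Gd" "b \<in> I g" and v: "v \<in> pool V c Gd I"
    and e: "insert v (g \<union> I g - {b}) \<in> E"
  defines "I' \<equiv> I(g := insert v (I g - {b}))"
  shows "arr k V E c Gd I'" "pool V c Gd I' = insert b (pool V c Gd I - {v})"
proof -
  have vg: "v \<notin> set c" "v \<in> V" "\<And>h. h \<in> Gd \<Longrightarrow> v \<notin> I h" using v by (auto simp: pool_def)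
  have gc: "g \<subseteq> set c" using g arrD(2,4)[OF a] cedges_subset by blast
  have b: "b \<in> V" "b \<notin> set c" using arrD(5)[OF a g(1)] g(2) by auto
  have bh: "b \<notin> I h" if "h \<in> Gd" "h \<noteq> g" for h using arrD(8)[OF a that(1) g(1) that(2)] g(2) by auto
  have fI: "finite (I g)" using arrD(5)[OF a g(1)] V by (meson finite_Diff finite_subset)
  have pos: "card (I g) > 0" using fI g(2) by (auto simp: card_gt_0_iff)
  have cg: "card (insert v (I g - {b})) = k - 2"
    using fI g(2) vg(3)[OF g(1)] arrD(6)[OF a g(1)] pos by simp
  have eg: "g \<union> insert v (I g - {b}) \<in> E"
  proof -
    have "g \<union> insert v (I g - {b}) = insert v (g \<union> I g - {b})" using gc b by auto
    then show ?thesis using e by simp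
  qed
  show "arr k V E c Gd I'"
    unfolding arr_def
  proof (intro conjI ballI impI)
    fix h assume h: "h \<in> Gd"
    show "I' h \<subseteq> V - set c" using arrD(5)[OF a h] arrD(5)[OF a g(1)] vg by (auto simp: I'_def)
    show "card (I' h) = k - 2" using arrD(6)[OF a h] cg by (simp add: I'_def)
    show "h \<union> I' h \<in> E" using arrD(7)[OF a h] eg by (simp add: I'_def)
    fix h' assume h': "h' \<in> Gd" "h \<noteq> h'"
    have "I h \<inter> I h' = {}" using arrD(8)[OF a h h'] .
    moreover have "v \<notin> I h" "v \<notin> I h'" using vg(3) h h' by blast+
    ultimately show "I' h \<inter> I' h' = {}"
      unfolding I'_def fun_upd_apply using h'(2) by (cases "h = g"; cases "h' = g") auto
  qed (fact arrD(1-4)[OF a])+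
  have "\<Union>(I' ` Gd) = insert v (\<Union>(I ` Gd) - {b})"
  proof -
    have "\<Union>(I ` Gd) = I g \<union> \<Union>(I ` (Gd - {g}))" using g by blast
    moreover have "\<Union>(I' ` Gd) = insert v (I g - {b}) \<union> \<Union>(I ` (Gd - {g}))"
    proof -
      have "I' ` (Gd - {g}) = I ` (Gd - {g})" by (intro image_cong) (auto simp: I'_def)
      moreover have "Gd = insert g (Gd - {g})" using g by blast
      then have "\<Union>(I' ` Gd) = I' g \<union> \<Union>(I' ` (Gd - {g}))" by blast
      ultimately show ?thesis by (simp add: I'_def)
    qed
    moreover have "b \<notin> \<Union>(I ` (Gd - {g}))" using bh by blast
    ultimately show ?thesis by (simp add: Un_Diff)
  qed
  then show "pool V c Gd I' = insert b (pool V c Gd I - {v})"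
    using b vg(1) vg(3)[OF g(1)] g(2) by (auto simp: pool_def)
qed

lemma arr_swaps:
  fixes m :: nat
  assumes a: "arr k V E c Gd I" and V: "finite V"
    and g: "\<And>j. j < m \<Longrightarrow> g j \<in> Gd \<and> b j \<in> I (g j)" "inj_on g {..<m}"
    and v: "\<And>j. j < m \<Longrightarrow> v j \<in> pool V c Gd I" "inj_on v {..<m}"
    and e: "\<And>j. j < m \<Longrightarrow> insert (v j) (g j \<union> I (g j) - {b j}) \<in> E"
  shows "\<exists>I'. arr k V E c Gd I' \<and> pool V c Gd I' = (pool V c Gd I - v ` {..<m}) \<union> b ` {..<m} \<and>
    (\<forall>h. h \<notin> g ` {..<m} \<longrightarrow> I' h = I h)"
  using g v e
proof (induction m)
  case 0
  then show ?case using a by auto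
next
  case (Suc m)
  have "inj_on g {..<m}" "inj_on v {..<m}" using Suc.prems(2,4) by (auto simp: inj_on_def)
  then obtain I1 where I1: "arr k V E c Gd I1"
    "pool V c Gd I1 = (pool V c Gd I - v ` {..<m}) \<union> b ` {..<m}" "\<forall>h. h \<notin> g ` {..<m} \<longrightarrow> I1 h = I h"
    using Suc.IH Suc.prems(1,3,5) by (metis less_SucI)
  have gm: "g m \<notin> g ` {..<m}" "v m \<notin> v ` {..<m}"
    using Suc.prems(2,4) unfolding lessThan_Suc by simp_all
  then have Ig: "I1 (g m) = I (g m)" using I1(3) by simp
  have vm: "v m \<in> pool V c Gd I" using Suc.prems(3)[of m] by simp
  then have v1: "v m \<in> pool V c Gd I1" using I1(2) gm by simp
  \<comment> \<open>The entering vertices are unplaced and the released ones interior to edges, so a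
    vertex released by an earlier swap cannot be the next one to enter.\<close>
  have bv: "v m \<notin> b ` {..<m}"
  proof
    assume "v m \<in> b ` {..<m}"
    then obtain j where "j < m" "v m = b j" by auto
    then show False using vm Suc.prems(1)[of j] by (auto simp: pool_def)
  qed
  note sw = arr_swap[OF I1(1) V, of "g m" "b m" "v m", unfolded Ig]
  have e1: "g m \<in> Gd" "b m \<in> I (g m)" "insert (v m) (g m \<union> I (g m) - {b m}) \<in> E"
    using Suc.prems(1)[of m] Suc.prems(5)[of m] by auto
  note sw = sw[OF e1(1,2) v1 e1(3)]
  let ?I' = "I1(g m := insert (v m) (I (g m) - {b m}))"
  have "pool V c Gd ?I' = (pool V c Gd I - v ` {..<Suc m}) \<union> b ` {..<Suc m}"
    unfolding sw(2) I1(2) lessThan_Suc using bv by auto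
  moreover have "\<forall>h. h \<notin> g ` {..<Suc m} \<longrightarrow> ?I' h = I h" using I1(3) by (simp add: lessThan_Suc)
  ultimately show ?case using sw(1) by blast
qed

text \<open>One rule for both kinds of change of the ordering. A 3-opt move keeps the set of joints;
  closing a gadget turns pool vertices into new joints, which is why \<open>set d\<close> may exceed
  \<open>set c\<close> by vertices of the pool outside the new interiors.\<close>

lemma arr_update:
  assumes a: "arr k V E c Gd I" and d: "distinct d" "d \<noteq> []" "set d \<subseteq> V"
    and O: "O' \<subseteq> Gd \<inter> cedges d" and N: "finite N" "N \<subseteq> cedges d" "N \<inter> O' = {}"
    and J: "\<And>h. h \<in> N \<Longrightarrow> J h \<subseteq> pool V c Gd I \<and> card (J h) = k - 2 \<and> h \<union> J h \<in> E"
    and Jd: "\<And>h h'. h \<in> N \<Longrightarrow> h' \<in> N \<Longrightarrow> h \<noteq> h' \<Longrightarrow> J h \<inter> J h' = {}"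
    and new: "set d - set c \<subseteq> pool V c Gd I - \<Union>(J ` N)" "set c \<subseteq> set d"
  defines "I' \<equiv> \<lambda>h. if h \<in> N then J h else I h"
  shows "arr k V E d (O' \<union> N) I'"
proof -
  have I: "I h \<subseteq> V - set d" if "h \<in> O'" for h
  proof -
    have "h \<in> Gd" using that O by auto
    then have "I h \<subseteq> V - set c" "I h \<inter> pool V c Gd I = {}" using arrD(5)[OF a] by (auto simp: pool_def)
    then show ?thesis using new(1) by auto
  qed
  have Jn: "J h \<subseteq> V - set d" if "h \<in> N" for h
  proof -
    have "J h \<subseteq> V - set c" using J[OF that] by (auto simp: pool_def)
    then show ?thesis using new(1) that by auto
  qed
  have on: "I' h = I h" "h \<in> Gd" if "h \<in> O'" for h using that N(3) O by (auto simp: I'_def)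
  have nn: "I' h = J h" if "h \<in> N" for h using that by (simp add: I'_def)
  have ij: "I h \<inter> J h' = {}" if "h \<in> O'" "h' \<in> N" for h h'
    using J[OF that(2)] on(2)[OF that(1)] by (auto simp: pool_def)
  show ?thesis
    unfolding arr_def
  proof (intro conjI ballI impI)
    fix h assume h: "h \<in> O' \<union> N"
    show "I' h \<subseteq> V - set d" using h I Jn on(1) nn by (cases "h \<in> N") auto
    show "card (I' h) = k - 2" using h J on nn arrD(6)[OF a] by (cases "h \<in> N") auto
    show "h \<union> I' h \<in> E" using h J on nn arrD(7)[OF a] by (cases "h \<in> N") auto
    fix h' assume h': "h' \<in> O' \<union> N" "h \<noteq> h'"
    consider "h \<in> O'" "h' \<in> O'" | "h \<in> O'" "h' \<in> N" | "h \<in> N" "h' \<in> O'" | "h \<in> N" "h' \<in> N" using h h' by blast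
    then show "I' h \<inter> I' h' = {}"
    proof cases
      case 1
      then show ?thesis using on arrD(8)[OF a _ _ h'(2)] by simp
    next
      case 2
      then show ?thesis using on nn ij by simp
    next
      case 3
      then show ?thesis using on(1)[OF 3(2)] nn[OF 3(1)] ij[OF 3(2,1)] by (simp add: Int_commute)
    next
      case 4
      then show ?thesis using nn Jd h'(2) by simp
    qed
  qed (use d O N in auto)
qed

text \<open>\<open>Mr\<close> is the reserve: a vertex \<open>v\<close> outside the exceptional set \<open>Y\<close> can be swapped into any edge
  of \<open>Mr\<close> that lies in \<open>F v\<close>. The pairs in \<open>Sg\<close> are gadgets: each stands for three consecutive edges
  \<open>u K b\<close>, \<open>b \<dots> b'\<close>, \<open>b' K' w\<close> of the final cycle that are filled in last. \<open>KK\<close> is the union of their sets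
  \<open>K, K'\<close>, and their other vertices account for the \<open>free\<close> surplus of the pool. For \<open>k = 2\<close> all of
  these are empty.\<close>

locale perturbed =
  fixes k :: nat and V :: "'a set" and E :: "'a set set" and X :: "'a set" and Sg :: "'a set set"
    and KK Y :: "'a set" and Mr :: "'a set set" and F :: "'a \<Rightarrow> 'a set set"
    and m P0 A0 g free :: nat
  assumes k: "k \<ge> 2" and V: "finite V" and XV: "X \<subseteq> V" and X3: "card X \<ge> 3"
    and tr: "has_transversals k (real m) V E"
    and codeg: "\<And>S. S \<subseteq> V \<Longrightarrow> card S = k - 1 \<Longrightarrow> A0 \<le> card (nbs E V S \<inter> X)"
    and room: "2 * m + 6 * P0 + 1 \<le> A0"
    and Mr: "finite Mr"
    and res: "\<And>v. 3 \<le> k \<Longrightarrow> v \<in> V - X - Y \<Longrightarrow> g \<le> card {f\<in>Mr. f \<in> F v}"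
    and Mdis: "\<And>f h. f \<in> Mr \<Longrightarrow> h \<in> Mr \<Longrightarrow> f \<noteq> h \<Longrightarrow> f \<inter> h = {}"
    and Mne: "\<And>f. f \<in> Mr \<Longrightarrow> f \<inter> X \<noteq> {}" and MV: "\<And>f. f \<in> Mr \<Longrightarrow> f \<subseteq> V"
    and swap: "\<And>v f. f \<in> F v \<Longrightarrow> \<exists>b\<in>f - X. insert v (f - {b}) \<in> E"
    and cardV: "card V = card X + (k - 2) * (card X - card Sg) + card KK + free"
    and free: "2 * (k - 2) \<le> free"
begin

text \<open>\<open>Mu\<close> is the still unused part of the reserve and \<open>Pr\<close> a set of protected pairs whose edges are
  never broken up again; only their interiors may contain exceptional vertices.\<close>

definition st :: "'a set set \<Rightarrow> 'a set set \<Rightarrow> 'a list \<Rightarrow> 'a set set \<Rightarrow> ('a set \<Rightarrow> 'a set) \<Rightarrow> bool" where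
  "st Mu Pr c Gd I \<longleftrightarrow> arr k V E c Gd I \<and> set c = X \<and> Sg \<subseteq> cedges c \<and> Sg \<inter> Gd = {} \<and> Pr \<subseteq> Gd \<and>
     KK \<subseteq> pool V c Gd I \<and> (pool V c Gd I - KK) \<inter> Y = {} \<and> (\<forall>h\<in>Gd - Pr. I h \<inter> Y = {}) \<and>
     Mu \<subseteq> Mr \<and> (\<forall>f\<in>Mu. f \<inter> X \<in> Pr \<and> I (f \<inter> X) = f - X)"

definition bad :: "'a list \<Rightarrow> 'a set set \<Rightarrow> 'a set set" where
  "bad c Gd = cedges c - Gd - Sg"

lemma stD:
  assumes "st Mu Pr c Gd I"
  shows "arr k V E c Gd I" "set c = X" "Sg \<subseteq> cedges c" "Sg \<inter> Gd = {}" "Pr \<subseteq> Gd"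
     "KK \<subseteq> pool V c Gd I" "(pool V c Gd I - KK) \<inter> Y = {}" "h \<in> Gd \<Longrightarrow> h \<notin> Pr \<Longrightarrow> I h \<inter> Y = {}"
     "Mu \<subseteq> Mr" "f \<in> Mu \<Longrightarrow> f \<inter> X \<in> Pr" "f \<in> Mu \<Longrightarrow> I (f \<inter> X) = f - X"
  using assms by (simp_all add: st_def)

text \<open>The joints are fixed, so the number of unplaced vertices depends only on the number of
  bad pairs. Together with \<open>free \<ge> 2 * (k - 2)\<close> it shows that even a single bad
  pair leaves the \<open>3 * (k - 2)\<close> vertices of a move, and conversely a small pool means
  few bad pairs.\<close>

lemma card_free_pool:
  assumes s: "st Mu Pr c Gd I"
  shows "card (pool V c Gd I - KK) = (k - 2) * card (bad c Gd) + free"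
proof -
  note a = stD(1)[OF s]
  have l: "length c = card X" using stD(2)[OF s] arrD(1)[OF a] distinct_card by metis
  have cc: "card (cedges c) = card X" using card_cedges[OF arrD(1)[OF a]] l X3 by simp
  have fc: "finite (cedges c)" by (rule finite_cedges)
  have fG: "finite Gd" "finite Sg" using fc arrD(4)[OF a] stD(3)[OF s] finite_subset by metis+
  have "card (bad c Gd) = card (cedges c - (Gd \<union> Sg))" by (simp add: bad_def Diff_Diff_Int Diff_eq Int_assoc)
  also have "\<dots> = card (cedges c) - card (Gd \<union> Sg)"
    using fG arrD(4)[OF a] stD(3)[OF s] by (intro card_Diff_subset) auto
  also have "card (Gd \<union> Sg) = card Gd + card Sg" using fG stD(4)[OF s] by (intro card_Un_disjoint) auto
  finally have b: "card (bad c Gd) = card X - (card Gd + card Sg)" using cc by simp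
  have le: "card Gd + card Sg \<le> card X"
    using card_mono[OF fc, of "Gd \<union> Sg"] arrD(4)[OF a] stD(3,4)[OF s] fG cc by (simp add: card_Un_disjoint Int_commute)
  have "card (pool V c Gd I) + card X + (k - 2) * card Gd = card V"
    using card_pool[OF a V] l by simp
  moreover have "card X - card Sg = card Gd + card (bad c Gd)" using b le by simp
  ultimately have "card (pool V c Gd I) = (k - 2) * card (bad c Gd) + card KK + free"
    using cardV by (simp add: algebra_simps)
  moreover have "finite KK" using stD(6)[OF s] V unfolding pool_def by (meson finite_Diff finite_subset)
  ultimately show ?thesis using stD(6)[OF s] by (simp add: card_Diff_subset)
qed

text \<open>A joint together with an interior is a \<open>(k - 1)\<close>-set, so \<open>u\<close>
  with \<open>J1\<close> and \<open>w\<close> with \<open>J2\<close> have at least \<open>A0\<close>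
  neighbours each among the joints. For the third edge only candidate sets \<open>A j\<close> are
  given: with \<open>P\<close> and \<open>Q\<close> from \<open>rotation\<close> they form
  \<open>k\<close> disjoint sets, and a transversal chooses \<open>p\<close>, \<open>q\<close> and
  the interior together.\<close>

lemma find_move:
  assumes c: "distinct c" "set c = X" and e: "{u, w} \<in> cedges c"
    and J: "J1 \<subseteq> V - X" "card J1 = k - 2" "J2 \<subseteq> V - X" "card J2 = k - 2"
    and B: "finite B" "card B \<le> 2 * P0"
    and A: "disjoint_family_on A {..<k - 2}" "\<And>j. j < k - 2 \<Longrightarrow> A j \<subseteq> V - X \<and> m \<le> card (A j)"
  obtains x y p q d a where "reconnects c d u w x y p q" "x \<notin> B" "y \<notin> B" "p \<notin> B"
    "{u, x} \<union> J1 \<in> E" "{w, y} \<union> J2 \<in> E" "{p, q} \<union> a ` {..<k - 2} \<in> E" "\<And>j. j < k - 2 \<Longrightarrow> a j \<in> A j"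
proof -
  have ne: "c \<noteq> []" using c X3 by auto
  have uw: "u \<in> X" "w \<in> X" using cedges_subset[OF ne e] c by auto
  have fJ: "finite J1" "finite J2" using J V by (meson finite_Diff finite_subset)+
  have cu: "card (insert u J1) = k - 1" "card (insert w J2) = k - 1"
    using J uw fJ k by (auto simp: card_insert_if)
  have sub: "insert u J1 \<subseteq> V" "insert w J2 \<subseteq> V" using J uw XV by auto
  define Sx where "Sx = nbs E V (insert u J1) \<inter> X"
  define Sy where "Sy = nbs E V (insert w J2) \<inter> X"
  have "A0 \<le> card Sx" "A0 \<le> card Sy" unfolding Sx_def Sy_def using codeg cu sub by blast+
  \<comment> \<open>With at most \<open>2 * P0\<close> forbidden joints, \<open>6 * P0\<close> in
    \<open>room\<close> is the \<open>3 * card B\<close> that \<open>rotation\<close> asks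
    for.\<close>
  then have cS: "2 * m + 2 * card B \<le> card Sx" "2 * m + 3 * card B + 1 \<le> card Sy" using room B by linarith+
  have nin: "u \<notin> Sx" "w \<notin> Sy" and S: "Sx \<subseteq> set c" "Sy \<subseteq> set c"
    using c by (auto simp: Sx_def Sy_def nbs_def)
  obtain P Q where PQ: "P \<subseteq> set c" "Q \<subseteq> set c" "P \<inter> Q = {}" "m \<le> card P" "m \<le> card Q"
    and mv: "\<And>p q. p \<in> P \<Longrightarrow> q \<in> Q \<Longrightarrow>
      p \<notin> B \<and> (\<exists>x\<in>Sx - B. \<exists>y\<in>Sy - B. \<exists>d. reconnects c d u w x y p q)"
    using rotation[OF c(1) ne e S(1) nin(1) cS(1) S(2) nin(2) cS(2) B(1)] by blast
  define A' where "A' j = (if j < k - 2 then A j else if j = k - 2 then P else Q)" for j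
  have "disjoint_family_on A' {..<k}"
    unfolding disjoint_family_on_def
  proof (intro ballI impI)
    fix i j assume "i \<in> {..<k}" "j \<in> {..<k}" "i \<noteq> j"
    moreover have "A i \<inter> P = {}" "A i \<inter> Q = {}" if "i < k - 2" for i
      using A(2)[OF that] PQ(1,2) c(2) by auto
    moreover have "A i \<inter> A j = {}" if "i < k - 2" "j < k - 2" "i \<noteq> j" for i j
      using A(1) that by (auto simp: disjoint_family_on_def)
    ultimately show "A' i \<inter> A' j = {}" using PQ(3) by (auto simp: A'_def)
  qed
  moreover have "A' j \<subseteq> V" "real m \<le> real (card (A' j))" if "j < k" for j
    using A(2)[of j] PQ c(2) XV by (auto simp: A'_def)
  ultimately obtain a where a: "\<And>j. j < k \<Longrightarrow> a j \<in> A' j" "a ` {..<k} \<in> E"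
    using has_transversalsD[OF tr] by metis
  have kk: "{..<k} = insert (k - 2) (insert (k - 1) {..<k - 2})" using k by auto
  have k12: "\<not> k - 1 < k - 2" "k - 1 \<noteq> k - 2" using k by linarith+
  have "a (k - 2) \<in> P" using a(1)[of "k - 2"] k by (simp add: A'_def)
  moreover have "a (k - 1) \<in> Q" using a(1)[of "k - 1"] k k12 unfolding A'_def if_not_P[OF k12(1)] if_not_P[OF k12(2)] by simp
  ultimately obtain x y d where mv': "a (k - 2) \<notin> B" "x \<in> Sx - B" "y \<in> Sy - B"
    "reconnects c d u w x y (a (k - 2)) (a (k - 1))"
    using mv by blast
  show thesis
  proof (rule that[OF mv'(4)])
    have "insert x (insert u J1) \<in> E" using mv'(2) by (simp add: Sx_def nbs_def)
    then show "{u, x} \<union> J1 \<in> E" by (simp add: insert_commute)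
    have "insert y (insert w J2) \<in> E" using mv'(3) by (simp add: Sy_def nbs_def)
    then show "{w, y} \<union> J2 \<in> E" by (simp add: insert_commute)
    show "{a (k - 2), a (k - 1)} \<union> a ` {..<k - 2} \<in> E" using a(2) unfolding kk by simp
    show "a j \<in> A j" if "j < k - 2" for j using a(1)[of j] that by (simp add: A'_def)
  qed (use mv' in auto)
qed

text \<open>Broken edges are unprotected, so the interiors they return to the pool are free of
  exceptional vertices. Only \<open>J3\<close> may contain such vertices, namely when it was
  released by the reserve; the pair \<open>{p, q}\<close> then has to become protected, which is the
  second alternative for \<open>Pr'\<close>.\<close>

lemma apply_move:
  assumes a: "arr k V E c Gd I" and c: "set c = X" and Sg: "Sg \<subseteq> cedges c" "Sg \<inter> Gd = {}" and Pr: "Pr \<subseteq> Gd"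
    and KK: "KK \<subseteq> pool V c Gd I" and Yp: "(pool V c Gd I - KK - J3) \<inter> Y = {}"
    and YI: "\<And>h. h \<in> Gd \<Longrightarrow> h \<notin> Pr \<Longrightarrow> I h \<inter> Y = {}"
    and Mu: "Mu \<subseteq> Mr" "\<And>f. f \<in> Mu \<Longrightarrow> f \<inter> X \<in> Pr \<and> I (f \<inter> X) = f - X"
    and uw: "{u, w} \<in> bad c Gd" and rc: "reconnects c d u w x y p q"
    and out: "x \<notin> \<Union>(Pr \<union> Sg)" "y \<notin> \<Union>(Pr \<union> Sg)" "p \<notin> \<Union>(Pr \<union> Sg)"
    and J: "J1 \<subseteq> pool V c Gd I - KK" "J2 \<subseteq> pool V c Gd I - KK" "J3 \<subseteq> pool V c Gd I - KK"
      "card J1 = k - 2" "card J2 = k - 2" "card J3 = k - 2" "J1 \<inter> J2 = {}" "J1 \<inter> J3 = {}" "J2 \<inter> J3 = {}"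
    and e: "{u, x} \<union> J1 \<in> E" "{w, y} \<union> J2 \<in> E" "{p, q} \<union> J3 \<in> E"
    and Pr': "Pr' = Pr \<and> J3 \<inter> Y = {} \<or> Pr' = insert {p, q} Pr"
  shows "\<exists>Gd' I'. st Mu Pr' d Gd' I' \<and> card (bad d Gd') < card (bad c Gd)"
proof -
  let ?N = "{{u, x}, {w, y}, {p, q}}"
  define Jf where "Jf h = (if h = {u, x} then J1 else if h = {w, y} then J2 else J3)" for h
  define Ol where "Ol = Gd \<inter> cedges d - ?N"
  define Gd' where "Gd' = Ol \<union> ?N"
  define I' where "I' h = (if h \<in> ?N then Jf h else I h)" for h
  have rc': "distinct d" "set d = X" "?N \<subseteq> cedges d" "{u, x} \<noteq> {w, y}" "{u, x} \<noteq> {p, q}" "{w, y} \<noteq> {p, q}"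
    "cedges c \<subseteq> cedges d \<union> {{u, w}, {x, p}, {y, q}}" "cedges d \<subseteq> (cedges c - {{u, w}}) \<union> ?N"
    using rc c by (simp_all add: reconnects_def)
  have Jfe: "Jf {u, x} = J1" "Jf {w, y} = J2" "Jf {p, q} = J3"
    using rc'(4-6) by (simp_all add: Jf_def)
  have dne: "d \<noteq> []" using rc'(2) X3 by auto
  have PN: "h \<notin> ?N" if "h \<in> Pr \<union> Sg" for h using that out by blast
  have Pd: "h \<in> cedges d" if h: "h \<in> Pr \<union> Sg" for h
  proof -
    have "h \<in> cedges c" using h Pr arrD(4)[OF a] Sg by blast
    moreover have "h \<noteq> {u, w}" using h Pr uw by (auto simp: bad_def)
    moreover have "h \<noteq> {x, p}" "h \<noteq> {y, q}" using out h by blast+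
    ultimately show ?thesis using rc'(7) by blast
  qed
  have arr': "arr k V E d Gd' I'"
    unfolding Gd'_def I'_def
  proof (rule arr_update[OF a rc'(1) dne])
    show "set d \<subseteq> V" using rc'(2) XV by simp
    show "Ol \<subseteq> Gd \<inter> cedges d" "?N \<inter> Ol = {}" by (auto simp: Ol_def)
    show "Jf h \<subseteq> pool V c Gd I \<and> card (Jf h) = k - 2 \<and> h \<union> Jf h \<in> E" if "h \<in> ?N" for h
      using that Jfe J e by auto
    show "Jf h \<inter> Jf h' = {}" if "h \<in> ?N" "h' \<in> ?N" "h \<noteq> h'" for h h'
      using that Jfe J(7-9) by (auto simp: Int_commute)
    show "set d - set c \<subseteq> pool V c Gd I - \<Union>(Jf ` ?N)" "set c \<subseteq> set d" using rc'(2) c by auto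
  qed (use rc' in auto)
  have I'J: "I' {u, x} = J1" "I' {w, y} = J2" "I' {p, q} = J3" using Jfe by (simp_all add: I'_def)
  have I'O: "I' h = I h" if "h \<notin> ?N" for h using that by (simp add: I'_def)
  have PrG: "Pr \<subseteq> Ol" using Pr Pd PN by (auto simp: Ol_def)
  have SG: "Sg \<inter> Gd' = {}" using Sg(2) PN by (auto simp: Gd'_def Ol_def)
  have UI: "\<Union>(I' ` Gd') = \<Union>(I ` Ol) \<union> (J1 \<union> J2 \<union> J3)"
  proof -
    have "I' ` Ol = I ` Ol" using I'O by (intro image_cong) (auto simp: Ol_def)
    then show ?thesis unfolding Gd'_def image_Un using I'J by (simp add: Un_ac)
  qed
  have KK': "KK \<subseteq> pool V d Gd' I'"
  proof
    fix z assume z: "z \<in> KK"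
    then have "z \<in> V - set c" "z \<notin> \<Union>(I ` Gd)" using KK by (auto simp: pool_def)
    moreover have "z \<notin> J1 \<union> J2 \<union> J3" using z J(1-3) by blast
    moreover have "\<Union>(I ` Ol) \<subseteq> \<Union>(I ` Gd)" by (auto simp: Ol_def)
    ultimately show "z \<in> pool V d Gd' I'" unfolding pool_def UI using rc'(2) c by blast
  qed
  have Y': "(pool V d Gd' I' - KK) \<inter> Y = {}"
  proof -
    have "z \<notin> Y" if z: "z \<in> pool V d Gd' I' - KK" for z
    proof (cases "z \<in> pool V c Gd I")
      case True
      then have "z \<in> pool V c Gd I - KK - J3" using z by (auto simp: pool_def UI)
      then show ?thesis using Yp by blast
    next
      case False
      \<comment> \<open>A vertex new to the pool was interior to an edge that the move
        destroyed.\<close>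
      then obtain h where h: "h \<in> Gd" "z \<in> I h" using z rc'(2) c by (auto simp: pool_def)
      have "h \<notin> Ol" using h(2) z by (auto simp: pool_def UI)
      then have "h \<notin> Pr" using PrG by blast
      then show ?thesis using YI h by blast
    qed
    then show ?thesis by blast
  qed
  have YI': "I' h \<inter> Y = {}" if h: "h \<in> Gd' - Pr'" for h
  proof (cases "h \<in> ?N")
    case False
    then have "h \<in> Gd" "h \<notin> Pr" using h Pr' by (auto simp: Gd'_def Ol_def)
    then show ?thesis using YI I'O[OF False] by simp
  next
    case True
    have "J1 \<inter> Y = {}" "J2 \<inter> Y = {}" using J Yp by blast+
    moreover have "J3 \<inter> Y = {}" if "h = {p, q}" using that h Pr' by auto
    ultimately show ?thesis using True I'J by auto
  qed
  have Mu': "f \<inter> X \<in> Pr' \<and> I' (f \<inter> X) = f - X" if "f \<in> Mu" for f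
  proof -
    have "f \<inter> X \<in> Pr" "I (f \<inter> X) = f - X" using Mu(2)[OF that] by auto
    then show ?thesis using I'O PN Pr' by auto
  qed
  have "st Mu Pr' d Gd' I'"
    unfolding st_def using arr' rc'(2) Pd SG KK' Y' YI' Mu(1) Mu' Pr' PrG by (auto simp: Gd'_def)
  moreover have "bad d Gd' \<subset> bad c Gd"
  proof -
    have "bad d Gd' \<subseteq> bad c Gd - {{u, w}}"
    proof
      fix h assume h: "h \<in> bad d Gd'"
      then have "h \<in> cedges d" "h \<notin> ?N" "h \<notin> Gd" "h \<notin> Sg" by (auto simp: bad_def Gd'_def Ol_def)
      then show "h \<in> bad c Gd - {{u, w}}" using rc'(8) unfolding bad_def by blast
    qed
    then show ?thesis using uw by blast
  qed
  then have "card (bad d Gd') < card (bad c Gd)"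
    by (intro psubset_card_mono) (auto simp: bad_def finite_cedges)
  ultimately show ?thesis by blast
qed

lemma card_protected:
  assumes s: "st Mu Pr c Gd I"
  shows "finite (\<Union>(Pr \<union> Sg))" "card (\<Union>(Pr \<union> Sg)) \<le> 2 * (card Pr + card Sg)"
proof -
  note a = stD(1)[OF s]
  have sub: "Pr \<union> Sg \<subseteq> cedges c" using stD(3,5)[OF s] arrD(4)[OF a] by auto
  have fP: "finite (Pr \<union> Sg)" using finite_subset[OF sub finite_cedges] .
  have two: "card h \<le> 2 \<and> finite h" if "h \<in> Pr \<union> Sg" for h
  proof -
    have "h \<in> cedges c" using that sub by auto
    then have "h \<in> insert {last c, hd c} (pedges c)" by (simp add: cedges_def)
    then obtain u w where "h = {u, w}" by (auto simp: pedges_nth)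
    then show ?thesis by (simp add: card_insert_if)
  qed
  show "finite (\<Union>(Pr \<union> Sg))" using fP two by auto
  have "card (\<Union>(Pr \<union> Sg)) \<le> (\<Sum>h\<in>Pr \<union> Sg. card h)" using card_Union_le_sum_card by blast
  also have "\<dots> \<le> (\<Sum>h\<in>Pr \<union> Sg. 2)" using two by (intro sum_mono) auto
  also have "\<dots> = 2 * card (Pr \<union> Sg)" by simp
  also have "\<dots> \<le> 2 * (card Pr + card Sg)" using card_Un_le[of Pr Sg] by simp
  finally show "card (\<Union>(Pr \<union> Sg)) \<le> 2 * (card Pr + card Sg)" .
qed

text \<open>Of the \<open>(k - 2) * (m + 2)\<close> pool vertices, \<open>2 * (k - 2)\<close> become
  the interiors of the two edges at \<open>u\<close> and \<open>w\<close>, and the others are split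
  into \<open>k - 2\<close> sets of \<open>m\<close> candidates for the third. For
  \<open>k = 2\<close> the bound is vacuous, so that such a move is always possible.\<close>

lemma step_pool:
  assumes s: "st Mu Pr c Gd I" and b: "bad c Gd \<noteq> {}" and P: "card Pr + card Sg \<le> P0"
    and big: "(k - 2) * (m + 2) \<le> card (pool V c Gd I - KK)"
  shows "\<exists>d Gd' I'. st Mu Pr d Gd' I' \<and> card (bad d Gd') < card (bad c Gd)"
proof -
  note a = stD(1)[OF s]
  let ?L = "pool V c Gd I - KK"
  have fL: "finite ?L" using V by (simp add: pool_def)
  have ne: "2 \<le> length c" using stD(2)[OF s] X3 arrD(1)[OF a] by (metis distinct_card le_trans numeral_le_iff semiring_norm(68,72))
  obtain h where h: "h \<in> bad c Gd" using b by auto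
  then have "h \<in> cedges c" by (simp add: bad_def)
  then obtain u w where uw: "h = {u, w}" using cedges_doubleton[OF arrD(1)[OF a] ne] by metis
  have big': "(k - 2) * m + (k - 2) * 2 \<le> card ?L" using big unfolding add_mult_distrib2 .
  then have "(k - 2) * 2 \<le> card ?L" by linarith
  then obtain J where J: "J \<subseteq> ?L" "card J = (k - 2) * 2" by (meson obtain_subset_with_card_n)
  have fJ: "finite J" using J fL finite_subset by blast
  have "k - 2 \<le> card J" using J(2) by simp
  then obtain J1 where J1: "J1 \<subseteq> J" "card J1 = k - 2" by (meson obtain_subset_with_card_n)
  define J2 where "J2 = J - J1"
  have J2: "card J2 = k - 2" "J1 \<inter> J2 = {}"
    using J J1 fJ by (auto simp: J2_def card_Diff_subset finite_subset)
  have cL: "(k - 2) * m \<le> card (?L - J)"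
    using big' J fJ by (simp add: card_Diff_subset)
  obtain A where A: "\<forall>j\<in>{..<k - 2}. A j \<subseteq> ?L - J \<and> card (A j) = m" "disjoint_family_on A {..<k - 2}"
    using disjoint_choice[of "{..<k - 2}" "k - 2" "\<lambda>_. ?L - J" m] cL fL by auto
  have LV: "?L \<subseteq> V - X" using stD(2)[OF s] by (auto simp: pool_def)
  have "2 * (card Pr + card Sg) \<le> 2 * P0" using P by simp
  with card_protected(2)[OF s] have B: "card (\<Union>(Pr \<union> Sg)) \<le> 2 * P0" by (rule order_trans)
  obtain x y p q d a' where mv: "reconnects c d u w x y p q" "x \<notin> \<Union>(Pr \<union> Sg)" "y \<notin> \<Union>(Pr \<union> Sg)" "p \<notin> \<Union>(Pr \<union> Sg)"
    "{u, x} \<union> J1 \<in> E" "{w, y} \<union> J2 \<in> E" "{p, q} \<union> a' ` {..<k - 2} \<in> E" "\<And>j. j < k - 2 \<Longrightarrow> a' j \<in> A j"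
  proof (rule find_move[OF arrD(1)[OF a] stD(2)[OF s], of u w J1 J2 "\<Union>(Pr \<union> Sg)" A])
    show "{u, w} \<in> cedges c" using h uw by (simp add: bad_def)
    show "J1 \<subseteq> V - X" "J2 \<subseteq> V - X" using J J1 LV by (auto simp: J2_def)
    show "A j \<subseteq> V - X \<and> m \<le> card (A j)" if "j < k - 2" for j using A(1) LV that by auto
  qed (use J1 J2 A(2) B card_protected(1)[OF s] in auto)
  have ai: "inj_on a' {..<k - 2}"
    using mv(8) A(2) by (auto simp: inj_on_def disjoint_family_on_def) (metis IntI empty_iff lessThan_iff)
  have aL: "a' ` {..<k - 2} \<subseteq> ?L - J" using mv(8) A(1) by auto
  have Yp: "?L \<inter> Y = {}" by (rule stD(7)[OF s])
  have "\<exists>Gd' I'. st Mu Pr d Gd' I' \<and> card (bad d Gd') < card (bad c Gd)"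
  proof (rule apply_move[OF a stD(2,3,4,5,6)[OF s], where ?J3.0 = "a' ` {..<k - 2}"])
    show "(pool V c Gd I - KK - a' ` {..<k - 2}) \<inter> Y = {}" using Yp by blast
    show "{u, w} \<in> bad c Gd" using h uw by simp
    show "J1 \<subseteq> ?L" "J2 \<subseteq> ?L" "a' ` {..<k - 2} \<subseteq> ?L" using J J1 aL by (auto simp: J2_def)
    show "card (a' ` {..<k - 2}) = k - 2" using ai by (simp add: card_image)
    show "J1 \<inter> a' ` {..<k - 2} = {}" "J2 \<inter> a' ` {..<k - 2} = {}" using aL J1 by (auto simp: J2_def)
    show "Pr = Pr \<and> a' ` {..<k - 2} \<inter> Y = {} \<or> Pr = insert {p, q} Pr" using aL Yp by blast
    show "f \<inter> X \<in> Pr \<and> I (f \<inter> X) = f - X" if "f \<in> Mu" for f using stD(10,11)[OF s that] by simp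
  qed (use mv J1 J2 stD(8,9)[OF s] in auto)
  then show ?thesis by blast
qed

text \<open>The candidate sets must be fixed before a transversal \<open>a\<close> is known, and the
  reserve edges behind \<open>a\<close> are identified afterwards; hence the conclusion quantifies
  over all \<open>a\<close>. Reserve edges are pairwise disjoint, so a released vertex determines
  its edge. \<open>Q\<close> is a side condition on the released vertex: trivial for moves,
  adjacency to a gadget at the end.\<close>

lemma reserve_choice:
  fixes v :: "nat \<Rightarrow> 'a" and G :: "nat \<Rightarrow> 'a set set" and t :: nat
  assumes s: "st Mu Pr c Gd I"
    and G: "\<And>j. j < t \<Longrightarrow> u + t * m \<le> card {f\<in>Mr. f \<in> G j}" and u: "card (Mr - Mu) \<le> u"
    and sw: "\<And>j f. j < t \<Longrightarrow> f \<in> G j \<Longrightarrow> \<exists>b\<in>f - X. Q j b \<and> insert (v j) (f - {b}) \<in> E"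
  obtains A where "disjoint_family_on A {..<t}" "\<forall>j<t. A j \<subseteq> \<Union>(I ` Pr) \<and> m \<le> card (A j)"
    "\<forall>a. (\<forall>j<t. a j \<in> A j) \<longrightarrow> (\<exists>f. inj_on f {..<t} \<and> (\<forall>j<t. f j \<in> Mu \<and> a j \<in> f j - X \<and> Q j (a j) \<and>
        insert (v j) (f j - {a j}) \<in> E))"
proof -
  have MuM: "Mu \<subseteq> Mr" by (rule stD(9)[OF s])
  have "finite {f\<in>Mu. f \<in> G j} \<and> t * m \<le> card {f\<in>Mu. f \<in> G j}" if "j \<in> {..<t}" for j
  proof
    show "finite {f\<in>Mu. f \<in> G j}" using MuM Mr finite_subset by (metis (no_types, lifting) mem_Collect_eq subsetI)
    have "{f\<in>Mr. f \<in> G j} \<subseteq> {f\<in>Mu. f \<in> G j} \<union> (Mr - Mu)" by auto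
    then have "card {f\<in>Mr. f \<in> G j} \<le> card ({f\<in>Mu. f \<in> G j} \<union> (Mr - Mu))"
      using Mr MuM by (intro card_mono) (auto intro: finite_subset)
    also have "\<dots> \<le> card {f\<in>Mu. f \<in> G j} + card (Mr - Mu)" by (rule card_Un_le)
    finally show "t * m \<le> card {f\<in>Mu. f \<in> G j}" using G[of j] that u by simp
  qed
  then obtain D where D: "\<forall>j\<in>{..<t}. D j \<subseteq> {f\<in>Mu. f \<in> G j} \<and> card (D j) = m" "disjoint_family_on D {..<t}"
    using disjoint_choice[of "{..<t}" t "\<lambda>j. {f\<in>Mu. f \<in> G j}" m] by auto
  have "\<exists>b. b \<in> f - X \<and> Q j b \<and> insert (v j) (f - {b}) \<in> E" if "j < t" "f \<in> D j" for j f
    using sw[OF that(1), of f] D that by auto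
  then obtain b where b: "\<And>j f. j < t \<Longrightarrow> f \<in> D j \<Longrightarrow>
      b j f \<in> f - X \<and> Q j (b j f) \<and> insert (v j) (f - {b j f}) \<in> E" by metis
  have DM: "f \<in> Mu" "f \<in> Mr" if "j < t" "f \<in> D j" for j f using D(1) that MuM by auto
  have same: "f = h" if "f \<in> Mr" "h \<in> Mr" "z \<in> f" "z \<in> h" for f h z using Mdis that by blast
  have dis: "i = j" if "i < t" "j < t" "f \<in> D i" "f \<in> D j" for i j f
    using D(2) that by (auto simp: disjoint_family_on_def)
  have eq: "f = h" if "i < t" "j < t" "f \<in> D i" "h \<in> D j" "b i f = b j h" for i j f h
    using same[OF DM(2)[OF that(1,3)] DM(2)[OF that(2,4)], of "b i f"] b[OF that(1,3)] b[OF that(2,4)] that(5) by auto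
  show thesis
  proof (rule that[of "\<lambda>j. b j ` D j"])
    show "disjoint_family_on (\<lambda>j. b j ` D j) {..<t}"
      unfolding disjoint_family_on_def
    proof (intro ballI impI)
      fix i j assume ij: "i \<in> {..<t}" "j \<in> {..<t}" "i \<noteq> j"
      have False if "z \<in> b i ` D i" "z \<in> b j ` D j" for z
      proof -
        obtain f h where fh: "f \<in> D i" "h \<in> D j" "z = b i f" "z = b j h" using \<open>z \<in> b i ` D i\<close> \<open>z \<in> b j ` D j\<close> by auto
        then have "f = h" using eq[of i j f h] ij by simp
        then show False using dis[of i j f] fh ij by simp
      qed
      then show "b i ` D i \<inter> b j ` D j = {}" by blast
    qed
    show "\<forall>j<t. b j ` D j \<subseteq> \<Union>(I ` Pr) \<and> m \<le> card (b j ` D j)"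
    proof (intro allI impI)
      fix j assume j: "j < t"
      have "inj_on (b j) (D j)" using eq[OF j j] by (auto simp: inj_on_def)
      then have "card (b j ` D j) = m" using D(1) j by (simp add: card_image)
      moreover have "b j f \<in> \<Union>(I ` Pr)" if "f \<in> D j" for f
        using b[OF j that] stD(10,11)[OF s DM(1)[OF j that]] by (metis UN_I)
      ultimately show "b j ` D j \<subseteq> \<Union>(I ` Pr) \<and> m \<le> card (b j ` D j)" by auto
    qed
    show "\<forall>a. (\<forall>j<t. a j \<in> b j ` D j) \<longrightarrow> (\<exists>f. inj_on f {..<t} \<and> (\<forall>j<t. f j \<in> Mu \<and> a j \<in> f j - X \<and> Q j (a j) \<and>
        insert (v j) (f j - {a j}) \<in> E))"
    proof (intro allI impI)
      fix a assume "\<forall>j<t. a j \<in> b j ` D j"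
      then have "\<exists>f. f \<in> D j \<and> a j = b j f" if "j < t" for j using that by blast
      then obtain f where f: "\<And>j. j < t \<Longrightarrow> f j \<in> D j \<and> a j = b j (f j)" by metis
      have "inj_on f {..<t}" using f dis by (auto simp: inj_on_def) (metis)
      then show "\<exists>f. inj_on f {..<t} \<and> (\<forall>j<t. f j \<in> Mu \<and> a j \<in> f j - X \<and> Q j (a j) \<and> insert (v j) (f j - {a j}) \<in> E)"
        using f b DM by (intro exI[of _ f]) auto
    qed
  qed
qed

lemma swap_reserves:
  fixes f :: "nat \<Rightarrow> 'a set" and v a :: "nat \<Rightarrow> 'a" and t :: nat
  assumes s: "st Mu Pr c Gd I" and f: "inj_on f {..<t}" "\<And>j. j < t \<Longrightarrow> f j \<in> Mu \<and> a j \<in> f j - X \<and> insert (v j) (f j - {a j}) \<in> E"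
    and v: "inj_on v {..<t}" "\<And>j. j < t \<Longrightarrow> v j \<in> pool V c Gd I"
  obtains I' where "arr k V E c Gd I'" "pool V c Gd I' = (pool V c Gd I - v ` {..<t}) \<union> a ` {..<t}"
    "\<And>h. h \<in> Gd \<Longrightarrow> h \<notin> Pr \<Longrightarrow> I' h = I h"
    "\<And>h. h \<in> Mu \<Longrightarrow> h \<notin> f ` {..<t} \<Longrightarrow> I' (h \<inter> X) = I (h \<inter> X)"
proof -
  have MuM: "f j \<in> Mr" if "j < t" for j using f(2)[OF that] stD(9)[OF s] by auto
  have XI: "h = h'" if "h \<in> Mr" "h' \<in> Mr" "h \<inter> X = h' \<inter> X" for h h'
  proof (rule ccontr)
    assume "h \<noteq> h'"
    then have "h \<inter> h' = {}" using Mdis that by blast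
    then show False using Mne[OF that(1)] that(3) by blast
  qed
  have "\<exists>I'. arr k V E c Gd I' \<and> pool V c Gd I' = (pool V c Gd I - v ` {..<t}) \<union> a ` {..<t} \<and>
    (\<forall>h. h \<notin> (\<lambda>j. f j \<inter> X) ` {..<t} \<longrightarrow> I' h = I h)"
  proof (rule arr_swaps[OF stD(1)[OF s] V])
    show "inj_on (\<lambda>j. f j \<inter> X) {..<t}"
      using f(1) XI MuM by (auto simp: inj_on_def)
    fix j assume j: "j < t"
    have fj: "f j \<in> Mu" "a j \<in> f j - X" "insert (v j) (f j - {a j}) \<in> E" using f(2)[OF j] by auto
    have I: "f j \<inter> X \<in> Pr" "I (f j \<inter> X) = f j - X" using stD(10,11)[OF s fj(1)] by auto
    then show "f j \<inter> X \<in> Gd \<and> a j \<in> I (f j \<inter> X)" using stD(5)[OF s] fj(2) by auto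
    have "(f j \<inter> X) \<union> I (f j \<inter> X) = f j" using I by auto
    then show "insert (v j) ((f j \<inter> X) \<union> I (f j \<inter> X) - {a j}) \<in> E" using fj(3) by simp
    show "v j \<in> pool V c Gd I" by (rule v(2)[OF j])
  qed (rule v(1))
  then obtain I' where I': "arr k V E c Gd I'" "pool V c Gd I' = (pool V c Gd I - v ` {..<t}) \<union> a ` {..<t}"
    "\<forall>h. h \<notin> (\<lambda>j. f j \<inter> X) ` {..<t} \<longrightarrow> I' h = I h" by blast
  show thesis
  proof (rule that[OF I'(1,2)])
    fix h assume "h \<in> Gd" "h \<notin> Pr"
    moreover have "f j \<inter> X \<in> Pr" if "j < t" for j using stD(10)[OF s] f(2)[OF that] by simp
    ultimately show "I' h = I h" using I'(3) by (metis (mono_tags, lifting) imageE lessThan_iff)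
  next
    fix h assume h: "h \<in> Mu" "h \<notin> f ` {..<t}"
    have "h \<inter> X \<noteq> f j \<inter> X" if "j < t" for j
      using XI[of h "f j"] MuM[OF that] h stD(9)[OF s] that by auto
    then show "I' (h \<inter> X) = I (h \<inter> X)" using I'(3) by (metis (mono_tags, lifting) imageE lessThan_iff)
  qed
qed

end

text \<open>The pair \<open>{u, w}\<close> is replaced by the path \<open>u, b 0, b 1, w\<close>:
  \<open>b 0\<close> and \<open>b 1\<close> turn into joints, \<open>K1\<close> and
  \<open>K2\<close> are the interiors of the outer edges, and \<open>b 2, ..., b (k - 1)\<close>
  form that of the middle edge.\<close>

lemma arr_close:
  assumes a: "arr k V E c Gd I" and k: "k \<ge> 3" and uw: "{u, w} \<in> cedges c" "{u, w} \<notin> Gd" and l: "3 \<le> length c"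
    and K: "K1 \<subseteq> pool V c Gd I" "K2 \<subseteq> pool V c Gd I" "card K1 = k - 2" "card K2 = k - 2" "K1 \<inter> K2 = {}"
    and b: "inj_on b {..<k}" "b ` {..<k} \<subseteq> pool V c Gd I" "b ` {..<k} \<inter> (K1 \<union> K2) = {}"
    and e: "{u, b 0} \<union> K1 \<in> E" "{w, b 1} \<union> K2 \<in> E" "b ` {..<k} \<in> E"
  defines "N \<equiv> {{u, b 0}, {b 0, b 1}, {b 1, w}}"
  shows "\<exists>d I'. arr k V E d (Gd \<union> N) I' \<and> length d = length c + 2 \<and>
     cedges d = (cedges c - {{u, w}}) \<union> N \<and>
     pool V d (Gd \<union> N) I' = pool V c Gd I - K1 - K2 - b ` {..<k}"
proof -
  obtain c' where c': "distinct c'" "set c' = set c" "cedges c' = cedges c" "hd c' = w" "last c' = u" "c' \<noteq> []"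
    using cedges_normal[OF arrD(1,2)[OF a] uw(1)] by blast
  have lc: "length c' = length c" using c'(1,2) arrD(1)[OF a] by (metis distinct_card)
  have b01: "b 0 \<in> pool V c Gd I" "b 1 \<in> pool V c Gd I" "b 0 \<noteq> b 1"
    using b(2) k inj_onD[OF b(1), of 0 1] by auto
  then have bc: "b 0 \<notin> set c" "b 1 \<notin> set c" by (auto simp: pool_def)
  define d where "d = c' @ [b 0, b 1]"
  have uin: "u \<in> set c" "w \<in> set c" using cedges_subset[OF arrD(2)[OF a] uw(1)] by auto
  have d: "distinct d" "d \<noteq> []" "set d = set c \<union> {b 0, b 1}" using c' b01 bc by (auto simp: d_def)
  have "pedges d = {{u, b 0}, {b 0, b 1}} \<union> pedges c'"
    using c' by (simp add: d_def pedges_append insert_commute)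
  then have cd: "cedges d = N \<union> pedges c'"
    using c' by (simp add: cedges_def N_def d_def insert_commute)
  have "{u, w} \<notin> pedges c'" using ends_notin_pedges[OF c'(1)] lc l c'(4,5) by simp
  moreover have "cedges c = insert {u, w} (pedges c')" using c'(3-5) by (simp add: cedges_def)
  ultimately have pc: "pedges c' = cedges c - {{u, w}}" by simp
  have GN: "N \<inter> Gd = {}"
  proof -
    have "h \<notin> Gd" if "h \<in> N" for h
      using that bc cedges_subset[OF arrD(2)[OF a], of h] arrD(4)[OF a] by (auto simp: N_def)
    then show ?thesis by blast
  qed
  have ne: "{u, b 0} \<noteq> {b 0, b 1}" "{u, b 0} \<noteq> {b 1, w}" "{b 0, b 1} \<noteq> {b 1, w}"
    using uin bc b01 by (auto simp: doubleton_eq_iff)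
  define J where "J h = (if h = {u, b 0} then K1 else if h = {b 1, w} then K2 else b ` {2..<k})" for h
  have Je: "J {u, b 0} = K1" "J {b 1, w} = K2" "J {b 0, b 1} = b ` {2..<k}"
    using ne by (auto simp: J_def)
  have sp: "{..<k} = {0, 1} \<union> {2..<k}" using k by auto
  have cb: "card (b ` {2..<k}) = k - 2"
    using inj_on_subset[OF b(1), of "{2..<k}"] by (simp add: card_image lessThan_atLeast0)
  have b2: "b ` {2..<k} \<subseteq> b ` {..<k}" by auto
  have b2': "{2..<k} \<subseteq> {..<k}" by auto
  have b02: "b 0 \<notin> b ` {2..<k}" "b 1 \<notin> b ` {2..<k}"
    using inj_on_image_mem_iff[OF b(1), of 0 "{2..<k}"] inj_on_image_mem_iff[OF b(1), of 1 "{2..<k}"] k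
      b2' by auto
  define I' where "I' h = (if h \<in> N then J h else I h)" for h
  have UJ: "\<Union>(J ` N) = K1 \<union> K2 \<union> b ` {2..<k}" using Je by (auto simp: N_def)
  have "arr k V E d (Gd \<union> N) I'"
    unfolding I'_def
  proof (rule arr_update[OF a d(1,2)])
    show "set d \<subseteq> V" using d(3) arrD(3)[OF a] b01 by (auto simp: pool_def)
    show "Gd \<subseteq> Gd \<inter> cedges d" using arrD(4)[OF a] uw(2) cd pc by auto
    show "finite N" "N \<subseteq> cedges d" "N \<inter> Gd = {}" using cd GN by (auto simp: N_def)
    show "J h \<subseteq> pool V c Gd I \<and> card (J h) = k - 2 \<and> h \<union> J h \<in> E" if "h \<in> N" for h
    proof -
      have "{b 0, b 1} \<union> b ` {2..<k} = b ` {..<k}" unfolding sp by auto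
      moreover have "{b 1, w} = {w, b 1}" by auto
      moreover have "b ` {2..<k} \<subseteq> pool V c Gd I" using b(2) b2 by blast
      ultimately show ?thesis using that K e cb Je unfolding N_def by auto
    qed
    have "b ` {2..<k} \<inter> (K1 \<union> K2) = {}" using b(3) b2 by blast
    then show "J h \<inter> J h' = {}" if "h \<in> N" "h' \<in> N" "h \<noteq> h'" for h h'
      using that K(5) Je unfolding N_def by (auto simp: Int_commute)
    show "set c \<subseteq> set d" using d(3) by auto
    have "b 0 \<in> b ` {..<k}" "b 1 \<in> b ` {..<k}" using k by auto
    then have "b 0 \<notin> K1 \<union> K2" "b 1 \<notin> K1 \<union> K2" using b(3) by blast+
    then show "set d - set c \<subseteq> pool V c Gd I - \<Union>(J ` N)" unfolding UJ d(3) using b01 b02 by auto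
  qed
  moreover have "length d = length c + 2" by (simp add: d_def lc)
  moreover have "cedges d = (cedges c - {{u, w}}) \<union> N" using cd pc by auto
  moreover have "pool V d (Gd \<union> N) I' = pool V c Gd I - K1 - K2 - b ` {..<k}"
  proof -
    have "I' ` Gd = I ` Gd" using GN by (intro image_cong) (auto simp: I'_def)
    moreover have "I' ` N = J ` N" by (intro image_cong) (auto simp: I'_def)
    ultimately have "\<Union>(I' ` (Gd \<union> N)) = \<Union>(I ` Gd) \<union> (K1 \<union> K2 \<union> b ` {2..<k})"
      by (simp add: image_Un UJ)
    moreover have "b ` {..<k} = {b 0, b 1} \<union> b ` {2..<k}" unfolding sp by auto
    ultimately show ?thesis unfolding pool_def d(3) by auto
  qed
  ultimately show ?thesis by blast
qed

lemma loose_cycle_of_arr: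
  assumes a: "arr k V E c Gd I" and G: "cedges c \<subseteq> Gd" and k: "k \<ge> 2" and n: "n \<ge> 3" "length c = n"
    and V: "finite V" "card V = (k - 1) * n"
  shows "has_loose_Hamilton_cycle k V E"
proof (rule loose_cycle_of_arrangement[OF k n(1) V arrD(1)[OF a] n(2) arrD(3)[OF a]])
  fix g assume "g \<in> cedges c"
  then have "g \<in> Gd" using G by auto
  then show "I g \<subseteq> V - set c \<and> card (I g) = k - 2 \<and> g \<union> I g \<in> E" using arrD(5-7)[OF a] by simp
  fix h assume "h \<in> cedges c" "g \<noteq> h"
  then show "I g \<inter> I h = {}" using arrD(8)[OF a] \<open>g \<in> Gd\<close> G by blast
qed

context perturbed
begin

text \<open>Too few unplaced vertices remain to offer linear sets for the third interior, so the
  reserve offers them: \<open>k - 2\<close> pool vertices are assigned to reserve edges, and the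
  vertices they could release are the candidates. The swaps are carried out once the move is known.
  The edges used leave \<open>Mu\<close>, since their interiors have changed.\<close>

lemma step_reserve:
  assumes s: "st Mu Pr c Gd I" and b: "bad c Gd \<noteq> {}" and P: "card Pr + card Sg \<le> P0"
    and u: "card (Mr - Mu) + (k - 2) * m \<le> g"
  shows "\<exists>Mu' Pr' d Gd' I'. st Mu' Pr' d Gd' I' \<and> card (bad d Gd') < card (bad c Gd) \<and>
     card (Mr - Mu') \<le> card (Mr - Mu) + (k - 2) \<and> card Pr' \<le> card Pr + 1"
proof -
  note a = stD(1)[OF s]
  let ?L = "pool V c Gd I - KK" and ?t = "k - 2"
  have fL: "finite ?L" using V by (simp add: pool_def)
  have ne: "2 \<le> length c" using stD(2)[OF s] X3 arrD(1)[OF a] by (metis distinct_card le_trans numeral_le_iff semiring_norm(68,72))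
  obtain h where h: "h \<in> bad c Gd" using b by auto
  then have "h \<in> cedges c" by (simp add: bad_def)
  then obtain u w where uw: "h = {u, w}" using cedges_doubleton[OF arrD(1)[OF a] ne] by metis
  have "card (bad c Gd) > 0" using b finite_cedges[of c] by (simp add: bad_def card_gt_0_iff)
  \<comment> \<open>One bad pair contributes \<open>k - 2\<close> to the pool and
    \<open>free\<close> at least \<open>2 * (k - 2)\<close>: enough for \<open>J1\<close>,
    \<open>J2\<close> and the vertices \<open>v j\<close> that enter the reserve.\<close>
  then have "?t * 1 \<le> ?t * card (bad c Gd)" by (intro mult_le_mono2) simp
  then have "3 * ?t \<le> card ?L" using card_free_pool[OF s] free by linarith
  moreover have "card {..<3 * ?t} = 3 * ?t" by simp
  ultimately obtain z where z: "inj_on z {..<3 * ?t}" "z ` {..<3 * ?t} \<subseteq> ?L"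
    using card_le_inj[of "{..<3 * ?t}" ?L] fL by auto
  define J1 where "J1 = z ` {..<?t}"
  define J2 where "J2 = z ` {?t..<2 * ?t}"
  define v where "v j = z (2 * ?t + j)" for j
  have zeq: "z i = z j \<longleftrightarrow> i = j" if "i < 3 * ?t" "j < 3 * ?t" for i j
    using z(1) that by (auto simp: inj_on_def)
  have cJ: "card J1 = ?t" "card J2 = ?t"
  proof -
    have "{..<?t} \<subseteq> {..<3 * ?t}" "{?t..<2 * ?t} \<subseteq> {..<3 * ?t}" by auto
    then have "inj_on z {..<?t}" "inj_on z {?t..<2 * ?t}" using inj_on_subset[OF z(1)] by blast+
    then show "card J1 = ?t" "card J2 = ?t" by (simp_all add: J1_def J2_def card_image)
  qed
  have zL: "z i \<in> ?L" if "i < 3 * ?t" for i using z(2) that by blast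
  have vL: "v j \<in> ?L" if "j < ?t" for j using zL[of "2 * ?t + j"] that unfolding v_def by linarith
  have JL: "J1 \<subseteq> ?L" "J2 \<subseteq> ?L" using zL unfolding J1_def J2_def by (simp_all add: image_subset_iff)
  have Jd: "J1 \<inter> J2 = {}" "J1 \<inter> v ` {..<?t} = {}" "J2 \<inter> v ` {..<?t} = {}"
    using zeq by (auto simp: J1_def J2_def v_def)
  have vi: "inj_on v {..<?t}" using zeq by (auto simp: inj_on_def v_def)
  have LV: "?L \<subseteq> V - X" using stD(2)[OF s] by (auto simp: pool_def)
  have Yp: "?L \<inter> Y = {}" by (rule stD(7)[OF s])
  obtain A where A: "disjoint_family_on A {..<?t}" "\<forall>j<?t. A j \<subseteq> \<Union>(I ` Pr) \<and> m \<le> card (A j)"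
    and Af: "\<forall>a. (\<forall>j<?t. a j \<in> A j) \<longrightarrow> (\<exists>f. inj_on f {..<?t} \<and> (\<forall>j<?t. f j \<in> Mu \<and> a j \<in> f j - X \<and> True \<and>
        insert (v j) (f j - {a j}) \<in> E))"
  proof (rule reserve_choice[OF s, of ?t "card (Mr - Mu)" "\<lambda>j. F (v j)" "\<lambda>_ _. True" v])
    fix j assume j: "j < ?t"
    then have "3 \<le> k" by simp
    moreover have "v j \<in> V - X - Y" using vL[OF j] LV Yp by blast
    ultimately show "card (Mr - Mu) + ?t * m \<le> card {f\<in>Mr. f \<in> F (v j)}" using res u by (meson le_trans)
    show "\<exists>b\<in>f - X. True \<and> insert (v j) (f - {b}) \<in> E" if "f \<in> F (v j)" for f using swap[OF that] by simp
  qed (rule order_refl)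
  have IPV: "\<Union>(I ` Pr) \<subseteq> V - X - pool V c Gd I"
    using arrD(5)[OF a] stD(2)[OF s] stD(5)[OF s] by (auto simp: pool_def)
  have "2 * (card Pr + card Sg) \<le> 2 * P0" using P by simp
  with card_protected(2)[OF s] have B: "card (\<Union>(Pr \<union> Sg)) \<le> 2 * P0" by (rule order_trans)
  obtain x y p q d a' where mv: "reconnects c d u w x y p q" "x \<notin> \<Union>(Pr \<union> Sg)" "y \<notin> \<Union>(Pr \<union> Sg)" "p \<notin> \<Union>(Pr \<union> Sg)"
    "{u, x} \<union> J1 \<in> E" "{w, y} \<union> J2 \<in> E" "{p, q} \<union> a' ` {..<?t} \<in> E" "\<And>j. j < ?t \<Longrightarrow> a' j \<in> A j"
  proof (rule find_move[OF arrD(1)[OF a] stD(2)[OF s], of u w J1 J2 "\<Union>(Pr \<union> Sg)" A])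
    show "{u, w} \<in> cedges c" using h uw by (simp add: bad_def)
    show "J1 \<subseteq> V - X" "J2 \<subseteq> V - X" using JL LV by auto
    show "A j \<subseteq> V - X \<and> m \<le> card (A j)" if "j < ?t" for j using A(2) that IPV by auto
  qed (use cJ A(1) B card_protected(1)[OF s] in auto)
  obtain f where f: "inj_on f {..<?t}" "\<And>j. j < ?t \<Longrightarrow> f j \<in> Mu \<and> a' j \<in> f j - X \<and> insert (v j) (f j - {a' j}) \<in> E"
    using Af[rule_format, of a'] mv(8) by blast
  have vp: "v j \<in> pool V c Gd I" if "j < ?t" for j using vL[OF that] by simp
  obtain I1 where I1: "arr k V E c Gd I1" "pool V c Gd I1 = (pool V c Gd I - v ` {..<?t}) \<union> a' ` {..<?t}"
    "\<And>h. h \<in> Gd \<Longrightarrow> h \<notin> Pr \<Longrightarrow> I1 h = I h"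
    "\<And>h. h \<in> Mu \<Longrightarrow> h \<notin> f ` {..<?t} \<Longrightarrow> I1 (h \<inter> X) = I (h \<inter> X)"
    using swap_reserves[OF s f vi vp] by metis
  let ?J3 = "a' ` {..<?t}"
  have aI: "?J3 \<subseteq> \<Union>(I ` Pr)" using mv(8) A(2) by blast
  have ai: "inj_on a' {..<?t}"
    using mv(8) A(1) by (auto simp: inj_on_def disjoint_family_on_def) (metis IntI empty_iff lessThan_iff)
  have a3: "?J3 \<inter> pool V c Gd I = {}" using aI IPV by blast
  have vK: "v ` {..<?t} \<inter> KK = {}" using vL by auto
  have KKp: "KK \<subseteq> pool V c Gd I" by (rule stD(6)[OF s])
  define Mu' where "Mu' = Mu - f ` {..<?t}"
  have "\<exists>Gd' I'. st Mu' (insert {p, q} Pr) d Gd' I' \<and> card (bad d Gd') < card (bad c Gd)"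
  proof (rule apply_move[OF I1(1) stD(2,3,4,5)[OF s], where ?J3.0 = ?J3])
    show "KK \<subseteq> pool V c Gd I1" unfolding I1(2) using KKp vK by blast
    show "(pool V c Gd I1 - KK - ?J3) \<inter> Y = {}" unfolding I1(2) using Yp by blast
    show "I1 h \<inter> Y = {}" if "h \<in> Gd" "h \<notin> Pr" for h using I1(3)[OF that] stD(8)[OF s that] by simp
    show "Mu' \<subseteq> Mr" using stD(9)[OF s] by (auto simp: Mu'_def)
    show "h \<inter> X \<in> Pr \<and> I1 (h \<inter> X) = h - X" if "h \<in> Mu'" for h
      using that I1(4)[of h] stD(10,11)[OF s, of h] by (simp add: Mu'_def)
    show "{u, w} \<in> bad c Gd" using h uw by simp
    show "J1 \<subseteq> pool V c Gd I1 - KK" "J2 \<subseteq> pool V c Gd I1 - KK" unfolding I1(2) using JL Jd by blast+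
    show "?J3 \<subseteq> pool V c Gd I1 - KK" unfolding I1(2) using a3 KKp by blast
    show "card ?J3 = ?t" using ai by (simp add: card_image)
    show "J1 \<inter> ?J3 = {}" "J2 \<inter> ?J3 = {}" using JL a3 by blast+
    show "reconnects c d u w x y p q" by (rule mv(1))
  qed (use mv cJ Jd in auto)
  then obtain Gd' I' where G: "st Mu' (insert {p, q} Pr) d Gd' I'" "card (bad d Gd') < card (bad c Gd)" by blast
  have "Mr - Mu' \<subseteq> (Mr - Mu) \<union> f ` {..<?t}" by (auto simp: Mu'_def)
  then have "card (Mr - Mu') \<le> card ((Mr - Mu) \<union> f ` {..<?t})" using Mr by (intro card_mono) auto
  also have "\<dots> \<le> card (Mr - Mu) + ?t"
    using card_Un_le[of "Mr - Mu" "f ` {..<?t}"] card_image_le[of "{..<?t}" f] by simp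
  finally have "card (Mr - Mu') \<le> card (Mr - Mu) + ?t" .
  moreover have "card (insert {p, q} Pr) \<le> card Pr + 1" by (metis Suc_eq_plus1 card_insert_le_m1 diff_Suc_1 le_refl zero_less_Suc)
  ultimately show ?thesis using G by blast
qed

section \<open>Removing all bad pairs and closing the gadgets\<close>

lemma phase_pool:
  assumes "st Mu Pr c Gd I" and P: "card Pr + card Sg \<le> P0"
  shows "\<exists>d Gd' I'. st Mu Pr d Gd' I' \<and> (bad d Gd' = {} \<or> card (pool V d Gd' I' - KK) < (k - 2) * (m + 2))"
  using assms(1)
proof (induction "card (bad c Gd)" arbitrary: c Gd I rule: less_induct)
  case less
  show ?case
  proof (cases "bad c Gd = {} \<or> card (pool V c Gd I - KK) < (k - 2) * (m + 2)")
    case True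
    then show ?thesis using less.prems by blast
  next
    case False
    then have F: "bad c Gd \<noteq> {}" "(k - 2) * (m + 2) \<le> card (pool V c Gd I - KK)" by auto
    obtain d Gd' I' where "st Mu Pr d Gd' I'" "card (bad d Gd') < card (bad c Gd)"
      using step_pool[OF less.prems F(1) P F(2)] by blast
    then show ?thesis using less.hyps by blast
  qed
qed

text \<open>Each move costs at most \<open>k - 2\<close> reserve edges and protects at most one more
  pair. Both budgets are therefore stated with a term for the bad pairs still to come, which makes
  them invariant.\<close>

lemma phase_reserve:
  assumes "st Mu Pr c Gd I" and "card Pr + card Sg + card (bad c Gd) \<le> P0"
    and "card (Mr - Mu) + (k - 2) * card (bad c Gd) \<le> U" and U: "U + (k - 2) * m \<le> g"
  shows "\<exists>Mu' Pr' d Gd' I'. st Mu' Pr' d Gd' I' \<and> bad d Gd' = {} \<and> card (Mr - Mu') \<le> U"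
  using assms(1-3)
proof (induction "card (bad c Gd)" arbitrary: Mu Pr c Gd I rule: less_induct)
  case less
  show ?case
  proof (cases "bad c Gd = {}")
    case True
    then show ?thesis using less.prems by (metis add_leE)
  next
    case False
    have P: "card Pr + card Sg \<le> P0" "card (Mr - Mu) + (k - 2) * m \<le> g" using less.prems U by linarith+
    obtain Mu' Pr' d Gd' I' where n: "st Mu' Pr' d Gd' I'" "card (bad d Gd') < card (bad c Gd)"
      "card (Mr - Mu') \<le> card (Mr - Mu) + (k - 2)" "card Pr' \<le> card Pr + 1"
      using step_reserve[OF less.prems(1) False P] by blast
    have "(k - 2) + (k - 2) * card (bad d Gd') = (k - 2) * Suc (card (bad d Gd'))" by simp
    also have "\<dots> \<le> (k - 2) * card (bad c Gd)" using n(2) by (intro mult_le_mono2) simp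
    finally have "card (Mr - Mu') + (k - 2) * card (bad d Gd') \<le> U" using n(3) less.prems(3) by linarith
    moreover have "card Pr' + card Sg + card (bad d Gd') \<le> P0" using n less.prems(2) by linarith
    ultimately show ?thesis using less.hyps[OF n(2,1)] by blast
  qed
qed

text \<open>If moves from the pool stop early, fewer than \<open>(k - 2) * (m + 2)\<close> vertices
  are free, and by \<open>card_free_pool\<close> fewer than \<open>m + 2\<close> pairs are bad. This
  bounds the reserve edges used by the second phase.\<close>

lemma all_good:
  assumes s: "st Mr Pr c Gd I" and P: "card Pr + card Sg + m + 2 \<le> P0" and U: "(k - 2) * (m + 2) + (k - 2) * m \<le> g"
  shows "\<exists>Mu' Pr' d Gd' I'. st Mu' Pr' d Gd' I' \<and> bad d Gd' = {} \<and> card (Mr - Mu') \<le> (k - 2) * (m + 2)"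
proof -
  obtain d Gd' I' where d: "st Mr Pr d Gd' I'" "bad d Gd' = {} \<or> card (pool V d Gd' I' - KK) < (k - 2) * (m + 2)"
    using phase_pool[OF s] P by auto
  show ?thesis
  proof (cases "bad d Gd' = {}")
    case True
    then show ?thesis using d(1) by (metis Diff_cancel card.empty le0)
  next
    case False
    then have "(k - 2) * card (bad d Gd') < (k - 2) * (m + 2)" using d(2) card_free_pool[OF d(1)] by linarith
    then have b: "card (bad d Gd') < m + 2" by (metis mult_less_cancel1)
    have "(k - 2) * card (bad d Gd') \<le> (k - 2) * (m + 2)" using b by (intro mult_le_mono2) simp
    then show ?thesis using phase_reserve[OF d(1) _ _ U] P b by simp
  qed
qed

text \<open>Without bad pairs exactly \<open>2 * k\<close> vertices are unplaced outside
  \<open>KK\<close>. All of them enter the reserve, and the \<open>2 * k\<close> released vertices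
  are chosen to form two edges, the middle edges of the gadgets. Two vertices of each middle edge
  must in addition complete \<open>insert (uu i) (Kf i)\<close> to an edge; the families
  \<open>F' i\<close> release only vertices with this property.\<close>

lemma close_gadgets:
  assumes k3: "k \<ge> 3" and s: "st Mu Pr c Gd I" and b: "bad c Gd = {}"
    and Sg: "Sg = {{uu 0, uu 1}, {uu 2, uu 3}}" "{uu 0, uu 1} \<noteq> {uu (2::nat), uu 3}"
    and KK: "KK = (\<Union>i<4. Kf i)" "disjoint_family_on Kf {..<4}" "\<And>i. i < (4::nat) \<Longrightarrow> card (Kf i) = k - 2"
    and fr: "free = 2 * k" and n: "card V = (k - 1) * n" "card X + 4 = n"
    and res4: "\<And>i v. i < 4 \<Longrightarrow> v \<in> V - X - Y \<Longrightarrow> g \<le> card {f\<in>Mr. f \<in> F' i v}"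
    and swap4: "\<And>i v f. i < 4 \<Longrightarrow> f \<in> F' i v \<Longrightarrow>
      \<exists>b\<in>f - X. b \<in> nbs E V (insert (uu i) (Kf i)) \<and> insert v (f - {b}) \<in> E"
    and U: "card (Mr - Mu) + 2 * k * m \<le> g"
  shows "has_loose_Hamilton_cycle k V E"
proof -
  note a = stD(1)[OF s]
  let ?L = "pool V c Gd I - KK" and ?t = "2 * k"
  have fL: "finite ?L" using V by (simp add: pool_def)
  have cL: "card ?L = ?t" using card_free_pool[OF s] b fr by simp
  obtain v where v: "bij_betw v {..<?t} ?L"
    using ex_bij_betw_nat_finite[OF fL] cL by (auto simp: atLeast0LessThan)
  have vi: "inj_on v {..<?t}" and vim: "v ` {..<?t} = ?L" using v by (auto simp: bij_betw_def)
  have vp: "v j \<in> pool V c Gd I" if "j < ?t" for j using vim that by blast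
  have LV: "?L \<subseteq> V - X" using stD(2)[OF s] by (auto simp: pool_def)
  have Yp: "?L \<inter> Y = {}" by (rule stD(7)[OF s])
  \<comment> \<open>Positions 0, 1 and \<open>k\<close>, \<open>k + 1\<close> hold the new joints
    next to \<open>uu 0\<close>, \<open>uu 1\<close>, \<open>uu 2\<close>, \<open>uu 3\<close>. At
    the other positions the adjacency is not wanted, and class 0 is an arbitrary choice.\<close>
  define cl :: "nat \<Rightarrow> nat" where "cl j = (if j = 1 then 1 else if j = k then 2 else if j = k + 1 then 3 else 0)" for j
  have cl4: "cl j < 4" for j by (simp add: cl_def)
  define Q where "Q j b' \<longleftrightarrow> b' \<in> nbs E V (insert (uu (cl j)) (Kf (cl j)))" for j b'
  obtain A where A: "disjoint_family_on A {..<?t}" "\<forall>j<?t. A j \<subseteq> \<Union>(I ` Pr) \<and> m \<le> card (A j)"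
    and Af: "\<forall>a. (\<forall>j<?t. a j \<in> A j) \<longrightarrow> (\<exists>f. inj_on f {..<?t} \<and> (\<forall>j<?t. f j \<in> Mu \<and> a j \<in> f j - X \<and> Q j (a j) \<and>
        insert (v j) (f j - {a j}) \<in> E))"
  proof (rule reserve_choice[OF s, of ?t "card (Mr - Mu)" "\<lambda>j. F' (cl j) (v j)" Q v])
    fix j assume j: "j < ?t"
    then have "v j \<in> V - X - Y" using vim LV Yp by blast
    then show "card (Mr - Mu) + ?t * m \<le> card {f\<in>Mr. f \<in> F' (cl j) (v j)}"
      using res4[OF cl4] U by (meson le_trans)
    show "\<exists>b\<in>f - X. Q j b \<and> insert (v j) (f - {b}) \<in> E" if "f \<in> F' (cl j) (v j)" for f
      using swap4[OF cl4 that] by (simp add: Q_def)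
  qed (rule order_refl)
  have IPV: "\<Union>(I ` Pr) \<subseteq> V - X - pool V c Gd I"
    using arrD(5)[OF a] stD(2)[OF s] stD(5)[OF s] by (auto simp: pool_def)
  have AV: "A j \<subseteq> V" "real m \<le> real (card (A j))" if "j < ?t" for j using A(2) that IPV by auto
  have A1: "disjoint_family_on A {..<k}" and A2: "disjoint_family_on (\<lambda>j. A (k + j)) {..<k}"
    using A(1) by (auto simp: disjoint_family_on_def)
  have AV1: "\<And>j. j < k \<Longrightarrow> A j \<subseteq> V" "\<And>j. j < k \<Longrightarrow> real m \<le> real (card (A j))"
    and AV2: "\<And>j. j < k \<Longrightarrow> A (k + j) \<subseteq> V" "\<And>j. j < k \<Longrightarrow> real m \<le> real (card (A (k + j)))"
    using AV by simp_all
  obtain a1 where a1: "\<And>j. j < k \<Longrightarrow> a1 j \<in> A j" "a1 ` {..<k} \<in> E"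
    using has_transversalsD[OF tr A1 AV1] by blast
  obtain a2 where a2: "\<And>j. j < k \<Longrightarrow> a2 j \<in> A (k + j)" "a2 ` {..<k} \<in> E"
    using has_transversalsD[OF tr A2 AV2] by blast
  define a' where "a' j = (if j < k then a1 j else a2 (j - k))" for j
  have aA: "a' j \<in> A j" if "j < ?t" for j using a1(1)[of j] a2(1)[of "j - k"] that by (auto simp: a'_def)
  obtain f where f: "inj_on f {..<?t}" "\<And>j. j < ?t \<Longrightarrow> f j \<in> Mu \<and> a' j \<in> f j - X \<and> insert (v j) (f j - {a' j}) \<in> E"
    and Qa: "\<And>j. j < ?t \<Longrightarrow> Q j (a' j)"
    using Af[rule_format, of a'] aA by blast
  obtain I1 where I1: "arr k V E c Gd I1" "pool V c Gd I1 = (pool V c Gd I - v ` {..<?t}) \<union> a' ` {..<?t}"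
    using swap_reserves[OF s f vi vp] by metis
  have KKp: "KK \<subseteq> pool V c Gd I" by (rule stD(6)[OF s])
  have p1: "pool V c Gd I1 = KK \<union> a' ` {..<?t}" unfolding I1(2) vim using KKp by blast
  have aI: "a' ` {..<?t} \<subseteq> \<Union>(I ` Pr)" using aA A(2) by blast
  have aK: "a' ` {..<?t} \<inter> KK = {}" using aI IPV KKp by blast
  have aX: "a' j \<notin> X" if "j < ?t" for j using f(2)[OF that] by simp
  have ai: "inj_on a' {..<?t}"
    using aA A(1) by (auto simp: inj_on_def disjoint_family_on_def) (metis IntI empty_iff lessThan_iff)
  have aeq: "a' i = a' j \<longleftrightarrow> i = j" if "i < ?t" "j < ?t" for i j using ai that by (auto simp: inj_on_def)
  have KfK: "Kf i \<subseteq> KK" if "i < 4" for i using KK(1) that by auto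
  have Kd: "Kf i \<inter> Kf j = {}" if "i < 4" "j < 4" "i \<noteq> j" for i j using KK(2) that by (auto simp: disjoint_family_on_def)
  have a12: "a' ` {..<k} = a1 ` {..<k}" "(\<lambda>j. a' (k + j)) ` {..<k} = a2 ` {..<k}" by (auto simp: a'_def)
  have edge: "{uu i, a' j} \<union> Kf i \<in> E" if "j < ?t" "i = cl j" for i j
  proof -
    have "insert (a' j) (insert (uu i) (Kf i)) \<in> E" using Qa[OF that(1)] that(2) by (simp add: Q_def nbs_def)
    then show ?thesis by (simp add: insert_commute)
  qed
  have clv: "cl 0 = 0" "cl 1 = 1" "cl k = 2" "cl (k + 1) = 3" using k3 by (auto simp: cl_def)
  have lc: "length c = card X" using stD(2)[OF s] arrD(1)[OF a] distinct_card by metis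
  let ?e1 = "{uu 0, uu 1}" and ?e2 = "{uu 2, uu 3}"
  have e12: "?e1 \<in> cedges c" "?e2 \<in> cedges c" "?e1 \<notin> Gd" "?e2 \<notin> Gd" using stD(3,4)[OF s] Sg by auto
  let ?N1 = "{{uu 0, a' 0}, {a' 0, a' 1}, {a' 1, uu 1}}"
  have "\<exists>d I'. arr k V E d (Gd \<union> ?N1) I' \<and> length d = length c + 2 \<and>
     cedges d = (cedges c - {?e1}) \<union> ?N1 \<and>
     pool V d (Gd \<union> ?N1) I' = pool V c Gd I1 - Kf 0 - Kf 1 - a' ` {..<k}"
  proof (rule arr_close[OF I1(1) k3 e12(1,3)])
    show "3 \<le> length c" using lc X3 by simp
    show "Kf 0 \<subseteq> pool V c Gd I1" "Kf 1 \<subseteq> pool V c Gd I1" using KfK[of 0] KfK[of 1] p1 by auto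
    show "card (Kf 0) = k - 2" "card (Kf 1) = k - 2" "Kf 0 \<inter> Kf 1 = {}" using KK(3) Kd by auto
    show "inj_on a' {..<k}" using inj_on_subset[OF ai] by auto
    show "a' ` {..<k} \<subseteq> pool V c Gd I1" unfolding p1 by auto
    have "a' ` {..<k} \<subseteq> a' ` {..<?t}" by auto
    then show "a' ` {..<k} \<inter> (Kf 0 \<union> Kf 1) = {}" using aK KfK[of 0] KfK[of 1] by auto
    show "{uu 0, a' 0} \<union> Kf 0 \<in> E" "{uu 1, a' 1} \<union> Kf 1 \<in> E"  using edge[of 0 0] edge[of 1 1] clv k3 by simp_all
    show "a' ` {..<k} \<in> E" using a1(2) a12 by simp
  qed
  then obtain d I2 where d: "arr k V E d (Gd \<union> ?N1) I2" "length d = length c + 2"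
    "cedges d = (cedges c - {?e1}) \<union> ?N1" "pool V d (Gd \<union> ?N1) I2 = pool V c Gd I1 - Kf 0 - Kf 1 - a' ` {..<k}" by blast
  have uX: "uu 2 \<in> X" "uu 3 \<in> X" using cedges_subset[OF arrD(2)[OF a] e12(2)] stD(2)[OF s] by auto
  have a01: "a' 0 \<notin> X" "a' 1 \<notin> X" using aX k3 by auto
  have e2N: "?e2 \<notin> ?N1" using uX a01 by (auto simp: doubleton_eq_iff)
  let ?b = "\<lambda>j. a' (k + j)"
  let ?N2 = "{{uu 2, ?b 0}, {?b 0, ?b 1}, {?b 1, uu 3}}"
  have "\<exists>d' I'. arr k V E d' (Gd \<union> ?N1 \<union> ?N2) I' \<and> length d' = length d + 2 \<and>
     cedges d' = (cedges d - {?e2}) \<union> ?N2 \<and>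
     pool V d' (Gd \<union> ?N1 \<union> ?N2) I' = pool V d (Gd \<union> ?N1) I2 - Kf 2 - Kf 3 - ?b ` {..<k}"
  proof (rule arr_close[OF d(1) k3])
    show "?e2 \<in> cedges d" using d(3) e12(2) Sg(2) by auto
    show "?e2 \<notin> Gd \<union> ?N1" using e12(4) e2N by auto
    show "3 \<le> length d" using d(2) lc X3 by simp
    have aa: "a' ` {..<k} \<subseteq> a' ` {..<?t}" "?b ` {..<k} \<subseteq> a' ` {..<?t}" by auto
    have K23: "Kf 2 \<subseteq> KK" "Kf 3 \<subseteq> KK" using KfK by auto
    show "Kf 2 \<subseteq> pool V d (Gd \<union> ?N1) I2" "Kf 3 \<subseteq> pool V d (Gd \<union> ?N1) I2"
    proof -
      have "Kf 2 \<inter> Kf 0 = {}" "Kf 2 \<inter> Kf 1 = {}" "Kf 3 \<inter> Kf 0 = {}" "Kf 3 \<inter> Kf 1 = {}"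
        by (intro Kd; simp)+
      moreover have "a' ` {..<k} \<inter> KK = {}" using aK aa(1) by blast
      ultimately show "Kf 2 \<subseteq> pool V d (Gd \<union> ?N1) I2" "Kf 3 \<subseteq> pool V d (Gd \<union> ?N1) I2"
        unfolding d(4) p1 using K23 by blast+
    qed
    show "card (Kf 2) = k - 2" "card (Kf 3) = k - 2" "Kf 2 \<inter> Kf 3 = {}" using KK(3) Kd by auto
    show "inj_on ?b {..<k}"
    proof (rule inj_onI)
      fix i j assume "i \<in> {..<k}" "j \<in> {..<k}" "?b i = ?b j"
      then show "i = j" using aeq[of "k + i" "k + j"] by simp
    qed
    have "?b i \<noteq> a' j" if "i < k" "j < k" for i j using aeq[of "k + i" j] that by simp
    then have bd: "?b ` {..<k} \<inter> a' ` {..<k} = {}" by blast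
    have bK: "?b ` {..<k} \<inter> KK = {}" using aa(2) aK by blast
    then have "?b ` {..<k} \<inter> Kf 0 = {}" "?b ` {..<k} \<inter> Kf 1 = {}" using KfK[of 0] KfK[of 1] by auto
    then show "?b ` {..<k} \<subseteq> pool V d (Gd \<union> ?N1) I2"
      unfolding d(4) p1 using aa(2) bd by blast
    have "?b ` {..<k} \<inter> (Kf 2 \<union> Kf 3) \<subseteq> ?b ` {..<k} \<inter> KK" using K23 by (intro Int_mono) simp_all
    then show "?b ` {..<k} \<inter> (Kf 2 \<union> Kf 3) = {}" using bK by simp
    have "k < ?t" "k + 1 < ?t" using k3 by linarith+
    then show "{uu 2, ?b 0} \<union> Kf 2 \<in> E" "{uu 3, ?b 1} \<union> Kf 3 \<in> E"
      using edge[OF _ clv(3)[symmetric]] edge[OF _ clv(4)[symmetric]] by (simp_all only: add_0_right)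
    show "?b ` {..<k} \<in> E" using a2(2) a12 by simp
  qed
  then obtain d' I3 where d': "arr k V E d' (Gd \<union> ?N1 \<union> ?N2) I3" "length d' = length d + 2"
    "cedges d' = (cedges d - {?e2}) \<union> ?N2" by blast
  show ?thesis
  proof (rule loose_cycle_of_arr[OF d'(1) _ k _ _ V n(1)])
    show "3 \<le> n" using n(2) X3 by simp
    show "length d' = n" using d'(2) d(2) lc n(2) by simp
    have "cedges c \<subseteq> Gd \<union> Sg" using b unfolding bad_def by blast
    then have sub: "cedges c - {?e1} - {?e2} \<subseteq> Gd" unfolding Sg(1) by blast
    have gen: "(A - E1) \<union> N1 - E2 \<union> N2 \<subseteq> G \<union> N1 \<union> N2" if "A - E1 - E2 \<subseteq> G" for A E1 E2 N1 N2 G :: "'a set set"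
      using that by blast
    show "cedges d' \<subseteq> Gd \<union> ?N1 \<union> ?N2" unfolding d'(3) d(3) by (rule gen[OF sub])
  qed
qed

end

section \<open>Choosing the joints\<close>

text \<open>An exponential moment bound. For uniformly random \<phi> the expectation of
  \<open>(1 / 2) ^ hits\<close> is a product over the independent coordinates, where a coordinate in
  \<open>I\<close> contributes at most \<open>1 - 1 / (2 * r)\<close>; fewer than \<open>s\<close>
  hits make the variable at least \<open>(1 / 2) ^ s\<close>.\<close>

lemma few_bad_choices:
  fixes T :: "nat \<Rightarrow> nat set"
  assumes r: "r \<ge> 1" and I: "I \<subseteq> {..<n}" and T: "\<And>i. i \<in> I \<Longrightarrow> T i \<inter> {..<r} \<noteq> {}"
  shows "real (card {\<phi> \<in> {..<n} \<rightarrow>\<^sub>E {..<r}. card {i\<in>I. \<phi> i \<in> T i} < s})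
     \<le> 2 ^ s * (real r ^ n * (1 - 1 / (2 * real r)) ^ card I)"
proof -
  let ?\<Phi> = "{..<n} \<rightarrow>\<^sub>E {..<r}"
  let ?B = "{\<phi> \<in> ?\<Phi>. card {i\<in>I. \<phi> i \<in> T i} < s}"
  define w where "w i x = (if i \<in> I \<and> x \<in> T i then 1 / 2 else 1 :: real)" for i x
  have f\<Phi>: "finite ?\<Phi>" by (intro finite_PiE) auto
  have prodw: "(\<Prod>i<n. w i (\<phi> i)) = (1 / 2) ^ card {i\<in>I. \<phi> i \<in> T i}" for \<phi> :: "nat \<Rightarrow> nat"
  proof -
    have "{i \<in> {..<n}. i \<in> I \<and> \<phi> i \<in> T i} = {i\<in>I. \<phi> i \<in> T i}" using I by auto
    then show ?thesis unfolding w_def by (simp add: prod.If_cases Int_def)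
  qed
  have sumw: "(\<Sum>x<r. w i x) \<le> real r * (if i \<in> I then 1 - 1 / (2 * real r) else 1)" if "i < n" for i
  proof (cases "i \<in> I")
    case False
    then show ?thesis by (simp add: w_def)
  next
    case True
    then obtain x where x: "x \<in> T i" "x < r" using T by auto
    have "(\<Sum>x'<r. w i x') = w i x + (\<Sum>x'\<in>{..<r} - {x}. w i x')" using x by (simp add: sum.remove)
    also have "\<dots> \<le> 1 / 2 + (\<Sum>x'\<in>{..<r} - {x}. 1)"
      using x True by (intro add_mono sum_mono) (auto simp: w_def)
    also have "\<dots> = real r - 1 / 2" using x by (simp add: of_nat_diff)
    also have "\<dots> = real r * (1 - 1 / (2 * real r))" using r by (simp add: field_simps)
    finally show ?thesis using True by simp
  qed
  have w0: "0 \<le> w i x" for i x by (simp add: w_def)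
  have "real (card ?B) * (1 / 2) ^ s = (\<Sum>\<phi>\<in>?B. (1 / 2) ^ s)" by simp
  also have "\<dots> \<le> (\<Sum>\<phi>\<in>?B. \<Prod>i<n. w i (\<phi> i))"
    unfolding prodw by (intro sum_mono power_decreasing) auto
  also have "\<dots> \<le> (\<Sum>\<phi>\<in>?\<Phi>. \<Prod>i<n. w i (\<phi> i))"
    using f\<Phi> w0 by (intro sum_mono2) (auto intro: prod_nonneg)
  also have "\<dots> = (\<Prod>i<n. \<Sum>x<r. w i x)" by (rule prod_sum_PiE[symmetric]) auto
  also have "\<dots> \<le> (\<Prod>i<n. real r * (if i \<in> I then 1 - 1 / (2 * real r) else 1))"
    using sumw w0 by (intro prod_mono) (auto intro: sum_nonneg)
  also have "\<dots> = real r ^ n * (1 - 1 / (2 * real r)) ^ card I"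
  proof -
    have "{..<n} \<inter> I = I" using I by auto
    then show ?thesis by (simp add: prod.distrib prod.If_cases)
  qed
  finally have "real (card ?B) * (1 / 2) ^ s \<le> real r ^ n * (1 - 1 / (2 * real r)) ^ card I" .
  then have "2 ^ s * (real (card ?B) * (1 / 2) ^ s) \<le> 2 ^ s * (real r ^ n * (1 - 1 / (2 * real r)) ^ card I)"
    by (intro mult_left_mono) auto
  moreover have "2 ^ s * (real (card ?B) * (1 / 2) ^ s) = real (card ?B)"
    by (simp add: power_divide)
  ultimately show ?thesis by simp
qed

text \<open>\<open>X\<close> consists of one random element of each of \<open>n\<close> consecutive blocks of length \<open>r\<close>.\<close>

lemma exists_joints:
  assumes r: "r \<ge> 2" and \<A>: "finite \<A>" "\<And>A. A \<in> \<A> \<Longrightarrow> A \<subseteq> {1..r * n} \<and> r * h \<le> card A"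
    and small: "2 * real (card \<A>) * (2 ^ s * (1 - 1 / (2 * real r)) ^ h) < 1"
  shows "\<exists>X\<subseteq>{1..r * n}. card X = n \<and> (\<forall>A\<in>\<A>. s \<le> card (A \<inter> X) \<and> s \<le> card (A - X))"
proof -
  let ?\<Phi> = "{..<n} \<rightarrow>\<^sub>E {..<r}" and ?q = "1 - 1 / (2 * real r)"
  define e where "e i x = r * i + x + 1" for i x :: nat
  have e_inj: "e i x = e j y \<longleftrightarrow> i = j \<and> x = y" if "x < r" "y < r" for i j x y
  proof
    assume "e i x = e j y"
    then have eq: "r * i + x = r * j + y" by (simp add: e_def)
    have "(r * i + x) div r = i" "(r * j + y) div r = j" using that by simp_all
    then show "i = j \<and> x = y" using eq by simp
  qed simp
  have e_in: "e i x \<in> {1..r * n}" if "i < n" "x < r" for i x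
  proof -
    have "r * i + x + 1 \<le> r * Suc i" using that by simp
    also have "\<dots> \<le> r * n" using that by (intro mult_le_mono2) simp
    finally show ?thesis by (simp add: e_def)
  qed
  have e_ex: "\<exists>i x. i < n \<and> x < r \<and> z = e i x" if "z \<in> {1..r * n}" for z
  proof -
    have z: "z - 1 < r * n" using that by auto
    then have "(z - 1) div r < n" "(z - 1) mod r < r" using r by (simp_all add: less_mult_imp_div_less mult.commute)
    moreover have "z = e ((z - 1) div r) ((z - 1) mod r)" using that by (simp add: e_def)
    ultimately show ?thesis by blast
  qed
  have f\<Phi>: "finite ?\<Phi>" by (intro finite_PiE) auto
  have c\<Phi>: "real (card ?\<Phi>) = real r ^ n" by (simp add: card_PiE)
  have r1: "r \<ge> 1" using r by simp
  have q: "0 \<le> ?q" "?q \<le> 1" using r by (simp_all add: field_simps)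
  define I where "I A = {i. i < n \<and> (\<exists>x<r. e i x \<in> A)}" for A
  define T1 where "T1 A i = {x. e i x \<in> A}" for A i
  \<comment> \<open>A hit of \<open>T2\<close> provides an element of \<open>A\<close> in the block
    other than the chosen one, hence outside \<open>X\<close>. As \<open>r \<ge> 2\<close>, some
    choice is a hit even if \<open>A\<close> has only one element in the block.\<close>
  define T2 where "T2 A i = {x. \<exists>y<r. y \<noteq> x \<and> e i y \<in> A}" for A i
  define B1 where "B1 A = {\<phi> \<in> ?\<Phi>. card {i\<in>I A. \<phi> i \<in> T1 A i} < s}" for A
  define B2 where "B2 A = {\<phi> \<in> ?\<Phi>. card {i\<in>I A. \<phi> i \<in> T2 A i} < s}" for A
  have Isub: "I A \<subseteq> {..<n}" for A by (auto simp: I_def)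
  have fI: "finite (I A)" for A using Isub finite_subset by blast
  have hI: "h \<le> card (I A)" if A: "A \<in> \<A>" for A
  proof -
    have "A \<subseteq> (\<lambda>(i, x). e i x) ` (I A \<times> {..<r})"
    proof
      fix z assume z: "z \<in> A"
      then obtain i x where ix: "i < n" "x < r" "z = e i x" using \<A>(2)[OF A] e_ex by blast
      then have "(i, x) \<in> I A \<times> {..<r}" using z by (auto simp: I_def)
      then show "z \<in> (\<lambda>(i, x). e i x) ` (I A \<times> {..<r})" using ix(3) by force
    qed
    moreover have "finite (I A \<times> {..<r})" using fI by simp
    ultimately have "card A \<le> card (I A \<times> {..<r})" by (rule surj_card_le[rotated])
    also have "\<dots> = r * card (I A)" by (simp add: card_cartesian_product)
    finally have "r * h \<le> r * card (I A)" using \<A>(2)[OF A] by linarith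
    then show ?thesis using r by simp
  qed
  have T1: "T1 A i \<inter> {..<r} \<noteq> {}" if "i \<in> I A" for A i using that by (auto simp: I_def T1_def)
  have T2: "T2 A i \<inter> {..<r} \<noteq> {}" if iA: "i \<in> I A" for A i
  proof -
    obtain y where y: "y < r" "e i y \<in> A" using iA by (auto simp: I_def)
    define x :: nat where "x = (if y = 0 then 1 else 0)"
    have "x < r" "x \<noteq> y" using r y by (auto simp: x_def)
    then show ?thesis using y by (auto simp: T2_def)
  qed
  let ?c = "2 ^ s * (real r ^ n * ?q ^ h)"
  have B: "real (card (B1 A)) \<le> ?c" "real (card (B2 A)) \<le> ?c" if "A \<in> \<A>" for A
  proof -
    have "2 ^ s * (real r ^ n * ?q ^ card (I A)) \<le> ?c"
      using hI[OF that] q by (intro mult_left_mono power_decreasing) auto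
    then show "real (card (B1 A)) \<le> ?c" "real (card (B2 A)) \<le> ?c"
      using few_bad_choices[OF r1 Isub[of A] T1] few_bad_choices[OF r1 Isub[of A] T2] unfolding B1_def B2_def
      by (meson order_trans)+
  qed
  have fB: "finite (B1 A \<union> B2 A)" for A using f\<Phi> by (auto simp: B1_def B2_def)
  have le: "card (\<Union>A\<in>\<A>. B1 A \<union> B2 A) \<le> (\<Sum>A\<in>\<A>. card (B1 A \<union> B2 A))" by (rule card_UN_le[OF \<A>(1)])
  have "real (card (\<Union>A\<in>\<A>. B1 A \<union> B2 A)) \<le> (\<Sum>A\<in>\<A>. real (card (B1 A \<union> B2 A)))"
    using of_nat_mono[OF le, where 'a = real] unfolding of_nat_sum .
  also have "\<dots> \<le> (\<Sum>A\<in>\<A>. 2 * ?c)"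
  proof (rule sum_mono)
    fix A assume "A \<in> \<A>"
    then show "real (card (B1 A \<union> B2 A)) \<le> 2 * ?c"
      using B[of A] of_nat_mono[OF card_Un_le[of "B1 A" "B2 A"], where 'a = real] by simp
  qed
  also have "\<dots> = 2 * real (card \<A>) * (2 ^ s * ?q ^ h) * real r ^ n" by simp
  also have "\<dots> < 1 * real r ^ n" using small r by (intro mult_strict_right_mono) auto
  finally have "card (\<Union>A\<in>\<A>. B1 A \<union> B2 A) < card ?\<Phi>" using c\<Phi> by linarith
  then have "\<not> ?\<Phi> \<subseteq> (\<Union>A\<in>\<A>. B1 A \<union> B2 A)"
    using card_mono[of "\<Union>A\<in>\<A>. B1 A \<union> B2 A" ?\<Phi>] \<A>(1) fB by auto
  then obtain \<phi> where \<phi>: "\<phi> \<in> ?\<Phi>" "\<And>A. A \<in> \<A> \<Longrightarrow> \<phi> \<notin> B1 A \<and> \<phi> \<notin> B2 A" by blast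
  have \<phi>r: "\<phi> i < r" if "i < n" for i using \<phi>(1) that by (auto simp: PiE_def Pi_def)
  define X where "X = (\<lambda>i. e i (\<phi> i)) ` {..<n}"
  have injX: "inj_on (\<lambda>i. e i (\<phi> i)) {..<n}" using e_inj \<phi>r by (auto simp: inj_on_def)
  have "s \<le> card (A \<inter> X) \<and> s \<le> card (A - X)" if A: "A \<in> \<A>" for A
  proof
    have fA: "finite A" using \<A>(2)[OF A] finite_subset by blast
    have 1: "s \<le> card {i\<in>I A. \<phi> i \<in> T1 A i}" "s \<le> card {i\<in>I A. \<phi> i \<in> T2 A i}"
      using \<phi>(2)[OF A] \<phi>(1) by (auto simp: B1_def B2_def)
    have "inj_on (\<lambda>i. e i (\<phi> i)) {i\<in>I A. \<phi> i \<in> T1 A i}"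
      by (rule inj_on_subset[OF injX]) (auto simp: I_def)
    moreover have "(\<lambda>i. e i (\<phi> i)) ` {i\<in>I A. \<phi> i \<in> T1 A i} \<subseteq> A \<inter> X" by (auto simp: T1_def X_def I_def)
    ultimately have "card {i\<in>I A. \<phi> i \<in> T1 A i} \<le> card (A \<inter> X)" using fA by (intro card_inj_on_le) auto
    then show "s \<le> card (A \<inter> X)" using 1 by simp
    have "\<exists>y. y < r \<and> y \<noteq> \<phi> i \<and> e i y \<in> A" if "\<phi> i \<in> T2 A i" for i using that by (auto simp: T2_def)
    then obtain y where y: "\<And>i. \<phi> i \<in> T2 A i \<Longrightarrow> y i < r \<and> y i \<noteq> \<phi> i \<and> e i (y i) \<in> A" by metis
    have "inj_on (\<lambda>i. e i (y i)) {i\<in>I A. \<phi> i \<in> T2 A i}" using y e_inj by (auto simp: inj_on_def)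
    moreover have "e i (y i) \<notin> X" if "i \<in> I A" "\<phi> i \<in> T2 A i" for i
      using y[OF that(2)] e_inj \<phi>r by (auto simp: X_def)
    then have "(\<lambda>i. e i (y i)) ` {i\<in>I A. \<phi> i \<in> T2 A i} \<subseteq> A - X" using y by auto
    ultimately have "card {i\<in>I A. \<phi> i \<in> T2 A i} \<le> card (A - X)" using fA by (intro card_inj_on_le) auto
    then show "s \<le> card (A - X)" using 1 by simp
  qed
  moreover have "X \<subseteq> {1..r * n}" using e_in \<phi>r by (auto simp: X_def)
  moreover have "card X = n" using injX by (simp add: X_def card_image)
  ultimately show ?thesis by blast
qed

section \<open>Loose Hamilton cycles\<close>

lemma card_tl_Int:
  assumes xs: "length xs = k" "distinct xs" and k: "3 \<le> k"
    and X: "\<And>j. 0 < j \<Longrightarrow> j < k \<Longrightarrow> xs ! j \<in> X \<longleftrightarrow> j = 1 \<or> j = k - 1"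
  shows "card (set (tl xs) \<inter> X) = 2"
proof -
  have tl: "set (tl xs) = (!) xs ` {1..<k}"
  proof -
    have "set (tl xs) = (!) (tl xs) ` {..<k - 1}" using xs(1) by (auto simp: set_conv_nth)
    also have "\<dots> = (\<lambda>j. xs ! Suc j) ` {..<k - 1}" using xs(1) by (intro image_cong) (auto simp: nth_tl)
    also have "\<dots> = (!) xs ` Suc ` {..<k - 1}" by (simp add: image_image)
    also have "Suc ` {..<k - 1} = {1..<k}"
      using k unfolding image_Suc_lessThan by auto
    finally show ?thesis .
  qed
  have "set (tl xs) \<inter> X = {xs ! 1, xs ! (k - 1)}"
  proof
    show "set (tl xs) \<inter> X \<subseteq> {xs ! 1, xs ! (k - 1)}" unfolding tl using X by fastforce
    have "1 \<in> {1..<k}" "k - 1 \<in> {1..<k}" using k by auto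
    then show "{xs ! 1, xs ! (k - 1)} \<subseteq> set (tl xs) \<inter> X" unfolding tl using X[of 1] X[of "k - 1"] k by auto
  qed
  moreover have "xs ! 1 \<noteq> xs ! (k - 1)" using nth_eq_iff_index_eq[OF xs(2), of 1 "k - 1"] xs(1) k by auto
  ultimately show ?thesis by simp
qed

text \<open>Two joints, at positions 1 and \<open>k - 1\<close>, make a reserve edge fit between
  neighbouring joints, before and after its head is replaced by an interior vertex. The last
  position has to be a joint because the codegree hypothesis supplies neighbours in \<open>X\<close>
  there. The head is interior and lies in \<open>B\<close>, the neighbourhood of a gadget's
  \<open>(k - 1)\<close>-set.\<close>

definition pos_domain :: "nat \<Rightarrow> 'a set \<Rightarrow> 'a set \<Rightarrow> 'a set \<Rightarrow> nat \<Rightarrow> 'a set" where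
  "pos_domain k V X B j = (if j = 0 then B - X else if j = 1 \<or> j = k - 1 then X else V - X)"

lemma pos_domain_tl:
  assumes "length xs = k" "distinct xs" "3 \<le> k" "\<forall>j<k. xs ! j \<in> pos_domain k V X B j"
  shows "card (set (tl xs) \<inter> X) = 2"
proof (rule card_tl_Int[OF assms(1-3)])
  fix j assume "0 < j" "j < k"
  then show "xs ! j \<in> X \<longleftrightarrow> j = 1 \<or> j = k - 1"
    using assms(4) by (auto simp: pos_domain_def split: if_splits dest!: spec[of _ j])
qed

lemma swap_family_joints:
  assumes "f \<in> swap_family k H (pos_domain k V X B) v" "3 \<le> k"
  shows "card (f \<inter> X) = 2"
proof -
  obtain xs where xs: "f = set xs" "length xs = k" "distinct xs" "\<forall>j<k. xs ! j \<in> pos_domain k V X B j"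
    using assms(1) unfolding swap_family_def by blast
  have "xs \<noteq> []" using xs(2) assms(2) by auto
  then have "set xs = insert (xs ! 0) (set (tl xs))" by (cases xs) auto
  moreover have "xs ! 0 \<notin> X" using xs(4) assms(2) by (auto simp: pos_domain_def dest!: spec[of _ 0])
  ultimately have "f \<inter> X = set (tl xs) \<inter> X" using xs(1) by auto
  then show ?thesis using pos_domain_tl[OF xs(2,3) assms(2) xs(4)] by simp
qed

lemma arr_of_matching:
  fixes V :: "'a set"
  assumes V: "finite V" and X: "X \<subseteq> V" "X \<noteq> {}" and k: "2 \<le> k"
    and M: "finite M" "disjoint M" "\<And>f. f \<in> M \<Longrightarrow> f \<subseteq> V \<and> card f = k \<and> card (f \<inter> X) = 2 \<and> f \<in> E"
    and Sg: "finite Sg" "disjoint Sg" "\<And>h. h \<in> Sg \<Longrightarrow> h \<subseteq> X \<and> card h = 2 \<and> h \<inter> \<Union>M = {}"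
  shows "\<exists>c I. arr k V E c ((\<lambda>f. f \<inter> X) ` M) I \<and> set c = X \<and> Sg \<subseteq> cedges c \<and> (\<forall>f\<in>M. I (f \<inter> X) = f - X)"
proof -
  let ?G = "(\<lambda>f. f \<inter> X) ` M"
  have Mne: "f \<inter> X \<noteq> {}" if "f \<in> M" for f using M(3)[OF that] by auto
  have Mdis: "f \<inter> h = {}" if "f \<in> M" "h \<in> M" "f \<noteq> h" for f h
    using M(2) that by (auto simp: disjoint_def pairwise_def disjnt_def)
  have "disjoint (?G \<union> Sg)"
  proof (rule disjoint_union)
    show "disjoint ?G"
    proof (rule disjointI)
      fix a b assume "a \<in> ?G" "b \<in> ?G" "a \<noteq> b"
      then obtain f h where "f \<in> M" "h \<in> M" "a = f \<inter> X" "b = h \<inter> X" "f \<noteq> h" by blast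
      then show "a \<inter> b = {}" using Mdis[of f h] by blast
    qed
    show "\<Union>?G \<inter> \<Union>Sg = {}" using Sg(3) by blast
  qed (rule Sg(2))
  moreover have "finite (?G \<union> Sg)" using M(1) Sg(1) by simp
  moreover have "g \<subseteq> X \<and> card g = 2" if g: "g \<in> ?G \<union> Sg" for g
  proof (cases "g \<in> Sg")
    case True
    then show ?thesis using Sg(3) by simp
  next
    case False
    then obtain f where "f \<in> M" "g = f \<inter> X" using g by blast
    then show ?thesis using M(3)[of f] by simp
  qed
  moreover have "finite X" using X V finite_subset by blast
  ultimately obtain c where c: "distinct c" "set c = X" "?G \<union> Sg \<subseteq> pedges c"
    using ordering_with_pairs[of "?G \<union> Sg" X] by blast
  \<comment> \<open>For \<open>g = f \<inter> X\<close> the union has the single member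
    \<open>f\<close>, because distinct edges of \<open>M\<close> are disjoint and \<open>f\<close>
    meets \<open>X\<close>.\<close>
  define I where "I g = \<Union>{f\<in>M. g \<subseteq> f} - X" for g
  have IM: "I (f \<inter> X) = f - X" if f: "f \<in> M" for f
  proof -
    have "h = f" if "h \<in> M" "f \<inter> X \<subseteq> h" for h using Mdis[OF that(1) f] Mne[OF f] that by blast
    then have "{h\<in>M. f \<inter> X \<subseteq> h} = {f}" using f by blast
    then show ?thesis by (simp add: I_def)
  qed
  have "arr k V E c ?G I"
    unfolding arr_def
  proof (intro conjI ballI impI)
    show "c \<noteq> []" using c(2) X by auto
    show "?G \<subseteq> cedges c" using c(3) by (auto simp: cedges_def)
    fix g assume "g \<in> ?G"
    then obtain f where f: "f \<in> M" "g = f \<inter> X" by blast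
    have Ig: "I g = f - X" using IM f by simp
    show "I g \<subseteq> V - set c" using Ig M(3)[OF f(1)] c(2) by auto
    have "finite f" using M(3)[OF f(1)] V finite_subset by blast
    then show "card (I g) = k - 2" using Ig M(3)[OF f(1)] by (simp add: card_Diff_subset_Int)
    have "g \<union> I g = f" using Ig f by blast
    then show "g \<union> I g \<in> E" using M(3)[OF f(1)] by simp
    fix h assume h: "h \<in> ?G" "g \<noteq> h"
    then obtain f' where f': "f' \<in> M" "h = f' \<inter> X" by blast
    then have "f \<noteq> f'" using f h by auto
    then show "I g \<inter> I h = {}" using Mdis[OF f(1) f'(1)] Ig IM[OF f'(1)] f' by auto
  qed (use c X in auto)
  moreover have "Sg \<subseteq> cedges c" using c(3) by (auto simp: cedges_def)
  ultimately show ?thesis using c(2) IM by blast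
qed

section \<open>Hamilton cycles in hypergraphs whose random part hits all required families\<close>

lemma nbs_mono: "H \<subseteq> E \<Longrightarrow> nbs H V S \<subseteq> nbs E V S"
  by (auto simp: nbs_def)

text \<open>For \<open>k = 2\<close> every vertex is a joint, interiors are empty, and neither
  reserve nor gadgets are required: any cyclic ordering with all pairs bad is a valid start. With
  \<open>P0 = m + 2\<close> the condition \<open>room\<close> becomes
  \<open>8 * m + 13 \<le> A0\<close>.\<close>

lemma hamilton_of_hits_graph:
  fixes V :: "'a set"
  assumes V: "finite V" "3 \<le> card V"
    and codeg: "\<And>S. S \<subseteq> V \<Longrightarrow> card S = 1 \<Longrightarrow> A0 \<le> card (nbs H V S)"
    and tr: "has_transversals 2 (real m) V R" and A0: "8 * m + 13 \<le> A0"
  shows "has_loose_Hamilton_cycle 2 V (H \<union> R)"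
proof -
  let ?E = "H \<union> R"
  interpret P: perturbed 2 V ?E V "{}" "{}" "{}" "{}" "\<lambda>_. {}" m "m + 2" A0 0 0
  proof
    show "has_transversals 2 (real m) V ?E" using has_transversals_mono[OF tr, of ?E "real m"] by simp
    fix S assume S: "S \<subseteq> V" "card S = 2 - 1"
    have "card (nbs H V S) \<le> card (nbs ?E V S \<inter> V)"
      using V(1) nbs_mono[of H ?E V S] by (intro card_mono) (auto simp: nbs_def)
    then show "A0 \<le> card (nbs ?E V S \<inter> V)" using codeg[of S] S by simp
  qed (use V A0 in auto)
  obtain c where c: "set c = V" "distinct c" using finite_distinct_list[OF V(1)] by blast
  have "c \<noteq> []" using c(1) V(2) by force
  then have "P.st {} {} c {} (\<lambda>_. {})" using c by (simp add: P.st_def arr_def)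
  then obtain Mu Pr d Gd I where d: "P.st Mu Pr d Gd I" "P.bad d Gd = {}"
    using P.all_good[of "{}" c "{}" "\<lambda>_. {}"] by auto
  have a: "arr 2 V ?E d Gd I" using P.stD(1)[OF d(1)] .
  have "length d = card V" using P.stD(2)[OF d(1)] arrD(1)[OF a] distinct_card by metis
  moreover have "cedges d \<subseteq> Gd" using d(2) by (auto simp: P.bad_def)
  ultimately show ?thesis using loose_cycle_of_arr[OF a, of "card V"] V by simp
qed

text \<open>\<open>X\<close> has four joints fewer than the final cycle, two for each gadget. The
  reserve is required to serve every vertex for each of the four sets
  \<open>insert (uu i) (Kf i)\<close>, so the index set consists of pairs
  \<open>(i, v)\<close>.\<close>

lemma hamilton_of_hits:
  fixes V :: "'a set" and uu :: "nat \<Rightarrow> 'a" and Kf :: "nat \<Rightarrow> 'a set"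
  assumes k: "k \<ge> 3" and V: "finite V" "card V = (k - 1) * n" and H: "H \<subseteq> ksets k V" and R: "R \<subseteq> ksets k V"
    and X: "X \<subseteq> V" "card X + 4 = n"
    and codeg: "\<And>S. S \<subseteq> V \<Longrightarrow> card S = k - 1 \<Longrightarrow> A0 \<le> card (nbs H V S \<inter> X) \<and> A0 \<le> card (nbs H V S - X)"
    and uu: "inj_on uu {..<4}" "\<And>i. i < 4 \<Longrightarrow> uu i \<in> X"
    and Kf: "disjoint_family_on Kf {..<4}" "\<And>i. i < 4 \<Longrightarrow> Kf i \<subseteq> V - X \<and> card (Kf i) = k - 2"
    and tr: "has_transversals k (real m) V R"
    and sp: "spreads \<rho> w V ({..<4} \<times> (V - X))
       (\<lambda>(i, v). swap_family k H (pos_domain k V X (nbs H V (insert (uu i) (Kf i)))) v) R"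
    and pos: "\<rho> > 0" "b > 0" and g: "(k - 2) * (m + 2) + 2 * k * m \<le> g"
    and s: "real g * (4 * real (card V)) < \<rho> * real b * real s" "k * s + k * b + 4 * k \<le> w"
    and A0: "w + k + 2 \<le> A0" "2 * m + 6 * (s + b + m + 4) + 1 \<le> A0"
  shows "has_loose_Hamilton_cycle k V (H \<union> R)"
proof -
  let ?E = "H \<union> R"
  define S where "S i = insert (uu i) (Kf i)" for i
  define B where "B i = nbs H V (S i)" for i
  define D where "D i = pos_domain k V X (B i)" for i
  define F where "F i v = swap_family k H (D i) v" for i v
  define KK where "KK = (\<Union>i<4. Kf i)"
  define Z where "Z = KK \<union> uu ` {..<4}"
  have Rf: "f \<subseteq> V \<and> card f = k" if "f \<in> R" for f using that R by (auto simp: ksets_def)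
  have Hf: "f \<subseteq> V \<and> card f = k" if "f \<in> H" for f using that H by (auto simp: ksets_def)
  have KV: "KK \<subseteq> V - X" using Kf(2) unfolding KK_def by blast
  have fK: "finite (Kf i)" if "i < 4" for i using Kf(2)[OF that] V by (meson finite_Diff finite_subset)
  have cKK: "card KK = 4 * (k - 2)"
  proof -
    have "card KK = (\<Sum>i<4. card (Kf i))"
      unfolding KK_def by (rule card_UN_disjoint) (use fK Kf(1) in \<open>auto simp: disjoint_family_on_def\<close>)
    also have "\<dots> = (\<Sum>i<(4::nat). k - 2)" using Kf(2) by (intro sum.cong) auto
    finally show ?thesis by simp
  qed
  have ZV: "Z \<subseteq> V" using KV uu(2) X(1) by (auto simp: Z_def)
  have fZ: "finite Z" using ZV V finite_subset by blast
  have cZ: "card Z \<le> 4 * k"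
  proof -
    have "card Z \<le> card KK + card (uu ` {..<4})" unfolding Z_def by (rule card_Un_le)
    also have "card (uu ` {..<4}) \<le> 4" using card_image_le[of "{..<4::nat}" uu] by simp
    finally show ?thesis using cKK k by simp
  qed
  have S: "S i \<subseteq> V" "card (S i) = k - 1" if "i < 4" for i
  proof -
    have "uu i \<notin> Kf i" using uu(2)[OF that] Kf(2)[OF that] by auto
    then show "card (S i) = k - 1" using fK[OF that] Kf(2)[OF that] k by (simp add: S_def)
    show "S i \<subseteq> V" using uu(2)[OF that] Kf(2)[OF that] X(1) by (auto simp: S_def)
  qed
  have AX: "A0 \<le> card X" "A0 \<le> card (V - X)"
  proof -
    have "A0 \<le> card (nbs H V (S 0) \<inter> X)" "A0 \<le> card (nbs H V (S 0) - X)"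
      using codeg[OF S[of 0]] by auto
    moreover have "card (nbs H V (S 0) \<inter> X) \<le> card X"
      using X(1) V(1) finite_subset by (intro card_mono) auto
    moreover have "card (nbs H V (S 0) - X) \<le> card (V - X)"
      using V(1) by (intro card_mono) (auto simp: nbs_def)
    ultimately show "A0 \<le> card X" "A0 \<le> card (V - X)" by linarith+
  qed
  have X3: "3 \<le> card X" using AX(1) A0(1) k by linarith
  define R' where "R' = {f\<in>R. f \<inter> Z = {} \<and> (\<exists>i<4. \<exists>v\<in>V - X. f \<in> F i v)}"
  let ?Idx = "{..<4::nat} \<times> (V - X)"
  let ?FF = "\<lambda>(i, v). F i v"
  have sp': "spreads \<rho> w V ?Idx ?FF R" using sp unfolding F_def D_def B_def S_def .
  have fIdx: "finite ?Idx" using V by simp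
  have cIdx: "card ?Idx \<le> 4 * card V" using card_mono[OF V(1) Diff_subset[of V X]] by (simp add: card_cartesian_product)
  have hit: "\<exists>f\<in>R'. f \<inter> W = {} \<and> \<rho> * real (card Y) \<le> real (card {i\<in>Y. f \<in> ?FF i})"
    if W: "W \<subseteq> V" "card W \<le> k * s" and Y: "Y \<subseteq> ?Idx" "Y \<noteq> {}" for W Y
  proof -
    have "card (W \<union> Z) \<le> w" using card_Un_le[of W Z] W(2) cZ s(2) by linarith
    moreover have "W \<union> Z \<subseteq> V" using W ZV by simp
    ultimately obtain f where f: "f \<in> R" "f \<inter> (W \<union> Z) = {}"
      "\<rho> * real (card Y) \<le> real (card {i\<in>Y. f \<in> ?FF i})"
      using sp' Y unfolding spreads_def by meson
    have fY: "finite Y" using Y fIdx finite_subset by blast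
    have "0 < \<rho> * real (card Y)" using pos Y fY by (simp add: card_gt_0_iff)
    then have "card {i\<in>Y. f \<in> ?FF i} \<noteq> 0" using f(3) by (metis not_less of_nat_0)
    then have "{i\<in>Y. f \<in> ?FF i} \<noteq> {}" by (metis card.empty)
    then obtain i v where "(i, v) \<in> Y" "f \<in> F i v" by auto
    then have "f \<in> R'" using f Y unfolding R'_def by blast
    then show ?thesis using f by blast
  qed
  have "\<exists>M\<subseteq>R'. disjoint M \<and> finite M \<and> card M \<le> s \<and> real (card {i\<in>?Idx. card {f\<in>M. f \<in> ?FF i} < g}) \<le> real b"
  proof (rule reserve_matching[OF V(1) _ _ fIdx hit])
    show "f \<subseteq> V \<and> card f = k" if "f \<in> R'" for f using that Rf by (simp add: R'_def)
    show "0 < k" using k by simp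
    have "real g * real (card ?Idx) \<le> real g * (4 * real (card V))"
      using cIdx by (intro mult_left_mono) (simp_all del: card_cartesian_product)
    then show "real g * real (card ?Idx) < \<rho> * real b * real s" using s(1) by linarith
  qed (use pos in auto)
  then obtain Mr where Mr: "Mr \<subseteq> R'" "disjoint Mr" "finite Mr" "card Mr \<le> s"
    "card {i\<in>?Idx. card {f\<in>Mr. f \<in> ?FF i} < g} \<le> b" by (auto simp: of_nat_le_iff)
  define Y where "Y = {v\<in>V - X. \<exists>i<4. card {f\<in>Mr. f \<in> F i v} < g}"
  have YV: "Y \<subseteq> V - X" by (auto simp: Y_def)
  have cY: "card Y \<le> b"
  proof -
    have "Y \<subseteq> snd ` {i\<in>?Idx. card {f\<in>Mr. f \<in> ?FF i} < g}"
      by (force simp: Y_def)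
    then have "card Y \<le> card {i\<in>?Idx. card {f\<in>Mr. f \<in> ?FF i} < g}"
      using fIdx by (intro surj_card_le) auto
    then show ?thesis using Mr(5) by linarith
  qed
  have MrP: "f \<subseteq> V" "card f = k" "f \<in> R" "f \<inter> Z = {}" "card (f \<inter> X) = 2" if "f \<in> Mr" for f
  proof -
    have f: "f \<in> R'" using that Mr(1) by auto
    then show "f \<subseteq> V" "card f = k" "f \<in> R" "f \<inter> Z = {}" using Rf by (auto simp: R'_def)
    obtain i v where iv: "f \<in> F i v" using f by (auto simp: R'_def)
    show "card (f \<inter> X) = 2" by (rule swap_family_joints[OF iv[unfolded F_def D_def] k])
  qed
  have UMr: "\<Union>Mr \<subseteq> V" using MrP(1) by blast
  have cUM: "card (\<Union>Mr) \<le> k * s"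
    using MrP(2) Mr(4) by (rule card_Union_uniform)
  define Q where "Q = {e\<in>H. card (e \<inter> X) = 2}"
  \<comment> \<open>Exceptional vertices in the reserve or in \<open>KK\<close> are already taken
    care of: the latter wait for the gadgets and never have to be swapped.\<close>
  let ?Y = "Y - \<Union>Mr - KK" and ?W0 = "\<Union>Mr \<union> Z"
  have cYle: "card ?Y \<le> b"
    using card_mono[of Y ?Y] YV V cY finite_subset[OF YV] by fastforce
  have "\<exists>M\<subseteq>Q. disjoint M \<and> finite M \<and> card M \<le> card ?Y \<and> ?Y \<subseteq> \<Union>M \<and> \<Union>M \<inter> ?W0 = {}"
  proof (rule cover_matching[where w = "k * s + 4 * k" and k = k])
    show "finite ?Y" using YV V by (meson finite_Diff finite_subset)
    show "finite ?W0" using UMr V fZ finite_subset by blast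
    show "card ?W0 \<le> k * s + 4 * k" using card_Un_le[of "\<Union>Mr" Z] cUM cZ by linarith
    show "card e = k" if "e \<in> Q" for e using that Hf by (auto simp: Q_def)
    show "?Y \<inter> ?W0 = {}" using YV uu(2) by (auto simp: Z_def)
    show "0 < k" using k by simp
    fix y W assume y: "y \<in> ?Y" "y \<notin> W" and W: "finite W" "card W \<le> k * s + 4 * k + k * card ?Y"
    have "k * card ?Y \<le> k * b" using cYle by simp
    then have cW: "card W \<le> w" using W(2) s(2) by linarith
    have yV: "y \<in> V" "y \<notin> X" using y YV by auto
    have cut: "1 + real k + 1 \<le> real (card (A - W))" if "A0 \<le> card A" for A
      using diff_card_le_card_Diff[OF W(1), of A] cW A0(1) that by linarith
    have "\<exists>xs. length xs = k \<and> distinct xs \<and> y \<notin> set xs \<and> (\<forall>j<k. xs ! j \<in> D 0 j) \<and>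
        insert y (set (tl xs)) \<in> H \<and> set xs \<inter> W = {}"
    proof (rule swap_family_dense(2)[OF V(1) _ _ yV(1)])
      show "D 0 j \<subseteq> V" for j using X(1) by (auto simp: D_def pos_domain_def B_def nbs_def)
      show "1 + real k + 1 \<le> real (card (D 0 j - W))" if "j < k - 1" for j
      proof (rule cut)
        show "A0 \<le> card (D 0 j)" using codeg[OF S[of 0]] AX by (simp add: D_def pos_domain_def B_def)
      qed
      fix T assume T: "T \<subseteq> V" "card T = k - 1"
      have "D 0 (k - 1) = X" using k by (simp add: D_def pos_domain_def)
      then have "D 0 (k - 1) \<inter> nbs H V T = nbs H V T \<inter> X" by blast
      then have "A0 \<le> card (D 0 (k - 1) \<inter> nbs H V T)" using codeg[OF T] by simp
      then show "1 + real k + 1 \<le> real (card (D 0 (k - 1) \<inter> nbs H V T - W))" by (rule cut)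
    qed (use k in auto)
    then obtain xs where xs: "length xs = k" "distinct xs" "\<forall>j<k. xs ! j \<in> D 0 j"
        "insert y (set (tl xs)) \<in> H" "set xs \<inter> W = {}" by blast
    have "card (set (tl xs) \<inter> X) = 2" using pos_domain_tl[OF xs(1,2) k] xs(3) unfolding D_def by blast
    then have "insert y (set (tl xs)) \<in> Q" using xs(4) yV(2) by (simp add: Q_def)
    moreover have "set (tl xs) \<subseteq> set xs" by (cases xs) auto
    then have "insert y (set (tl xs)) \<inter> W = {}" using xs(5) y(2) by auto
    ultimately show "\<exists>e\<in>Q. y \<in> e \<and> e \<inter> W = {}" by (intro bexI[of _ "insert y (set (tl xs))"]) simp_all
  qed
  then obtain MY where MY: "MY \<subseteq> Q" "disjoint MY" "finite MY" "card MY \<le> card ?Y" "?Y \<subseteq> \<Union>MY" "\<Union>MY \<inter> ?W0 = {}"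
    by blast
  define M where "M = Mr \<union> MY"
  define Sg where "Sg = {{uu 0, uu 1}, {uu 2, uu 3}}"
  have ueq: "uu i = uu j \<longleftrightarrow> i = j" if "i < 4" "j < 4" for i j using uu(1) that by (auto simp: inj_on_def)
  have une: "{uu 0, uu 1} \<noteq> {uu 2, uu 3}" by (simp add: doubleton_eq_iff ueq)
  have cSg: "card Sg = 2" using une by (simp add: Sg_def)
  have SgZ: "h \<subseteq> Z" if "h \<in> Sg" for h using that by (auto simp: Sg_def Z_def)
  have UMZ: "\<Union>M \<inter> Z = {}" using MrP(4) MY(6) unfolding M_def by blast
  have "\<exists>c I. arr k V ?E c ((\<lambda>f. f \<inter> X) ` M) I \<and> set c = X \<and> Sg \<subseteq> cedges c \<and> (\<forall>f\<in>M. I (f \<inter> X) = f - X)"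
  proof (rule arr_of_matching[OF V(1) X(1)])
    show "X \<noteq> {}" using X3 by auto
    show "finite M" using Mr(3) MY(3) by (simp add: M_def)
    have "\<Union>Mr \<inter> \<Union>MY = {}" using MY(6) by blast
    then show "disjoint M" unfolding M_def by (rule disjoint_union[OF Mr(2) MY(2)])
    show "f \<subseteq> V \<and> card f = k \<and> card (f \<inter> X) = 2 \<and> f \<in> ?E" if "f \<in> M" for f
    proof (cases "f \<in> Mr")
      case True
      then show ?thesis using MrP[of f] by simp
    next
      case False
      then have "f \<in> Q" using that MY(1) by (auto simp: M_def)
      then show ?thesis using Hf[of f] by (simp add: Q_def)
    qed
    show "finite Sg" by (simp add: Sg_def)
    show "disjoint Sg" by (auto simp: Sg_def disjoint_def pairwise_def disjnt_def ueq)
    show "h \<subseteq> X \<and> card h = 2 \<and> h \<inter> \<Union>M = {}" if "h \<in> Sg" for h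
    proof -
      have "h \<subseteq> uu ` {..<4} \<and> card h = 2" using that by (auto simp: Sg_def ueq)
      moreover have "uu ` {..<4} \<subseteq> X" "uu ` {..<4} \<subseteq> Z" using uu(2) by (auto simp: Z_def)
      ultimately have "h \<subseteq> X" "h \<subseteq> Z" "card h = 2" by (meson subset_trans)+
      then show ?thesis using UMZ by blast
    qed
  qed (use k in auto)
  then obtain c I where c': "arr k V ?E c ((\<lambda>f. f \<inter> X) ` M) I \<and> set c = X \<and> Sg \<subseteq> cedges c \<and> (\<forall>f\<in>M. I (f \<inter> X) = f - X)"
    by (elim exE)
  then have c: "arr k V ?E c ((\<lambda>f. f \<inter> X) ` M) I" "set c = X" "Sg \<subseteq> cedges c"
    "\<And>f. f \<in> M \<Longrightarrow> I (f \<inter> X) = f - X" by simp_all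
  have Mr2: "f = h" if "f \<in> Mr" "h \<in> Mr" "f \<inter> h \<noteq> {}" for f h
    using Mr(2) that by (auto simp: disjoint_def pairwise_def disjnt_def)
  have resF: "g \<le> card {f\<in>Mr. f \<in> F i v}" if "i < 4" "v \<in> V - X - Y" for i v
  proof (rule ccontr)
    assume "\<not> ?thesis"
    then have "v \<in> Y" using that unfolding Y_def by auto
    then show False using that by blast
  qed
  have swapF: "\<exists>b\<in>f - X. b \<in> B i \<and> insert v (f - {b}) \<in> H" if f: "f \<in> F i v" for f i v
  proof -
    obtain b where "b \<in> f" "b \<in> D i 0" "insert v (f - {b}) \<in> H"
      using swap_familyE[OF f[unfolded F_def]] k by auto
    then show ?thesis by (auto simp: D_def pos_domain_def)
  qed
  \<comment> \<open>The value of \<open>P0\<close> adds up at most \<open>s\<close> reserve pairs,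
    at most \<open>b\<close> pairs covering exceptional vertices, the two gadget pairs, and
    \<open>m + 2\<close> for pairs protected during the reserve phase. All edges of the initial
    matching are protected, since their interiors may be exceptional.\<close>
  interpret P: perturbed k V ?E X Sg KK Y Mr "F 0" m "s + b + m + 4" A0 g "2 * k"
  proof
    show "has_transversals k (real m) V ?E" using has_transversals_mono[OF tr, of ?E "real m"] by simp
    show "A0 \<le> card (nbs ?E V T \<inter> X)" if T: "T \<subseteq> V" "card T = k - 1" for T
    proof -
      have "card (nbs H V T \<inter> X) \<le> card (nbs ?E V T \<inter> X)"
      proof (rule card_mono)
        show "finite (nbs ?E V T \<inter> X)" using V(1) by (simp add: nbs_def)
        show "nbs H V T \<inter> X \<subseteq> nbs ?E V T \<inter> X" using nbs_mono[of H ?E V T] by blast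
      qed
      then show ?thesis using codeg[OF T] by simp
    qed
    show "g \<le> card {f\<in>Mr. f \<in> F 0 v}" if "v \<in> V - X - Y" for v
      using resF[OF _ that, of 0] by simp
    show "f \<inter> h = {}" if "f \<in> Mr" "h \<in> Mr" "f \<noteq> h" for f h using Mr2 that by blast
    show "f \<inter> X \<noteq> {}" if "f \<in> Mr" for f using MrP(5)[OF that] by auto
    show "\<exists>b\<in>f - X. insert v (f - {b}) \<in> ?E" if "f \<in> F 0 v" for v f using swapF[OF that] by blast
    have "card X - card Sg = card X - 2" "2 \<le> card X" using cSg X3 by simp_all
    moreover obtain x where x: "card X = x + 2" using \<open>2 \<le> card X\<close> by (metis add.commute le_Suc_ex)
    moreover obtain j where j: "k = j + 2" using k by (metis add.commute le_Suc_ex Suc_le_lessD Suc_leD numeral_3_eq_3 numeral_2_eq_2)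
    moreover have "n = x + 6" using X(2) x by simp
    ultimately show "card V = card X + (k - 2) * (card X - card Sg) + card KK + 2 * k"
      using V(2) cKK by (simp add: algebra_simps)
  qed (use k V X X3 A0 Mr MrP in auto)
  let ?G = "(\<lambda>f. f \<inter> X) ` M"
  have st: "P.st Mr ?G c ?G I"
    unfolding P.st_def
  proof (intro conjI ballI)
    show "Sg \<inter> ?G = {}"
    proof -
      have "f \<inter> X \<notin> Sg" if "f \<in> M" for f
      proof
        assume h: "f \<inter> X \<in> Sg"
        then have "f \<inter> X \<noteq> {}" by (auto simp: Sg_def)
        moreover have "f \<inter> X \<subseteq> Z" by (rule SgZ[OF h])
        ultimately show False using UMZ that by blast
      qed
      then show ?thesis by blast
    qed
    have UI: "\<Union>(I ` ?G) = \<Union>M - X" using c(4) by auto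
    show "KK \<subseteq> pool V c ?G I"
      unfolding pool_def UI c(2) using KV UMZ by (auto simp: Z_def)
    have "v \<in> \<Union>M - X \<or> v \<in> KK" if "v \<in> Y" for v using that MY(5) YV unfolding M_def by blast
    then show "(pool V c ?G I - KK) \<inter> Y = {}" unfolding pool_def UI by blast
    show "f \<inter> X \<in> ?G" if "f \<in> Mr" for f using that by (auto simp: M_def)
    show "I (f \<inter> X) = f - X" if "f \<in> Mr" for f using that c(4) by (auto simp: M_def)
  qed (use c in auto)
  have "card ?G \<le> card M" using Mr(3) MY(3) by (intro card_image_le) (simp add: M_def)
  also have "\<dots> \<le> s + b" using card_Un_le[of Mr MY] Mr(4) MY(4) cYle unfolding M_def by linarith
  finally have P: "card ?G + card Sg + m + 2 \<le> s + b + m + 4" using cSg by simp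
  have "(k - 2) * m \<le> 2 * k * m" by (intro mult_right_mono) auto
  then have U: "(k - 2) * (m + 2) + (k - 2) * m \<le> g" using g by linarith
  obtain Mu Pr d Gd I' where d: "P.st Mu Pr d Gd I'" "P.bad d Gd = {}" "card (Mr - Mu) \<le> (k - 2) * (m + 2)"
    using P.all_good[OF st P U] by blast
  show ?thesis
  proof (rule P.close_gadgets[OF k d(1,2), of uu Kf n F])
    show "Sg = {{uu 0, uu 1}, {uu 2, uu 3}}" by (rule Sg_def)
    show "{uu 0, uu 1} \<noteq> {uu 2, uu 3}" by (rule une)
    show "KK = (\<Union>i<4. Kf i)" by (rule KK_def)
    show "disjoint_family_on Kf {..<4}" by (rule Kf(1))
    show "card (Kf i) = k - 2" if "i < 4" for i using Kf(2)[OF that] by simp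
    show "card V = (k - 1) * n" "card X + 4 = n" by (rule V(2), rule X(2))
    show "g \<le> card {f\<in>Mr. f \<in> F i v}" if "i < 4" "v \<in> V - X - Y" for i v
      by (rule resF[OF that])
    show "\<exists>b\<in>f - X. b \<in> nbs ?E V (insert (uu i) (Kf i)) \<and> insert v (f - {b}) \<in> ?E"
      if "i < 4" "f \<in> F i v" for i v f
      using swapF[OF that(2)] nbs_mono[of H ?E V "S i"] unfolding B_def S_def by blast
    show "card (Mr - Mu) + 2 * k * m \<le> g" using d(3) g by linarith
  qed simp
qed

section \<open>Asymptotics\<close>

lemma codegree_nbs:
  assumes H: "uniform_hypergraph k V H" and V: "finite V" and k: "k \<ge> 1" and S: "S \<subseteq> V" "card S = k - 1"
  shows "min_degree (k - 1) V H \<le> card (nbs H V S)"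
proof -
  have fS: "finite S" using S V finite_subset by blast
  have "{S. S \<subseteq> V \<and> card S = k - 1} \<subseteq> Pow V" by auto
  then have "finite {S. S \<subseteq> V \<and> card S = k - 1}" using V finite_subset by blast
  then have "min_degree (k - 1) V H \<le> degree H S"
    unfolding min_degree_def using S by (intro Min_le) auto
  also have "\<dots> \<le> card (nbs H V S)"
    unfolding degree_def
  proof (rule surj_card_le)
    show "finite (nbs H V S)" using V by (simp add: nbs_def)
    show "{e \<in> H. S \<subseteq> e} \<subseteq> (\<lambda>x. insert x S) ` nbs H V S"
    proof
      fix e assume e: "e \<in> {e \<in> H. S \<subseteq> e}"
      then have e': "e \<subseteq> V" "card e = k" "S \<subseteq> e" "e \<in> H" using H by (auto simp: uniform_hypergraph_def)
      have "card (e - S) = 1" using e' S fS k by (simp add: card_Diff_subset)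
      then obtain x where x: "e - S = {x}" by (auto simp: card_1_singleton_iff)
      then have "e = insert x S" "x \<notin> S" "x \<in> V" using e' by auto
      then show "e \<in> (\<lambda>x. insert x S) ` nbs H V S" using e' by (auto simp: nbs_def)
    qed
  qed
  finally show ?thesis .
qed

section \<open>From hitting families to asymptotic probability\<close>

lemma eventually_le_linear: "\<epsilon> > 0 \<Longrightarrow> \<forall>\<^sub>F n in sequentially. L \<le> \<epsilon> * real n"
  by real_asymp

text \<open>The interface between the deterministic and the random part. The collection may depend
  on the hypergraph and on \<open>n\<close>, whereas the density \<open>q\<close> and the
  exponential rate \<open>C\<close> are to be constants, since the number of random edges is fixed
  before the hypergraph.\<close>

definition hits_suffice :: "real \<Rightarrow> real \<Rightarrow> nat \<Rightarrow> nat \<Rightarrow> nat \<Rightarrow> (nat set set \<Rightarrow> bool) \<Rightarrow> bool" where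
  "hits_suffice q C k n N P \<longleftrightarrow> (\<exists>\<C>. finite \<C> \<and> real (card \<C>) \<le> exp (C * real n) \<and>
     (\<forall>G\<in>\<C>. G \<subseteq> ksets k {1..N} \<and> q * real (N choose k) \<le> real (card G)) \<and>
     (\<forall>R\<subseteq>ksets k {1..N}. (\<forall>G\<in>\<C>. R \<inter> G \<noteq> {}) \<longrightarrow> P R))"

lemma hits_sufficeI:
  fixes F :: "'i \<Rightarrow> nat set set"
  assumes N: "N \<ge> 1" and k: "k \<ge> 1" and Idx: "finite Idx" and r: "0 \<le> r" and p: "0 \<le> p"
    and F: "\<And>i. i \<in> Idx \<Longrightarrow> F i \<subseteq> ksets k {1..N}"
    and dens: "\<And>i W. i \<in> Idx \<Longrightarrow> W \<subseteq> {1..N} \<Longrightarrow> card W \<le> w \<Longrightarrow>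
       p * real (N choose k) \<le> real (card {f\<in>F i. f \<inter> W = {}})"
    and q: "q \<le> p / 2" "q \<le> (r / real N) ^ k" and C: "real (N + card Idx + N * k) \<le> C * real n"
    and P: "\<And>R. R \<subseteq> ksets k {1..N} \<Longrightarrow> has_transversals k r {1..N} R \<Longrightarrow> spreads (p / 2) w {1..N} Idx F R \<Longrightarrow> P R"
  shows "hits_suffice q C k n N P"
proof -
  have V: "finite {1..N}" "{1..N} \<noteq> {}" "card {1..N} = N" using N by auto
  obtain \<C> where C1: "finite \<C>" "card \<C> \<le> 2 ^ (N + card Idx) + 2 ^ (N * k)"
    "\<forall>G\<in>\<C>. G \<subseteq> ksets k {1..N} \<and> min (p / 2) ((r / real N) ^ k) * real (N choose k) \<le> real (card G)"
    "\<forall>R. (\<forall>G\<in>\<C>. R \<inter> G \<noteq> {}) \<longrightarrow> has_transversals k r {1..N} R \<and> spreads (p / 2) w {1..N} Idx F R"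
    using hitting_collection[OF V(1,2) Idx r p, where F = F and k = k and w = w] F dens unfolding V(3) by blast
  have "real (card \<C>) \<le> exp (C * real n)"
  proof -
    have t: "(2::nat) ^ x + 2 ^ y \<le> 2 ^ (x + y)" if "x \<ge> 1" "y \<ge> 1" for x y :: nat
    proof -
      have "(2::nat) \<le> 2 ^ x" "(2::nat) \<le> 2 ^ y" using that by (metis power_increasing power_one_right one_le_numeral)+
      then obtain u v where "(2::nat) ^ x = u + 2" "(2::nat) ^ y = v + 2" by (metis add.commute le_Suc_ex)
      then show ?thesis by (simp add: power_add algebra_simps)
    qed
    have "N * k \<ge> 1" using N k by simp
    then have "card \<C> \<le> 2 ^ (N + card Idx + N * k)" using C1(2) t[of "N + card Idx" "N * k"] N by simp
    then have "real (card \<C>) \<le> 2 ^ (N + card Idx + N * k)" by (metis of_nat_le_iff of_nat_numeral of_nat_power)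
    also have "\<dots> \<le> exp 1 ^ (N + card Idx + N * k)"
      using exp_ge_add_one_self[of 1] by (intro power_mono) auto
    also have "\<dots> = exp (real (N + card Idx + N * k))" by (simp flip: exp_of_nat_mult)
    also have "\<dots> \<le> exp (C * real n)" using C by simp
    finally show ?thesis .
  qed
  moreover have "q * real (N choose k) \<le> real (card G)" if "G \<in> \<C>" for G
  proof -
    have "q * real (N choose k) \<le> min (p / 2) ((r / real N) ^ k) * real (N choose k)"
      using q by (intro mult_right_mono) auto
    then show ?thesis using C1(3) that by fastforce
  qed
  ultimately show ?thesis
    unfolding hits_suffice_def using C1 P by (intro exI[of _ \<C>]) blast
qed

text \<open>About \<open>c * n\<close> random edges miss some family with probability at most
  \<open>exp (C * n) * (1 - q) ^ m\<close>, which decays exponentially once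
  \<open>c * q > C\<close>. The assumption on \<open>N\<close> ensures that there are at least
  \<open>m\<close> available \<open>k\<close>-sets, so that the distribution is meaningful.\<close>

lemma aas_of_hits_suffice:
  assumes q: "0 < q" "q \<le> 1" and c: "C < c * q" "0 < c"
    and ev: "\<forall>\<^sub>F n in sequentially. hits_suffice q C k n (N n) (P n)"
    and N: "\<forall>\<^sub>F n in sequentially. c * real n \<le> real (N n choose k)"
  shows "(\<lambda>n. measure_pmf.prob (random_hypergraph k (N n) (nat \<lfloor>c * real n\<rfloor>)) {R. P n R}) \<longlonglongrightarrow> 1"
proof (rule tendsto_sandwich)
  \<comment> \<open>The factor \<open>exp q\<close> absorbs the loss of at most one edge by rounding
    \<open>c * n\<close> down.\<close>
  define lo where "lo n = 1 - exp q * exp (- (c * q - C) * real n)" for n :: nat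
  show "lo \<longlonglongrightarrow> 1"
  proof -
    have "c * q - C > 0" using c by simp
    then show ?thesis unfolding lo_def by real_asymp
  qed
  show "(\<lambda>n. 1) \<longlonglongrightarrow> (1::real)" by simp
  show "\<forall>\<^sub>F n in sequentially. measure_pmf.prob (random_hypergraph k (N n) (nat \<lfloor>c * real n\<rfloor>)) {R. P n R} \<le> 1"
    by simp
  show "\<forall>\<^sub>F n in sequentially. lo n \<le> measure_pmf.prob (random_hypergraph k (N n) (nat \<lfloor>c * real n\<rfloor>)) {R. P n R}"
    using ev N
  proof eventually_elim
    fix n assume h: "hits_suffice q C k n (N n) (P n)" and Nn: "c * real n \<le> real (N n choose k)"
    let ?m = "nat \<lfloor>c * real n\<rfloor>"
    let ?R = "random_hypergraph k (N n) ?m"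
    obtain \<C> where "finite \<C> \<and> real (card \<C>) \<le> exp (C * real n) \<and>
       (\<forall>G\<in>\<C>. G \<subseteq> ksets k {1..N n} \<and> q * real (N n choose k) \<le> real (card G)) \<and>
       (\<forall>R\<subseteq>ksets k {1..N n}. (\<forall>G\<in>\<C>. R \<inter> G \<noteq> {}) \<longrightarrow> P n R)"
      using h unfolding hits_suffice_def by (elim exE)
    then have C: "finite \<C>" "real (card \<C>) \<le> exp (C * real n)"
      "\<And>G. G \<in> \<C> \<Longrightarrow> G \<subseteq> ksets k {1..N n} \<and> q * real (N n choose k) \<le> real (card G)"
      "\<And>R. R \<subseteq> ksets k {1..N n} \<Longrightarrow> (\<forall>G\<in>\<C>. R \<inter> G \<noteq> {}) \<Longrightarrow> P n R" by simp_all
    have c0: "0 \<le> c * real n" using c(2) by simp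
    have m: "?m \<le> N n choose k" using Nn c0 by linarith
    have mlow: "c * real n - 1 \<le> real ?m" using c0 by linarith
    have "(1 - q) ^ ?m \<le> exp (- q) ^ ?m"
      using q exp_ge_add_one_self[of "- q"] by (intro power_mono) auto
    also have "\<dots> = exp (- q * real ?m)" by (simp add: exp_of_nat_mult[symmetric] mult.commute)
    also have "\<dots> \<le> exp (- q * (c * real n - 1))" using mlow q by simp
    finally have pw: "(1 - q) ^ ?m \<le> exp (- q * (c * real n - 1))" .
    have "real (card \<C>) * (1 - q) ^ ?m \<le> exp (C * real n) * exp (- q * (c * real n - 1))"
      using C(2) pw q by (intro mult_mono) auto
    also have "\<dots> = exp q * exp (- (c * q - C) * real n)"
      by (simp add: exp_add[symmetric] algebra_simps)
    finally have "lo n \<le> 1 - real (card \<C>) * (1 - q) ^ ?m" by (simp add: lo_def)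
    also have "\<dots> \<le> measure_pmf.prob ?R {R. \<forall>G\<in>\<C>. R \<inter> G \<noteq> {}}"
      by (rule prob_hits_all[OF m C(1) q(2) C(3)])
    also have "\<dots> = measure_pmf.prob ?R ({R. \<forall>G\<in>\<C>. R \<inter> G \<noteq> {}} \<inter> set_pmf ?R)"
      by (simp add: measure_Int_set_pmf)
    also have "\<dots> \<le> measure_pmf.prob ?R {R. P n R}"
    proof (rule measure_pmf.finite_measure_mono)
      have "R \<subseteq> ksets k {1..N n}" if "R \<in> set_pmf ?R" for R
        using that unfolding set_pmf_random_hypergraph[OF m] by (auto simp: uniform_hypergraph_def ksets_def)
      then show "{R. \<forall>G\<in>\<C>. R \<inter> G \<noteq> {}} \<inter> set_pmf ?R \<subseteq> {R. P n R}" using C(4) by blast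
    qed simp
    finally show "lo n \<le> measure_pmf.prob ?R {R. P n R}" .
  qed
qed

text \<open>Quadratically many \<open>k\<close>-sets suffice: \<open>(j * n choose k)\<close> is at
  least \<open>(j * n / k) ^ k\<close>, hence at least \<open>(n / 2) ^ 2\<close>, because
  \<open>k \<le> 2 * (k - 1) \<le> 2 * j\<close>.\<close>

lemma eventually_many_edges:
  assumes k: "k \<ge> 2" and j: "k - 1 \<le> j"
  shows "\<forall>\<^sub>F n in sequentially. c * real n \<le> real (j * n choose k)"
proof -
  have "\<forall>\<^sub>F n in sequentially. 4 * c \<le> 1 * real n" by (rule eventually_le_linear) simp
  moreover have "\<forall>\<^sub>F n in sequentially. real k + 2 \<le> 1 * real n" by (rule eventually_le_linear) simp
  ultimately show ?thesis
  proof eventually_elim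
    fix n assume n: "4 * c \<le> 1 * real n" "real k + 2 \<le> 1 * real n"
    have j1: "j \<ge> 1" using j k by simp
    have "n \<le> j * n" using j1 by simp
    then have kn: "k \<le> j * n" using n(2) by linarith
    have "k \<le> 2 * j" using k j by simp
    then have "real k * real n \<le> 2 * real j * real n" by (intro mult_right_mono) auto
    then have "real n / 2 \<le> real (j * n) / real k" using k by (simp add: field_simps)
    then have "(real n / 2) ^ 2 \<le> (real (j * n) / real k) ^ 2" by (intro power_mono) auto
    moreover have "1 \<le> real (j * n) / real k"
      using of_nat_mono[OF kn, where 'a = real] k by (simp add: le_divide_eq)
    then have "(real (j * n) / real k) ^ 2 \<le> (real (j * n) / real k) ^ k" using k by (intro power_increasing) auto
    moreover have "(real (j * n) / real k) ^ k \<le> real (j * n choose k)"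
      using binomial_ge_n_over_k_pow_k[OF kn, where 'a = real] .
    moreover have "c * real n \<le> (real n / 2) ^ 2"
      using mult_right_mono[OF n(1), of "real n / 4"] by (simp add: power2_eq_square)
    ultimately show "c * real n \<le> real (j * n choose k)" by linarith
  qed
qed

section \<open>Choice of the constants\<close>

lemma floor_bounds:
  assumes "0 \<le> x"
  shows "real (nat \<lfloor>x\<rfloor>) \<le> x" "x - 1 \<le> real (nat \<lfloor>x\<rfloor>)"
  using assms by linarith+

lemma nat_le_floor: "real i \<le> x \<Longrightarrow> i \<le> nat \<lfloor>x\<rfloor>"
  by (simp add: le_nat_floor)

lemma matching_hits_suffice:
  assumes k: "k \<ge> 2" and a: "0 < a" "a \<le> 1"
  shows "\<exists>q C. 0 < q \<and> q \<le> 1 \<and> (\<forall>\<^sub>F n in sequentially. \<forall>H. uniform_hypergraph k {1..k * n} H \<longrightarrow>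
     (\<forall>S\<subseteq>{1..k * n}. card S = k - 1 \<longrightarrow> a * real n \<le> real (card (nbs H {1..k * n} S))) \<longrightarrow>
     hits_suffice q C k n (k * n) (\<lambda>R. has_perfect_matching {1..k * n} (H \<union> R)))"
proof -
  let ?k = "real k"
  \<comment> \<open>After deleting obstacles of at most \<open>a * n / 4\<close> vertices, at least
    \<open>a * n / 2\<close> of the \<open>k * n\<close> vertices remain for each entry of a swap
    sequence.\<close>
  define p where "p = (a / (2 * ?k)) ^ k"
  \<comment> \<open>Chosen to satisfy \<open>g * card V < (p / 2) * b * s\<close> for
    \<open>g\<close> about \<open>\<gamma> * n\<close> and
    \<open>b = s \<ge> a * n / (16 * k)\<close>, with a factor 2 to spare.\<close>
  define \<gamma> where "\<gamma> = p / 2 * a ^ 2 / (512 * ?k ^ 3)"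
  define q where "q = min (p / 2) ((\<gamma> / (4 * ?k ^ 2)) ^ k)"
  define C where "C = 2 * ?k + ?k ^ 2"
  have k0: "?k \<ge> 2" using k by simp
  have "a / (2 * ?k) \<le> 1" using a k0 by (simp add: divide_le_eq)
  then have p: "0 < p" "p \<le> 1" unfolding p_def using a k0 by (simp_all add: power_le_one)
  have \<gamma>: "0 < \<gamma>" unfolding \<gamma>_def using p a k0 by simp
  have q: "0 < q" "q \<le> 1" unfolding q_def using p \<gamma> k0 by auto
  have e1: "\<forall>\<^sub>F n in sequentially. 8 * ?k + 16 \<le> a * real n" by (rule eventually_le_linear[OF a(1)])
  have e2: "\<forall>\<^sub>F n in sequentially. 16 * ?k \<le> a * real n" by (rule eventually_le_linear[OF a(1)])
  have e3: "\<forall>\<^sub>F n in sequentially. 4 * ?k \<le> \<gamma> * real n" by (rule eventually_le_linear[OF \<gamma>])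
  have "\<forall>\<^sub>F n in sequentially. \<forall>H. uniform_hypergraph k {1..k * n} H \<longrightarrow>
     (\<forall>S\<subseteq>{1..k * n}. card S = k - 1 \<longrightarrow> a * real n \<le> real (card (nbs H {1..k * n} S))) \<longrightarrow>
     hits_suffice q C k n (k * n) (\<lambda>R. has_perfect_matching {1..k * n} (H \<union> R))"
    using e1 e2 e3
  proof (eventually_elim, intro allI impI)
    fix n H
    assume n: "8 * ?k + 16 \<le> a * real n" "16 * ?k \<le> a * real n" "4 * ?k \<le> \<gamma> * real n"
      and H: "uniform_hypergraph k {1..k * n} H"
      and cod: "\<forall>S\<subseteq>{1..k * n}. card S = k - 1 \<longrightarrow> a * real n \<le> real (card (nbs H {1..k * n} S))"
    let ?V = "{1..k * n}"
    have n0: "real n > 0" using n(1) k0 by (cases "n = 0") auto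
    have an: "a * real n \<le> real n" using a n0 by simp
    have kn: "2 * real n \<le> ?k * real n" using k0 n0 by (intro mult_right_mono) auto
    have cV: "card ?V = k * n" "real (card ?V) = ?k * real n" by simp_all
    define w where "w = nat \<lfloor>a * real n / 4\<rfloor>"
    \<comment> \<open>The same number serves as the size of the reserve and as the bound on
      exceptional indices; its denominator is dictated by
      \<open>k * b + k * b \<le> w\<close>.\<close>
    define b where "b = nat \<lfloor>a * real n / (8 * ?k)\<rfloor>"
    define g where "g = nat \<lfloor>\<gamma> * real n\<rfloor>"
    define m where "m = nat \<lfloor>\<gamma> * real n / (2 * ?k)\<rfloor>"
    have wb: "real w \<le> a * real n / 4" unfolding w_def using a n0 by (intro floor_bounds) simp
    have bb: "real b \<le> a * real n / (8 * ?k)" "a * real n / (8 * ?k) - 1 \<le> real b"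
      unfolding b_def using a n0 k0 by (intro floor_bounds; simp)+
    have gb: "real g \<le> \<gamma> * real n" unfolding g_def using \<gamma> n0 by (intro floor_bounds) simp
    have mb: "real m \<le> \<gamma> * real n / (2 * ?k)" "\<gamma> * real n / (2 * ?k) - 1 \<le> real m"
      unfolding m_def using \<gamma> n0 k0 by (intro floor_bounds; simp)+
    have b2: "a * real n / (16 * ?k) \<le> real b"
    proof -
      have "1 \<le> a * real n / (16 * ?k)" using n(2) k0 by (simp add: field_simps)
      moreover have "a * real n / (8 * ?k) = 2 * (a * real n / (16 * ?k))" by simp
      ultimately show ?thesis using bb(2) by linarith
    qed
    have m2: "\<gamma> * real n / (4 * ?k) \<le> real m"
    proof -
      have "1 \<le> \<gamma> * real n / (4 * ?k)" using n(3) k0 by (simp add: field_simps)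
      moreover have "\<gamma> * real n / (2 * ?k) = 2 * (\<gamma> * real n / (4 * ?k))" by simp
      ultimately show ?thesis using mb(2) by linarith
    qed
    have HK: "H \<subseteq> ksets k ?V" using H by (auto simp: uniform_hypergraph_def ksets_def)
    have nW: "3 * a * real n / 4 \<le> real (card (nbs H ?V S - W))"
      if "S \<subseteq> ?V" "card S = k - 1" "card W \<le> w" "W \<subseteq> ?V" for S W
    proof -
      have "finite W" using that(4) finite_subset by blast
      then have "real (card (nbs H ?V S)) - real (card W) \<le> real (card (nbs H ?V S - W))"
        using diff_card_le_card_Diff[of W "nbs H ?V S"] by linarith
      moreover have "a * real n \<le> real (card (nbs H ?V S))" using cod that by blast
      moreover have "real (card W) \<le> a * real n / 4" using that(3) wb by linarith
      ultimately show ?thesis by linarith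
    qed
    show "hits_suffice q C k n (k * n) (\<lambda>R. has_perfect_matching ?V (H \<union> R))"
    proof (rule hits_sufficeI[where Idx = ?V and F = "swap_family k H (\<lambda>_. ?V)" and w = w and p = p and r = "real m"])
      show "1 \<le> k * n" using k n0 by simp
      show "1 \<le> k" using k by simp
      show "0 \<le> p" using p by simp
      show "swap_family k H (\<lambda>_. ?V) i \<subseteq> ksets k ?V" for i by (rule swap_family_ksets) simp
      show "p * real (k * n choose k) \<le> real (card {f \<in> swap_family k H (\<lambda>_. ?V) i. f \<inter> W = {}})"
        if i: "i \<in> ?V" and W: "W \<subseteq> ?V" "card W \<le> w" for i W
      proof -
        have fW: "finite W" using W finite_subset by blast
        have "(a * real n / 2 / real (card ?V)) ^ k * real (card ?V choose k)
          \<le> real (card {f \<in> swap_family k H (\<lambda>_. ?V) i. f \<inter> W = {}})"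
        proof (rule swap_family_dense(1)[OF _ k _ i])
          show "0 \<le> a * real n / 2" using a n0 by simp
          show "a * real n / 2 + ?k + 1 \<le> real (card (?V - W))" for j
          proof -
            have "real (card ?V) - real (card W) \<le> real (card (?V - W))"
              using diff_card_le_card_Diff[OF fW, of ?V] by linarith
            moreover have "real (card W) \<le> a * real n / 4" using W(2) wb by linarith
            ultimately show ?thesis using cV(2) n an kn by linarith
          qed
          fix S assume S: "S \<subseteq> ?V" "card S = k - 1"
          have eq: "?V \<inter> nbs H ?V S - W = nbs H ?V S - W" by (auto simp: nbs_def)
          show "a * real n / 2 + ?k + 1 \<le> real (card (?V \<inter> nbs H ?V S - W))"
            unfolding eq using nW[OF S W(2,1)] n by linarith
        qed auto
        moreover have "a * real n / 2 / real (card ?V) = a / (2 * ?k)" using n0 k0 by (simp add: field_simps)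
        ultimately show ?thesis using cV(1) by (simp add: p_def)
      qed
      show "q \<le> p / 2" by (simp add: q_def)
      show "q \<le> (real m / real (k * n)) ^ k"
      proof -
        have "\<gamma> / (4 * ?k ^ 2) = \<gamma> * real n / (4 * ?k) / real (k * n)"
          using n0 k0 by (simp add: field_simps power2_eq_square)
        also have "\<dots> \<le> real m / real (k * n)" using m2 by (intro divide_right_mono) auto
        finally have "(\<gamma> / (4 * ?k ^ 2)) ^ k \<le> (real m / real (k * n)) ^ k"
          using \<gamma> k0 by (intro power_mono) auto
        then show ?thesis by (simp add: q_def)
      qed
      show "real (k * n + card ?V + k * n * k) \<le> C * real n"
        by (simp add: C_def algebra_simps power2_eq_square)
      fix R assume R: "R \<subseteq> ksets k ?V" "has_transversals k (real m) ?V R"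
        "spreads (p / 2) w ?V ?V (swap_family k H (\<lambda>_. ?V)) R"
      show "has_perfect_matching ?V (H \<union> R)"
      proof (rule perfect_matching_of_hits[OF k _ _ HK R(1) _ _ R(2,3)])
        show "k dvd card ?V" by simp
        show "?k + 2 \<le> real (card (nbs H ?V S - W))" if S: "S \<subseteq> ?V" "card S = k - 1" and fW: "finite W" and W: "card W \<le> w" for S W
        proof -
          have "card (W \<inter> ?V) \<le> w" using W card_mono[OF fW, of "W \<inter> ?V"] by simp
          then have "3 * a * real n / 4 \<le> real (card (nbs H ?V S - (W \<inter> ?V)))" using nW S by simp
          moreover have "nbs H ?V S - (W \<inter> ?V) = nbs H ?V S - W" by (auto simp: nbs_def)
          ultimately show ?thesis using n by simp
        qed
        show "?k + 2 + real w \<le> real (card ?V)" using cV(2) wb n an kn by linarith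
        show "0 < p / 2" using p by simp
        show "0 < b" using b2 a n0 k0 by (metis divide_pos_pos less_le_trans mult_pos_pos of_nat_0_less_iff zero_less_numeral order_less_le_trans)
        show "2 * k * m \<le> g"
          unfolding g_def using mb(1) k0 by (intro nat_le_floor) (simp add: field_simps)
        show "real g * real (card ?V) < p / 2 * real b * real b"
        proof -
          have "real g * real (card ?V) \<le> \<gamma> * real n * (?k * real n)"
            unfolding cV(2) using gb n0 k0 by (intro mult_right_mono) auto
          also have "\<dots> < p / 2 * ((a * real n / (16 * ?k)) * (a * real n / (16 * ?k)))"
            unfolding \<gamma>_def using p a n0 k0 by (simp add: field_simps power2_eq_square power3_eq_cube)
          also have "\<dots> \<le> p / 2 * (real b * real b)"
            using b2 p a n0 k0 by (intro mult_left_mono mult_mono) auto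
          finally show ?thesis by (simp add: mult.assoc)
        qed
        show "k * b + k * b \<le> w"
          unfolding w_def using bb(1) k0 by (intro nat_le_floor) (simp add: field_simps)
      qed simp
    qed (use k in auto)
  qed
  then show ?thesis using q by blast
qed

text \<open>There are only polynomially many neighbourhoods. Each meets at least \<open>h\<close>,
  about \<open>a * n / (k - 1)\<close>, of the blocks of length \<open>k - 1\<close>, so its failure
  bound is of order \<open>exp (\<sigma> * n) * exp (- 4 * \<sigma> * n)\<close>; \<sigma> is chosen
  so that the gain \<open>h / (2 * (k - 1))\<close> is about
  \<open>4 * \<sigma> * n\<close>.\<close>

lemma joints_exist:
  assumes k: "k \<ge> 3" and a: "0 < a"
  defines "\<sigma> \<equiv> a / (8 * real (k - 1) ^ 2)"
  shows "\<forall>\<^sub>F n in sequentially. \<forall>H.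
     (\<forall>S\<subseteq>{1..(k - 1) * n}. card S = k - 1 \<longrightarrow> a * real n \<le> real (card (nbs H {1..(k - 1) * n} S))) \<longrightarrow>
     (\<exists>X\<subseteq>{1..(k - 1) * n}. card X = n \<and> (\<forall>S\<subseteq>{1..(k - 1) * n}. card S = k - 1 \<longrightarrow>
        nat \<lfloor>\<sigma> * real n\<rfloor> \<le> card (nbs H {1..(k - 1) * n} S \<inter> X) \<and>
        nat \<lfloor>\<sigma> * real n\<rfloor> \<le> card (nbs H {1..(k - 1) * n} S - X)))"
proof -
  define r where "r = k - 1"
  have r2: "r \<ge> 2" using k by (simp add: r_def)
  have \<sigma>: "0 < \<sigma>" unfolding \<sigma>_def using a r2 by (simp add: r_def)
  have "((\<lambda>n. 2 * real r ^ r * exp 1 * (real n ^ r * exp (- (3 * \<sigma>) * real n))) \<longlongrightarrow> 0) sequentially"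
    using \<sigma> by real_asymp
  then have "\<forall>\<^sub>F n in sequentially. 2 * real r ^ r * exp 1 * (real n ^ r * exp (- (3 * \<sigma>) * real n)) < 1"
    by (rule order_tendstoD) simp
  then show ?thesis
    unfolding r_def[symmetric]
  proof (eventually_elim, intro allI impI)
    fix n H
    assume small: "2 * real r ^ r * exp 1 * (real n ^ r * exp (- (3 * \<sigma>) * real n)) < 1"
      and cod: "\<forall>S\<subseteq>{1..r * n}. card S = r \<longrightarrow> a * real n \<le> real (card (nbs H {1..r * n} S))"
    let ?V = "{1..r * n}"
    define \<S> where "\<S> = {S. S \<subseteq> ?V \<and> card S = r}"
    define s where "s = nat \<lfloor>\<sigma> * real n\<rfloor>"
    define h where "h = nat \<lfloor>a * real n / real r\<rfloor>"
    have f\<S>: "finite \<S>" unfolding \<S>_def by (rule finite_subset[of _ "Pow ?V"]) auto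
    have "card \<S> = (r * n) choose r" unfolding \<S>_def by (simp add: n_subsets)
    also have "\<dots> \<le> (r * n) ^ r" by (rule le_trans[OF _ binomial_fact_pow]) simp
    finally have "card (nbs H ?V ` \<S>) \<le> (r * n) ^ r" using card_image_le[OF f\<S>, of "nbs H ?V"] by linarith
    then have cA: "real (card (nbs H ?V ` \<S>)) \<le> real r ^ r * real n ^ r"
      by (metis of_nat_le_iff of_nat_mult of_nat_power power_mult_distrib)
    have sb: "real s \<le> \<sigma> * real n" unfolding s_def using \<sigma> by (intro floor_bounds) simp
    have hb: "real h \<le> a * real n / real r" "a * real n / real r - 1 \<le> real h"
      unfolding h_def using a by (intro floor_bounds; simp)+
    have "(2::real) ^ s \<le> exp 1 ^ s" using exp_ge_add_one_self[of 1] by (intro power_mono) auto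
    also have "\<dots> = exp (real s)" by (simp flip: exp_of_nat_mult)
    also have "\<dots> \<le> exp (\<sigma> * real n)" using sb by simp
    finally have p1: "(2::real) ^ s \<le> exp (\<sigma> * real n)" .
    have q0: "0 \<le> 1 - 1 / (2 * real r)" using r2 by (simp add: field_simps)
    have "(1 - 1 / (2 * real r)) ^ h \<le> exp (- 1 / (2 * real r)) ^ h"
      using exp_ge_add_one_self[of "- 1 / (2 * real r)"] q0 by (intro power_mono) auto
    also have "\<dots> = exp (- (real h / (2 * real r)))" by (simp flip: exp_of_nat_mult)
    also have "\<dots> \<le> exp (1 - 4 * \<sigma> * real n)"
    proof -
      have "(a * real n / real r - 1) / (2 * real r) \<le> real h / (2 * real r)"
        using hb(2) by (intro divide_right_mono) auto
      moreover have "(a * real n / real r - 1) / (2 * real r) = 4 * \<sigma> * real n - 1 / (2 * real r)"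
        unfolding \<sigma>_def r_def[symmetric] using r2 by (simp add: field_simps power2_eq_square)
      moreover have "1 / (2 * real r) \<le> 1" using r2 by (simp add: field_simps)
      ultimately show ?thesis by simp
    qed
    finally have p2: "(1 - 1 / (2 * real r)) ^ h \<le> exp (1 - 4 * \<sigma> * real n)" .
    have "2 ^ s * (1 - 1 / (2 * real r)) ^ h \<le> exp (\<sigma> * real n) * exp (1 - 4 * \<sigma> * real n)"
      using p1 p2 q0 by (intro mult_mono) auto
    also have "\<dots> = exp 1 * exp (- (3 * \<sigma>) * real n)"
      by (simp add: exp_add[symmetric] algebra_simps)
    finally have p3: "2 ^ s * (1 - 1 / (2 * real r)) ^ h \<le> exp 1 * exp (- (3 * \<sigma>) * real n)" .
    have "2 * real (card (nbs H ?V ` \<S>)) * (2 ^ s * (1 - 1 / (2 * real r)) ^ h)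
        \<le> 2 * (real r ^ r * real n ^ r) * (exp 1 * exp (- (3 * \<sigma>) * real n))"
      by (rule mult_mono[OF _ p3]) (use cA q0 in auto)
    also have "\<dots> < 1" using small by (simp add: algebra_simps)
    finally have sm: "2 * real (card (nbs H ?V ` \<S>)) * (2 ^ s * (1 - 1 / (2 * real r)) ^ h) < 1" .
    have AA: "A \<subseteq> ?V \<and> r * h \<le> card A" if A: "A \<in> nbs H ?V ` \<S>" for A
    proof -
      obtain S where S: "S \<subseteq> ?V" "card S = r" "A = nbs H ?V S" using A by (auto simp: \<S>_def)
      have "real r * real h \<le> a * real n" using hb(1) r2 by (simp add: field_simps)
      also have "\<dots> \<le> real (card A)" using cod S by blast
      finally have "real (r * h) \<le> real (card A)" by simp
      then show ?thesis using S(3) by (simp add: nbs_def subset_iff del: of_nat_mult)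
    qed
    obtain X where X: "X \<subseteq> ?V" "card X = n"
      "\<And>A. A \<in> nbs H ?V ` \<S> \<Longrightarrow> s \<le> card (A \<inter> X) \<and> s \<le> card (A - X)"
      using exists_joints[OF r2 finite_imageI[OF f\<S>] AA sm] by blast
    show "\<exists>X\<subseteq>?V. card X = n \<and> (\<forall>S\<subseteq>?V. card S = r \<longrightarrow>
        nat \<lfloor>\<sigma> * real n\<rfloor> \<le> card (nbs H ?V S \<inter> X) \<and> nat \<lfloor>\<sigma> * real n\<rfloor> \<le> card (nbs H ?V S - X))"
      using X unfolding s_def[symmetric] \<S>_def by blast
  qed
qed

lemma hamilton_hits_suffice:
  assumes k: "k \<ge> 3" and a: "0 < a" "a \<le> 1"
  shows "\<exists>q C. 0 < q \<and> q \<le> 1 \<and> (\<forall>\<^sub>F n in sequentially. \<forall>H. uniform_hypergraph k {1..(k - 1) * n} H \<longrightarrow>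
     (\<forall>S\<subseteq>{1..(k - 1) * n}. card S = k - 1 \<longrightarrow> a * real n \<le> real (card (nbs H {1..(k - 1) * n} S))) \<longrightarrow>
     hits_suffice q C k n ((k - 1) * n) (\<lambda>R. has_loose_Hamilton_cycle k {1..(k - 1) * n} (H \<union> R)))"
proof -
  let ?k = "real k"
  define \<sigma> where "\<sigma> = a / (8 * real (k - 1) ^ 2)"
  \<comment> \<open>Halving \<sigma> absorbs the rounding and the four joints removed below, so that
    \<open>A0 \<ge> \<theta> * n\<close>.\<close>
  define \<theta> where "\<theta> = \<sigma> / 2"
  define p where "p = (\<theta> / (4 * ?k)) ^ k"
  \<comment> \<open>As for matchings, but with up to \<open>4 * card V\<close> indices and
    \<open>b = s \<ge> \<theta> * n / (32 * k)\<close>; again a factor 2 is spare.\<close>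
  define \<gamma> where "\<gamma> = p / 2 * \<theta> ^ 2 / (8192 * ?k ^ 3)"
  define q where "q = min (p / 2) ((\<gamma> / (8 * ?k ^ 2)) ^ k)"
  define C where "C = 5 * ?k + ?k ^ 2"
  have k0: "?k \<ge> 3" using k by simp
  have km: "real (k - 1) = ?k - 1" using k by (simp add: of_nat_diff)
  have \<sigma>: "0 < \<sigma>" "\<sigma> \<le> 1"
  proof -
    have "(2::real) ^ 2 \<le> real (k - 1) ^ 2" using k by (intro power_mono) auto
    then have "a \<le> 8 * real (k - 1) ^ 2" using a by simp
    then show "0 < \<sigma>" "\<sigma> \<le> 1" using a k by (simp_all add: \<sigma>_def divide_le_eq)
  qed
  have \<theta>: "0 < \<theta>" "\<theta> \<le> 1" using \<sigma> by (simp_all add: \<theta>_def)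
  have "\<theta> / (4 * ?k) \<le> 1" using \<theta> k0 by (simp add: divide_le_eq)
  then have p: "0 < p" "p \<le> 1" unfolding p_def using \<theta> k0 by (simp_all add: power_le_one)
  have \<gamma>: "0 < \<gamma>" unfolding \<gamma>_def using p \<theta> k0 by simp
  have \<gamma>\<theta>: "\<gamma> \<le> \<theta> / 64"
  proof -
    have "(1::real) \<le> ?k ^ 3" using k0 by (intro one_le_power) simp
    have "p / 2 * \<theta> ^ 2 \<le> 1 * \<theta>"
      using p \<theta> by (intro mult_mono) (auto simp: power2_eq_square mult_le_cancel_left1)
    also have "\<dots> \<le> \<theta> / 64 * (8192 * ?k ^ 3)"
      using \<open>1 \<le> ?k ^ 3\<close> \<theta> mult_left_mono[of 1 "128 * ?k ^ 3" \<theta>] by simp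
    finally show ?thesis unfolding \<gamma>_def using k0 by (simp add: divide_le_eq)
  qed
  have q: "0 < q" "q \<le> 1" unfolding q_def using p \<gamma> k0 by auto
  have e1: "\<forall>\<^sub>F n in sequentially. 64 * ?k + 512 \<le> \<theta> * real n" by (rule eventually_le_linear[OF \<theta>(1)])
  have e2: "\<forall>\<^sub>F n in sequentially. 32 * ?k \<le> \<gamma> * real n" by (rule eventually_le_linear[OF \<gamma>])
  have "\<forall>\<^sub>F n in sequentially. \<forall>H. uniform_hypergraph k {1..(k - 1) * n} H \<longrightarrow>
     (\<forall>S\<subseteq>{1..(k - 1) * n}. card S = k - 1 \<longrightarrow> a * real n \<le> real (card (nbs H {1..(k - 1) * n} S))) \<longrightarrow>
     hits_suffice q C k n ((k - 1) * n) (\<lambda>R. has_loose_Hamilton_cycle k {1..(k - 1) * n} (H \<union> R))"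
    using e1 e2 joints_exist[OF k a(1)]
  proof (eventually_elim, intro allI impI)
    fix n H
    let ?V = "{1..(k - 1) * n}"
    assume n: "64 * ?k + 512 \<le> \<theta> * real n" "32 * ?k \<le> \<gamma> * real n"
      and H: "uniform_hypergraph k ?V H"
      and cod: "\<forall>S\<subseteq>?V. card S = k - 1 \<longrightarrow> a * real n \<le> real (card (nbs H ?V S))"
      and ex: "\<forall>H. (\<forall>S\<subseteq>?V. card S = k - 1 \<longrightarrow> a * real n \<le> real (card (nbs H ?V S))) \<longrightarrow>
         (\<exists>X\<subseteq>?V. card X = n \<and> (\<forall>S\<subseteq>?V. card S = k - 1 \<longrightarrow>
         nat \<lfloor>a / (8 * real (k - 1) ^ 2) * real n\<rfloor> \<le> card (nbs H ?V S \<inter> X) \<and>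
         nat \<lfloor>a / (8 * real (k - 1) ^ 2) * real n\<rfloor> \<le> card (nbs H ?V S - X)))"
    obtain X1 where X1: "X1 \<subseteq> ?V" "card X1 = n"
      "\<And>S. S \<subseteq> ?V \<Longrightarrow> card S = k - 1 \<Longrightarrow> nat \<lfloor>\<sigma> * real n\<rfloor> \<le> card (nbs H ?V S \<inter> X1) \<and> nat \<lfloor>\<sigma> * real n\<rfloor> \<le> card (nbs H ?V S - X1)"
      using ex[rule_format, OF cod[rule_format]] unfolding \<sigma>_def by blast
    have n\<theta>: "\<theta> * real n \<le> real n" using \<theta> mult_right_mono[of \<theta> 1 "real n"] by simp
    have n0: "real n > 0" using n\<theta> n(1) k0 by linarith
    have n8: "8 \<le> n" using n\<theta> n(1) k0 by linarith
    \<comment> \<open>The random construction yields \<open>n\<close> joints, one for each block;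
      four are given up because closing the gadgets creates four new ones.\<close>
    obtain T where T: "T \<subseteq> X1" "card T = 4" using obtain_subset_with_card_n[of 4 X1] X1(2) n8 by (metis le_trans numeral_le_iff semiring_norm(68) semiring_norm(71))
    have fX1: "finite X1" using X1(1) finite_subset by blast
    have fT: "finite T" using T fX1 finite_subset by blast
    define X where "X = X1 - T"
    have X: "X \<subseteq> ?V" "card X + 4 = n"
      using X1 T fT n8 by (auto simp: X_def card_Diff_subset)
    define A0 where "A0 = nat \<lfloor>\<sigma> * real n\<rfloor> - 4"
    define w where "w = nat \<lfloor>\<theta> * real n / 2\<rfloor>"
    define b where "b = nat \<lfloor>\<theta> * real n / (16 * ?k)\<rfloor>"
    define g where "g = nat \<lfloor>\<gamma> * real n\<rfloor>"
    define m where "m = nat \<lfloor>\<gamma> * real n / (4 * ?k)\<rfloor>"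
    have Ab: "\<theta> * real n \<le> real A0"
    proof -
      have "\<sigma> * real n - 1 \<le> real (nat \<lfloor>\<sigma> * real n\<rfloor>)" using \<sigma> n0 by (intro floor_bounds) simp
      moreover have "\<sigma> * real n = 2 * (\<theta> * real n)" by (simp add: \<theta>_def)
      ultimately show ?thesis unfolding A0_def using n(1) k0 by linarith
    qed
    have wb: "real w \<le> \<theta> * real n / 2" "\<theta> * real n / 2 - 1 \<le> real w"
      unfolding w_def using \<theta> n0 by (intro floor_bounds; simp)+
    have bb: "real b \<le> \<theta> * real n / (16 * ?k)" "\<theta> * real n / (16 * ?k) - 1 \<le> real b"
      unfolding b_def using \<theta> n0 k0 by (intro floor_bounds; simp)+
    have gb: "real g \<le> \<gamma> * real n" "\<gamma> * real n - 1 \<le> real g"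
      unfolding g_def using \<gamma> n0 by (intro floor_bounds; simp)+
    have mb: "real m \<le> \<gamma> * real n / (4 * ?k)" "\<gamma> * real n / (4 * ?k) - 1 \<le> real m"
      unfolding m_def using \<gamma> n0 k0 by (intro floor_bounds; simp)+
    have b2: "\<theta> * real n / (32 * ?k) \<le> real b"
    proof -
      have "1 \<le> \<theta> * real n / (32 * ?k)" using n(1) k0 by (simp add: le_divide_eq)
      moreover have "\<theta> * real n / (16 * ?k) = 2 * (\<theta> * real n / (32 * ?k))" by simp
      ultimately show ?thesis using bb(2) by linarith
    qed
    have m2: "\<gamma> * real n / (8 * ?k) \<le> real m"
    proof -
      have "1 \<le> \<gamma> * real n / (8 * ?k)" using n(2) k0 by (simp add: le_divide_eq)
      moreover have "\<gamma> * real n / (4 * ?k) = 2 * (\<gamma> * real n / (8 * ?k))" by simp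
      ultimately show ?thesis using mb(2) by linarith
    qed
    have kb: "?k * real b \<le> \<theta> * real n / 16" using bb(1) k0 by (simp add: le_divide_eq field_simps)
    have kmm: "?k * real m \<le> \<gamma> * real n / 4" using mb(1) k0 by (simp add: le_divide_eq field_simps)
    have codeg: "A0 \<le> card (nbs H ?V S \<inter> X) \<and> A0 \<le> card (nbs H ?V S - X)" if "S \<subseteq> ?V" "card S = k - 1" for S
    proof
      have fN: "finite (nbs H ?V S)" by (simp add: nbs_def)
      have "nbs H ?V S \<inter> X = nbs H ?V S \<inter> X1 - T" by (auto simp: X_def)
      then have "card (nbs H ?V S \<inter> X1) - 4 \<le> card (nbs H ?V S \<inter> X)"
        using diff_card_le_card_Diff[OF fT, of "nbs H ?V S \<inter> X1"] T(2) by simp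
      then show "A0 \<le> card (nbs H ?V S \<inter> X)" unfolding A0_def using X1(3)[OF that] by linarith
      have "card (nbs H ?V S - X1) \<le> card (nbs H ?V S - X)"
        using fN by (intro card_mono) (auto simp: X_def)
      then show "A0 \<le> card (nbs H ?V S - X)" unfolding A0_def using X1(3)[OF that] by linarith
    qed
    have HK: "H \<subseteq> ksets k ?V" using H by (auto simp: uniform_hypergraph_def ksets_def)
    have cV: "card ?V = (k - 1) * n" by simp
    have fX: "finite X" using X(1) finite_subset by blast
    have "4 \<le> card X" using X(2) n8 by linarith
    then obtain U where U: "U \<subseteq> X" "card U = 4" by (meson obtain_subset_with_card_n)
    have "finite U" using U fX finite_subset by blast
    then obtain uu where uu: "bij_betw uu {..<4::nat} U"
      using ex_bij_betw_nat_finite[of U] U(2) by (auto simp: atLeast0LessThan)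
    have cVX: "4 * (k - 2) \<le> card (?V - X)"
    proof -
      have "card (?V - X) = (k - 1) * n - card X" using X(1) fX by (simp add: card_Diff_subset)
      moreover have "(k - 1) * n = (k - 2) * n + n"
      proof -
        have "k - 1 = (k - 2) + 1" using k by simp
        then show ?thesis by simp
      qed
      moreover have "(k - 2) * 4 \<le> (k - 2) * n" using n8 by (intro mult_le_mono2) simp
      ultimately show ?thesis using X(2) by linarith
    qed
    obtain Kf where Kf: "\<forall>i\<in>{..<4::nat}. Kf i \<subseteq> ?V - X \<and> card (Kf i) = k - 2" "disjoint_family_on Kf {..<4}"
    proof -
      have "\<exists>D. (\<forall>i\<in>{..<4::nat}. D i \<subseteq> ?V - X \<and> card (D i) = k - 2) \<and> disjoint_family_on D {..<4}"
        by (rule disjoint_choice[where t = 4]) (use cVX in simp_all)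
      then show ?thesis using that by blast
    qed
    define F where "F = (\<lambda>(i, v). swap_family k H (pos_domain k ?V X (nbs H ?V (insert (uu i) (Kf i)))) v)"
    let ?Idx = "{..<4::nat} \<times> (?V - X)"
    have uX: "uu i \<in> X" if "i < 4" for i using uu U that by (auto simp: bij_betw_def)
    have S: "insert (uu i) (Kf i) \<subseteq> ?V" "card (insert (uu i) (Kf i)) = k - 1" if "i < 4" for i
    proof -
      have Ki: "Kf i \<subseteq> ?V - X" "card (Kf i) = k - 2" using Kf(1) that by auto
      then have "finite (Kf i)" "uu i \<notin> Kf i" using uX[OF that] finite_subset by blast+
      then show "card (insert (uu i) (Kf i)) = k - 1" using Ki k by simp
      show "insert (uu i) (Kf i) \<subseteq> ?V" using Ki uX[OF that] X(1) by blast
    qed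
    have AX: "A0 \<le> card X" "A0 \<le> card (?V - X)"
    proof -
      note c = codeg[OF S[of 0]]
      have "card (nbs H ?V (insert (uu 0) (Kf 0)) \<inter> X) \<le> card X" using fX by (intro card_mono) auto
      then show "A0 \<le> card X" using c by simp
      have "card (nbs H ?V (insert (uu 0) (Kf 0)) - X) \<le> card (?V - X)" by (intro card_mono) (auto simp: nbs_def)
      then show "A0 \<le> card (?V - X)" using c by simp
    qed
    have posV: "pos_domain k ?V X (nbs H ?V T) j \<subseteq> ?V" for T j
      using X(1) by (auto simp: pos_domain_def nbs_def)
    show "hits_suffice q C k n ((k - 1) * n) (\<lambda>R. has_loose_Hamilton_cycle k ?V (H \<union> R))"
    proof (rule hits_sufficeI[where Idx = ?Idx and F = F and w = w and p = p and r = "real m"])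
      show "1 \<le> (k - 1) * n" using k n8 by simp
      show "1 \<le> k" using k by simp
      show "0 \<le> p" using p by simp
      show "F i \<subseteq> ksets k ?V" if "i \<in> ?Idx" for i
        unfolding F_def case_prod_beta by (rule swap_family_ksets) (rule posV)
      show "p * real ((k - 1) * n choose k) \<le> real (card {f \<in> F i. f \<inter> W = {}})"
        if i: "i \<in> ?Idx" and W: "W \<subseteq> ?V" "card W \<le> w" for i W
      proof -
        have fW: "finite W" using W finite_subset by blast
        obtain j v where jv: "i = (j, v)" "j < 4" "v \<in> ?V" "v \<notin> X" using i by auto
        let ?D = "pos_domain k ?V X (nbs H ?V (insert (uu j) (Kf j)))"
        have cut: "\<theta> * real n / 4 + ?k + 1 \<le> real (card (B - W))" if "A0 \<le> card B" for B
        proof -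
          have "real (card B) - real (card W) \<le> real (card (B - W))"
            using diff_card_le_card_Diff[OF fW, of B] by linarith
          moreover have "real A0 \<le> real (card B)" using that by simp
          moreover have "real (card W) \<le> \<theta> * real n / 2" using W(2) wb(1) by linarith
          ultimately show ?thesis using Ab n(1) k0 by linarith
        qed
        have "(\<theta> * real n / 4 / real (card ?V)) ^ k * real (card ?V choose k)
          \<le> real (card {f \<in> swap_family k H ?D v. f \<inter> W = {}})"
        proof (rule swap_family_dense(1)[OF _ _ _ jv(3)])
          show "?D l \<subseteq> ?V" for l by (rule posV)
          show "0 \<le> \<theta> * real n / 4" using \<theta> by simp
          show "\<theta> * real n / 4 + ?k + 1 \<le> real (card (?D l - W))" if "l < k - 1" for l
          proof (rule cut)
            show "A0 \<le> card (?D l)" using codeg[OF S[OF jv(2)]] AX by (simp add: pos_domain_def)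
          qed
          fix B assume B: "B \<subseteq> ?V" "card B = k - 1"
          have "?D (k - 1) = X" using k by (simp add: pos_domain_def)
          then have eq: "?D (k - 1) \<inter> nbs H ?V B = nbs H ?V B \<inter> X" by blast
          show "\<theta> * real n / 4 + ?k + 1 \<le> real (card (?D (k - 1) \<inter> nbs H ?V B - W))"
            unfolding eq using codeg[OF B] by (intro cut) simp
        qed (use k in auto)
        moreover have "p \<le> (\<theta> * real n / 4 / real (card ?V)) ^ k"
        proof -
          have x1: "real (card ?V) \<le> ?k * real n" using n0 by (simp add: km)
          have x2: "0 < real (card ?V)" using n0 k by (simp add: km)
          have "\<theta> * real n / 4 / (?k * real n) \<le> \<theta> * real n / 4 / real (card ?V)"
            by (rule frac_le[OF _ order_refl x2 x1]) (use \<theta> in simp)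
          moreover have "\<theta> * real n / 4 / (?k * real n) = \<theta> / (4 * ?k)" using n0 by simp
          ultimately show ?thesis unfolding p_def using \<theta> k0 by (intro power_mono) auto
        qed
        then have "p * real (card ?V choose k) \<le> (\<theta> * real n / 4 / real (card ?V)) ^ k * real (card ?V choose k)"
          by (intro mult_right_mono) auto
        ultimately show ?thesis unfolding F_def jv(1) cV by simp
      qed
      show "q \<le> p / 2" by (simp add: q_def)
      show "q \<le> (real m / real ((k - 1) * n)) ^ k"
      proof -
        have "\<gamma> / (8 * ?k ^ 2) = \<gamma> * real n / (8 * ?k) / (?k * real n)"
          using n0 k0 by (simp add: field_simps power2_eq_square)
        also have "\<dots> \<le> real m / (?k * real n)" using m2 n0 by (intro divide_right_mono) auto
        also have "\<dots> \<le> real m / real ((k - 1) * n)"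
          by (intro frac_le) (use n0 k in \<open>simp_all add: km\<close>)
        finally have "(\<gamma> / (8 * ?k ^ 2)) ^ k \<le> (real m / real ((k - 1) * n)) ^ k"
          using \<gamma> k0 by (intro power_mono) auto
        then show ?thesis by (simp add: q_def)
      qed
      show "real ((k - 1) * n + card ?Idx + (k - 1) * n * k) \<le> C * real n"
      proof -
        have "card (?V - X) \<le> (k - 1) * n" using card_mono[of ?V "?V - X"] by simp
        then have "card ?Idx \<le> 4 * ((k - 1) * n)" by (simp add: card_cartesian_product)
        moreover have "(k - 1) * n \<le> k * n" by simp
        ultimately have "(k - 1) * n + card ?Idx + (k - 1) * n * k \<le> 5 * (k * n) + k * n * k"
          by (intro add_mono mult_right_mono) linarith+
        then have "real ((k - 1) * n + card ?Idx + (k - 1) * n * k) \<le> real (5 * (k * n) + k * n * k)"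
          by (rule of_nat_mono)
        also have "\<dots> = C * real n" by (simp add: C_def algebra_simps power2_eq_square)
        finally show ?thesis .
      qed
      fix R assume R: "R \<subseteq> ksets k ?V" "has_transversals k (real m) ?V R" "spreads (p / 2) w ?V ?Idx F R"
      show "has_loose_Hamilton_cycle k ?V (H \<union> R)"
      proof (rule hamilton_of_hits[OF k _ cV HK R(1) X codeg _ uX Kf(2) _ R(2) R(3)[unfolded F_def]])
        show "inj_on uu {..<4}" using uu by (simp add: bij_betw_def)
        show "Kf i \<subseteq> ?V - X \<and> card (Kf i) = k - 2" if "i < 4" for i using Kf(1) that by simp
        show "0 < p / 2" using p by simp
        have "0 < \<theta> * real n / (32 * ?k)" using \<theta> n0 k0 by simp
        then show "0 < b" using b2 by linarith
        show "(k - 2) * (m + 2) + 2 * k * m \<le> g"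
        proof -
          have "(k - 2) * (m + 2) \<le> k * (m + 2)" by (intro mult_right_mono) auto
          then have "(k - 2) * (m + 2) + 2 * k * m \<le> 3 * (k * m) + 2 * k" by (simp add: algebra_simps)
          then have "real ((k - 2) * (m + 2) + 2 * k * m) \<le> real (3 * (k * m) + 2 * k)" by (rule of_nat_mono)
          also have "\<dots> = 3 * (?k * real m) + 2 * ?k" by simp
          also have "\<dots> \<le> \<gamma> * real n" using kmm n(2) by linarith
          finally show ?thesis unfolding g_def by (rule nat_le_floor)
        qed
        show "real g * (4 * real (card ?V)) < p / 2 * real b * real b"
        proof -
          have "real g * (4 * real (card ?V)) \<le> \<gamma> * real n * (4 * (?k * real n))"
            using gb(1) \<gamma> n0 by (intro mult_mono) (auto simp: km)
          also have "\<dots> < p / 2 * ((\<theta> * real n / (32 * ?k)) * (\<theta> * real n / (32 * ?k)))"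
            unfolding \<gamma>_def using p \<theta> n0 k0 by (simp add: field_simps power2_eq_square power3_eq_cube)
          also have "\<dots> \<le> p / 2 * (real b * real b)"
            using b2 p \<theta> n0 k0 by (intro mult_left_mono mult_mono) auto
          finally show ?thesis by (simp add: mult.assoc)
        qed
        show "k * b + k * b + 4 * k \<le> w"
        proof -
          have "real (k * b + k * b + 4 * k) = 2 * (?k * real b) + 4 * ?k" by simp
          also have "\<dots> \<le> \<theta> * real n / 2" using kb n(1) k0 by linarith
          finally have "real (k * b + k * b + 4 * k) \<le> \<theta> * real n / 2" .
          then show ?thesis unfolding w_def by (rule nat_le_floor)
        qed
        show "w + k + 2 \<le> A0"
        proof -
          have "real (w + k + 2) \<le> real A0" using wb(1) Ab n(1) k0 unfolding of_nat_add of_nat_numeral by linarith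
          then show ?thesis by linarith
        qed
        show "2 * m + 6 * (b + b + m + 4) + 1 \<le> A0"
        proof -
          have "3 * real b \<le> ?k * real b" "3 * real m \<le> ?k * real m" using k0 by (intro mult_right_mono; simp)+
          then have "real b \<le> \<theta> * real n / 48" "real m \<le> \<gamma> * real n / 12" using kb kmm by linarith+
          moreover have "\<gamma> * real n \<le> \<theta> * real n / 64" using mult_right_mono[OF \<gamma>\<theta>, of "real n"] by simp
          ultimately have "real (2 * m + 6 * (b + b + m + 4) + 1) \<le> real A0"
            using Ab n(1) k0 unfolding of_nat_add of_nat_mult of_nat_numeral of_nat_1 distrib_left by linarith
          then show ?thesis by linarith
        qed
      qed simp_all
    qed simp_all
  qed
  then show ?thesis using q by blast
qed

text \<open>Only transversals are needed here, so the index set of the spread property is empty. The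
  choice of \<open>m\<close> at most \<open>a * n / 16\<close> makes \<open>8 * m + 13\<close> at
  most \<open>a * n\<close>, and \<open>a / 32\<close> is what remains of \<open>m / n\<close> after
  rounding.\<close>

lemma hamilton_hits_suffice_graph:
  assumes a: "0 < a" "a \<le> 1"
  shows "\<exists>q C. 0 < q \<and> q \<le> 1 \<and> (\<forall>\<^sub>F n in sequentially. \<forall>H.
     (\<forall>S\<subseteq>{1..n}. card S = 1 \<longrightarrow> a * real n \<le> real (card (nbs H {1..n} S))) \<longrightarrow>
     hits_suffice q C 2 n n (\<lambda>R. has_loose_Hamilton_cycle 2 {1..n} (H \<union> R)))"
proof -
  define q where "q = (a / 32) ^ 2"
  have "a / 32 \<le> 1 / 32" using a by simp
  then have q: "0 < q" "q \<le> 1 / 2" "q \<le> 1" using a power_mono[of "a / 32" "1 / 32" 2]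
    by (simp_all add: q_def power2_eq_square)
  have e1: "\<forall>\<^sub>F n in sequentially. 64 \<le> a * real n" by (rule eventually_le_linear[OF a(1)])
  have "\<forall>\<^sub>F n in sequentially. \<forall>H.
     (\<forall>S\<subseteq>{1..n}. card S = 1 \<longrightarrow> a * real n \<le> real (card (nbs H {1..n} S))) \<longrightarrow>
     hits_suffice q 3 2 n n (\<lambda>R. has_loose_Hamilton_cycle 2 {1..n} (H \<union> R))"
    using e1
  proof (eventually_elim, intro allI impI)
    fix n H
    assume n: "64 \<le> a * real n"
      and cod: "\<forall>S\<subseteq>{1..n}. card S = 1 \<longrightarrow> a * real n \<le> real (card (nbs H {1..n} S))"
    have an: "a * real n \<le> real n" using a mult_right_mono[of a 1 "real n"] by simp
    have n3: "3 \<le> n" using n an by linarith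
    define m where "m = nat \<lfloor>a * real n / 16\<rfloor>"
    have mb: "real m \<le> a * real n / 16" "a * real n / 16 - 1 \<le> real m"
      unfolding m_def using a by (intro floor_bounds; simp)+
    show "hits_suffice q 3 2 n n (\<lambda>R. has_loose_Hamilton_cycle 2 {1..n} (H \<union> R))"
    proof (rule hits_sufficeI[where Idx = "{} :: nat set" and F = "\<lambda>_. {}" and w = 0 and p = 1 and r = "real m"])
      show "q \<le> (real m / real n) ^ 2"
      proof -
        have "a * real n / 32 \<le> real m" using mb n by linarith
        then have "a / 32 \<le> real m / real n" using n3 by (simp add: le_divide_eq)
        then show ?thesis unfolding q_def using a by (intro power_mono) auto
      qed
      fix R :: "nat set set" assume R: "has_transversals 2 (real m) {1..n} R"
      show "has_loose_Hamilton_cycle 2 {1..n} (H \<union> R)"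
      proof (rule hamilton_of_hits_graph[OF _ _ _ R, where ?A0.0 = "8 * m + 13"])
        fix S assume "S \<subseteq> {1..n}" "card S = 1"
        then have "a * real n \<le> real (card (nbs H {1..n} S))" using cod by blast
        moreover have "real (8 * m + 13) \<le> a * real n" using mb(1) n by simp
        ultimately show "8 * m + 13 \<le> card (nbs H {1..n} S)" by linarith
      qed (use n3 in auto)
    qed (use n3 q in auto)
  qed
  then show ?thesis using q by blast
qed

theorem theorem1:
  fixes k :: nat and \<alpha> :: real
  assumes "k \<ge> 2" and "\<alpha> > 0"
  shows "\<exists>c::real. c > 0 \<and>
    (\<forall>H :: nat \<Rightarrow> nat set set.
      (\<forall>\<^sub>F n in sequentially. uniform_hypergraph k {1..k * n} (H n) \<and>
         real (min_degree (k - 1) {1..k * n} (H n)) \<ge> \<alpha> * real n) \<longrightarrow>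
      (\<lambda>n. measure_pmf.prob (random_hypergraph k (k * n) (nat \<lfloor>c * real n\<rfloor>))
         {R. has_perfect_matching {1..k * n} (H n \<union> R)}) \<longlonglongrightarrow> 1) \<and>
    (\<forall>H :: nat \<Rightarrow> nat set set.
      (\<forall>\<^sub>F n in sequentially. uniform_hypergraph k {1..(k - 1) * n} (H n) \<and>
         real (min_degree (k - 1) {1..(k - 1) * n} (H n)) \<ge> \<alpha> * real n) \<longrightarrow>
      (\<lambda>n. measure_pmf.prob (random_hypergraph k ((k - 1) * n) (nat \<lfloor>c * real n\<rfloor>))
         {R. has_loose_Hamilton_cycle k {1..(k - 1) * n} (H n \<union> R)}) \<longlonglongrightarrow> 1)"
proof -
  \<comment> \<open>The estimates use \<open>a * n \<le> n\<close>; a large \<alpha> may be lowered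
    since this only weakens the codegree condition.\<close>
  define a where "a = min \<alpha> 1"
  have a: "0 < a" "a \<le> 1" "a \<le> \<alpha>" using assms(2) by (simp_all add: a_def)
  have cod: "a * real n \<le> real (card (nbs H {1..N} S))"
    if "uniform_hypergraph k {1..N} H" "real (min_degree (k - 1) {1..N} H) \<ge> \<alpha> * real n" "S \<subseteq> {1..N}" "card S = k - 1"
    for n N S and H :: "nat set set"
  proof -
    have "a * real n \<le> \<alpha> * real n" using a by (intro mult_right_mono) auto
    also have "\<dots> \<le> real (min_degree (k - 1) {1..N} H)" by (rule that(2))
    also have "\<dots> \<le> real (card (nbs H {1..N} S))"
      using codegree_nbs[OF that(1) _ _ that(3,4)] assms(1) by simp
    finally show ?thesis .
  qed
  obtain q1 C1 where 1: "0 < q1" "q1 \<le> 1" "\<forall>\<^sub>F n in sequentially. \<forall>H. uniform_hypergraph k {1..k * n} H \<longrightarrow>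
     (\<forall>S\<subseteq>{1..k * n}. card S = k - 1 \<longrightarrow> a * real n \<le> real (card (nbs H {1..k * n} S))) \<longrightarrow>
     hits_suffice q1 C1 k n (k * n) (\<lambda>R. has_perfect_matching {1..k * n} (H \<union> R))"
    using matching_hits_suffice[OF assms(1) a(1,2)] by blast
  have "\<exists>q C. 0 < q \<and> q \<le> 1 \<and> (\<forall>\<^sub>F n in sequentially. \<forall>H. uniform_hypergraph k {1..(k - 1) * n} H \<longrightarrow>
     (\<forall>S\<subseteq>{1..(k - 1) * n}. card S = k - 1 \<longrightarrow> a * real n \<le> real (card (nbs H {1..(k - 1) * n} S))) \<longrightarrow>
     hits_suffice q C k n ((k - 1) * n) (\<lambda>R. has_loose_Hamilton_cycle k {1..(k - 1) * n} (H \<union> R)))"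
  proof (cases "k = 2")
    case True
    obtain q C where h: "0 < q" "q \<le> 1" "\<forall>\<^sub>F n in sequentially. \<forall>H.
       (\<forall>S\<subseteq>{1..n}. card S = 1 \<longrightarrow> a * real n \<le> real (card (nbs H {1..n} S))) \<longrightarrow>
       hits_suffice q C 2 n n (\<lambda>R. has_loose_Hamilton_cycle 2 {1..n} (H \<union> R))"
      using hamilton_hits_suffice_graph[OF a(1,2)] by blast
    show ?thesis
      unfolding True by (intro exI[of _ q] exI[of _ C] conjI h(1,2) eventually_mono[OF h(3)]) simp
  next
    case False
    then show ?thesis using hamilton_hits_suffice[OF _ a(1,2), of k] assms(1) by simp
  qed
  then obtain q2 C2 where 2: "0 < q2" "q2 \<le> 1" "\<forall>\<^sub>F n in sequentially. \<forall>H. uniform_hypergraph k {1..(k - 1) * n} H \<longrightarrow>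
     (\<forall>S\<subseteq>{1..(k - 1) * n}. card S = k - 1 \<longrightarrow> a * real n \<le> real (card (nbs H {1..(k - 1) * n} S))) \<longrightarrow>
     hits_suffice q2 C2 k n ((k - 1) * n) (\<lambda>R. has_loose_Hamilton_cycle k {1..(k - 1) * n} (H \<union> R))"
    by blast
  \<comment> \<open>One constant for both parts. The absolute values avoid a case distinction on the
    signs of \<open>C1\<close> and \<open>C2\<close>, and the summand 1 makes the inequalities
    strict.\<close>
  define c where "c = \<bar>C1\<bar> / q1 + \<bar>C2\<bar> / q2 + 1"
  have c: "0 < c" "C1 < c * q1" "C2 < c * q2"
  proof -
    have nn: "0 \<le> \<bar>C1\<bar> / q1" "0 \<le> \<bar>C2\<bar> / q2" using 1(1) 2(1) by simp_all
    then show "0 < c" by (simp add: c_def)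
    have "\<bar>C1\<bar> < (\<bar>C1\<bar> / q1 + 1) * q1" using 1(1) by (simp add: distrib_right)
    also have "\<dots> \<le> c * q1" using nn 1(1) by (intro mult_right_mono) (simp_all add: c_def)
    finally show "C1 < c * q1" by linarith
    have "\<bar>C2\<bar> < (\<bar>C2\<bar> / q2 + 1) * q2" using 2(1) by (simp add: distrib_right)
    also have "\<dots> \<le> c * q2" using nn 2(1) by (intro mult_right_mono) (simp_all add: c_def)
    finally show "C2 < c * q2" by linarith
  qed
  show ?thesis
  proof (intro exI[of _ c] conjI allI impI)
    show "0 < c" by (rule c)
    fix H :: "nat \<Rightarrow> nat set set"
    assume H: "\<forall>\<^sub>F n in sequentially. uniform_hypergraph k {1..k * n} (H n) \<and>
         real (min_degree (k - 1) {1..k * n} (H n)) \<ge> \<alpha> * real n"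
    have "\<forall>\<^sub>F n in sequentially. hits_suffice q1 C1 k n (k * n) (\<lambda>R. has_perfect_matching {1..k * n} (H n \<union> R))"
      using H 1(3)
    proof eventually_elim
      case (elim n)
      then show ?case using cod[of "k * n" "H n" n] by simp
    qed
    then show "(\<lambda>n. measure_pmf.prob (random_hypergraph k (k * n) (nat \<lfloor>c * real n\<rfloor>))
         {R. has_perfect_matching {1..k * n} (H n \<union> R)}) \<longlonglongrightarrow> 1"
      using eventually_many_edges[OF assms(1), of k c] by (intro aas_of_hits_suffice[OF 1(1,2) c(2,1)]) simp_all
  next
    fix H :: "nat \<Rightarrow> nat set set"
    assume H: "\<forall>\<^sub>F n in sequentially. uniform_hypergraph k {1..(k - 1) * n} (H n) \<and>
         real (min_degree (k - 1) {1..(k - 1) * n} (H n)) \<ge> \<alpha> * real n"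
    have "\<forall>\<^sub>F n in sequentially. hits_suffice q2 C2 k n ((k - 1) * n) (\<lambda>R. has_loose_Hamilton_cycle k {1..(k - 1) * n} (H n \<union> R))"
      using H 2(3)
    proof eventually_elim
      case (elim n)
      then show ?case using cod[of "(k - 1) * n" "H n" n] by simp
    qed
    then show "(\<lambda>n. measure_pmf.prob (random_hypergraph k ((k - 1) * n) (nat \<lfloor>c * real n\<rfloor>))
         {R. has_loose_Hamilton_cycle k {1..(k - 1) * n} (H n \<union> R)}) \<longlonglongrightarrow> 1"
      using eventually_many_edges[OF assms(1), of "k - 1" c] by (intro aas_of_hits_suffice[OF 2(1,2) c(3,1)]) simp_all
  qed
qed

end
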